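(* Let $\lambda\in Cont^G(\hat G,\mathbb R_{>0}^{\tau_*})$ and let $u,v\in Cont^G(\hat G,\mathbb R^{\tau_*})$ be two tangent vectors based at $\lambda$. Then $$\omega_\lambda(u,v)=\lim_{n\to\infty}\frac{2}{k(n)}\sum_{T\in P_n}\eta_{\lambda,u,v}|_T,$$ where the sum is over all triangles $T$ complementary to $\tau_*$ in the fundamental polygon $P_n$, and $k(n)$ is the number of triangles in $P_n$.
   Context: **Setting.** $\mathbb D$ is the unit disk with its hyperbolic metric. $\tau_*$ is the Farey tesselation (a set of geodesic edges) of $\mathbb D$, obtained from the ideal triangle with vertices $1,-1,-i$ by repeated reflection in its sides; $PSL_2(\mathbb Z)$ is the group of orientation-preserving isometries preserving $\tau_*$. $G<PSL_2(\mathbb Z)$ is the once-punctured torus group (characteristic of index six), which has as fundamental domain the ideal quadrilateral with vertices $1,i,-1,-i$; $\hat G$ is its profinite completion. $Cont^G(\hat G,\mathbb R^{\tau_*})$ is the vector space of continuous functions $v:\hat G\to\mathbb R^{\tau_*}$ (supremum topology on $\mathbb R^{\tau_*}$), written $v(t,e)$, with $v(t\gamma^{-1},\gamma e)=v(t,e)$ for all $\gamma\in G$; $Cont^G(\hat G,\mathbb R_{>0}^{\tau_*})$ is the subset of positive ones (this is the decorated Teichmüller space of the punctured solenoid $(\mathbb D\times\hat G)/G$ in lambda length coordinates; its tangent space at each point is $Cont^G(\hat G,\mathbb R^{\tau_*})$). **Local form.** For a triangle with lambda lengths $(a,b,c)$ of its edges in counterclockwise order consider the two form $$-2(d\log a\wedge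 d\log b+d\log b\wedge d\log c+d\log c\wedge d\log a).$$ For $t\in\hat G$ and $i=1,2$, $\eta^i_{\lambda,u,v}(t)$ is its value for the triangle $T_i$ at $\lambda(t,\cdot)$ on the vectors $u(t,\cdot),v(t,\cdot)$, where $T_1$ has vertices $-1,-i,1$ and $T_2$ has vertices $1,i,-1$. For a triangle $T$ complementary to $\tau_*$, $\eta_{\lambda,u,v}|_T$ is its value for $T$ at $\lambda(id,\cdot)$ on $u(id,\cdot),v(id,\cdot)$. **Weil-Petersson form.** $\omega_\lambda(u,v)=\int_{\hat G}[\eta^1_{\lambda,u,v}(t)+\eta^2_{\lambda,u,v}(t)]\,dm(t)$, with $m$ the Haar probability measure on $\hat G$. **Polygons.** $G_n$ is the characteristic subgroup of $PSL_2(\mathbb Z)$ given by the intersection of all subgroups of index at most $n$, so $\bigcap_nG_n=\{id\}$. $P_n$ is a nested sequence of fundamental polygons for $G_n$ whose frontier edges belong to $\tau_*$. *)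

theory Defs
  imports
    "HOL-Complex_Analysis.Complex_Analysis"
    "HOL-Probability.Probability"
    "HOL-Algebra.Bij"
    "HOL-Algebra.Generated_Groups"
begin

section \<open>The Farey tesselation\<close>

text \<open>
  A geodesic of the disk is recorded by the set of its two ideal endpoints, and an ideal triangle
  by the set of its three ideal vertices.  The corresponding region of the disk is its
  \<^emph>\<open>ideal hull\<close>: the map \<open>z \<mapsto> 2z / (1 + |z|\<^sup>2)\<close> is the isometry from the Poincare disk onto the
  Klein disk; it fixes the ideal boundary and takes geodesics to chords, so hyperbolic convex hulls
  become Euclidean ones.
\<close>

type_synonym edge = "complex set"
type_synonym triangle = "complex set"

definition ideal_hull :: "complex set \<Rightarrow> complex set" where
  "ideal_hull V = {z \<in> ball 0 1. (2 / (1 + (norm z)\<^sup>2)) *\<^sub>R z \<in> convex hull V}"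

text \<open>
  Hyperbolic reflection in the geodesic with ideal endpoints \<open>p\<close> and \<open>q\<close>: if \<open>p + q \<noteq> 0\<close>, inversion
  in the circle with centre \<open>2pq / (p + q)\<close> that is orthogonal to the unit circle at \<open>p\<close> and \<open>q\<close>;
  if \<open>q = -p\<close>, Euclidean reflection in the diameter.
\<close>

definition geodesic_reflection :: "complex \<Rightarrow> complex \<Rightarrow> complex \<Rightarrow> complex" where
  "geodesic_reflection p q z = (2 * p * q * cnj z - (p + q)) / ((p + q) * cnj z - 2)"

inductive_set farey_triangles :: "triangle set" where
  base: "{1, -1, -\<i>} \<in> farey_triangles"
| reflect: "T \<in> farey_triangles \<Longrightarrow> p \<in> T \<Longrightarrow> q \<in> T \<Longrightarrow> p \<noteq> q
    \<Longrightarrow> geodesic_reflection p q ` T \<in> farey_triangles"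

definition farey_edges :: "edge set" where
  "farey_edges = {{p, q} | p q. p \<noteq> q \<and> (\<exists>T\<in>farey_triangles. {p, q} \<subseteq> T)}"


section \<open>The modular group and the once-punctured torus group\<close>

text \<open>
  The orientation-preserving isometries of the hyperbolic disk are the Moebius transformations
  \<^const>\<open>Moebius_function\<close>.  They are taken as functions on the closed disk, so that they also act on
  ideal points; the group law is composition.
\<close>

definition disk_isometries :: "(complex \<Rightarrow> complex) set" where
  "disk_isometries = {restrict (Moebius_function t w) (cball 0 1) | t w. norm w < 1}"

definition PSL2Z :: "(complex \<Rightarrow> complex) monoid" where
  "PSL2Z = (BijGroup (cball 0 1))
     \<lparr>carrier := {f \<in> disk_isometries. (`) f ` farey_edges = farey_edges}\<rparr>"

text \<open>
  The once-punctured torus group is generated by the two elements that identify opposite sides of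
  the ideal quadrilateral with vertices \<open>1, \<i>, -1, -\<i>\<close>, reversing the boundary orientation.
\<close>

definition torus_group :: "(complex \<Rightarrow> complex) monoid" where
  "torus_group = PSL2Z\<lparr>carrier := generate PSL2Z
     {f \<in> carrier PSL2Z. (f 1 = -\<i> \<and> f \<i> = -1) \<or> (f \<i> = 1 \<and> f (-1) = -\<i>)}\<rparr>"

definition index_intersection :: "nat \<Rightarrow> (complex \<Rightarrow> complex) set" where
  "index_intersection n = {f \<in> carrier PSL2Z. \<forall>H. subgroup H PSL2Z \<and>
     finite (rcosets\<^bsub>PSL2Z\<^esub> H) \<and> card (rcosets\<^bsub>PSL2Z\<^esub> H) \<le> n \<longrightarrow> f \<in> H}"


section \<open>Profinite completion and Haar measure\<close>

definition finite_index_normals :: "('a, 'b) monoid_scheme \<Rightarrow> 'a set set" where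
  "finite_index_normals G = {N. N \<lhd> G \<and> finite (rcosets\<^bsub>G\<^esub> N)}"

text \<open>
  The inverse limit of the finite quotients.  For \<open>N \<subseteq> M\<close> the projection from \<open>G / N\<close> to \<open>G / M\<close>
  takes a coset of \<open>N\<close> to the coset of \<open>M\<close> containing it.
\<close>

definition profinite_completion ::
    "('a, 'b) monoid_scheme \<Rightarrow> ('a set \<Rightarrow> 'a set) monoid" where
  "profinite_completion G =
    \<lparr>carrier = {t \<in> (\<Pi>\<^sub>E N\<in>finite_index_normals G. carrier (G Mod N)).
        \<forall>N\<in>finite_index_normals G. \<forall>M\<in>finite_index_normals G. N \<subseteq> M \<longrightarrow> t N \<subseteq> t M},
     mult = (\<lambda>s t. \<lambda>N\<in>finite_index_normals G. s N \<otimes>\<^bsub>G Mod N\<^esub> t N),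
     one = (\<lambda>N\<in>finite_index_normals G. \<one>\<^bsub>G Mod N\<^esub>)\<rparr>"

definition profinite_topology :: "('a, 'b) monoid_scheme \<Rightarrow> ('a set \<Rightarrow> 'a set) topology" where
  "profinite_topology G =
    subtopology
      (product_topology (\<lambda>N. discrete_topology (carrier (G Mod N))) (finite_index_normals G))
      (carrier (profinite_completion G))"

definition profinite_embedding :: "('a, 'b) monoid_scheme \<Rightarrow> 'a \<Rightarrow> 'a set \<Rightarrow> 'a set" where
  "profinite_embedding G g = (\<lambda>N\<in>finite_index_normals G. N #>\<^bsub>G\<^esub> g)"

text \<open>
  The groups below are compact and metrizable, so regularity of the measure is automatic and left
  invariance implies right invariance.
\<close>

definition haar_probability :: "('a, 'b) monoid_scheme \<Rightarrow> 'a topology \<Rightarrow> 'a measure \<Rightarrow> bool" where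
  "haar_probability H X m \<longleftrightarrow>
     prob_space m \<and> space m = carrier H \<and> sets m = sigma_sets (carrier H) {U. openin X U} \<and>
     (\<forall>g\<in>carrier H. \<forall>A\<in>sets m. emeasure m (g <#\<^bsub>H\<^esub> A) = emeasure m A)"


section \<open>Equivariant continuous functions\<close>

text \<open>
  The supremum topology on the space of all real functions on a set \<open>S\<close>.  The functions may be
  unbounded, so suprema of differences can be infinite; the neighbourhoods are those of uniform
  convergence on \<open>S\<close>.
\<close>

definition sup_topology :: "'e set \<Rightarrow> ('e \<Rightarrow> real) topology" where
  "sup_topology S = topology (\<lambda>U. U \<subseteq> extensional S \<and>
     (\<forall>f\<in>U. \<exists>\<epsilon>>0. \<forall>g\<in>extensional S. (\<forall>e\<in>S. \<bar>g e - f e\<bar> < \<epsilon>) \<longrightarrow> g \<in> U))"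

lemma openin_sup_topology:
  "openin (sup_topology S) U \<longleftrightarrow> U \<subseteq> extensional S \<and>
     (\<forall>f\<in>U. \<exists>\<epsilon>>0. \<forall>g\<in>extensional S. (\<forall>e\<in>S. \<bar>g e - f e\<bar> < \<epsilon>) \<longrightarrow> g \<in> U)"
proof -
  define L where "L = (\<lambda>U. U \<subseteq> extensional S \<and>
     (\<forall>f\<in>U. \<exists>\<epsilon>>0. \<forall>g\<in>extensional S. (\<forall>e\<in>S. \<bar>g e - f e\<bar> < (\<epsilon>::real)) \<longrightarrow> g \<in> U))"
  have inter: "L (U \<inter> V)" if LU: "L U" and LV: "L V" for U V
    unfolding L_def
  proof (intro conjI ballI)
    show "U \<inter> V \<subseteq> extensional S" using LU by (auto simp: L_def)
    fix f assume f: "f \<in> U \<inter> V"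
    obtain a where a: "a > 0" "\<forall>g\<in>extensional S. (\<forall>e\<in>S. \<bar>g e - f e\<bar> < a) \<longrightarrow> g \<in> U"
      using LU f unfolding L_def by blast
    obtain b where b: "b > 0" "\<forall>g\<in>extensional S. (\<forall>e\<in>S. \<bar>g e - f e\<bar> < b) \<longrightarrow> g \<in> V"
      using LV f unfolding L_def by blast
    show "\<exists>\<epsilon>>0. \<forall>g\<in>extensional S. (\<forall>e\<in>S. \<bar>g e - f e\<bar> < \<epsilon>) \<longrightarrow> g \<in> U \<inter> V"
      using a b by (intro exI[of _ "min a b"]) auto
  qed
  have union: "L (\<Union>\<K>)" if "\<forall>K\<in>\<K>. L K" for \<K>
    using that unfolding L_def by (fastforce simp: Union_iff)
  have "istopology L"
    using inter union unfolding istopology_def by blast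
  then show ?thesis
    unfolding sup_topology_def by (simp add: topology_inverse' L_def)
qed

type_synonym ghat = "(complex \<Rightarrow> complex) set \<Rightarrow> (complex \<Rightarrow> complex) set"

abbreviation Ghat :: "ghat monoid" where
  "Ghat \<equiv> profinite_completion torus_group"

abbreviation Ghat_topology :: "ghat topology" where
  "Ghat_topology \<equiv> profinite_topology torus_group"

definition ContG :: "(ghat \<Rightarrow> edge \<Rightarrow> real) set" where
  "ContG = {v. continuous_map Ghat_topology (sup_topology farey_edges) v \<and>
     (\<forall>g\<in>carrier torus_group. \<forall>t\<in>carrier Ghat. \<forall>e\<in>farey_edges.
        v (t \<otimes>\<^bsub>Ghat\<^esub> inv\<^bsub>Ghat\<^esub> (profinite_embedding torus_group g)) (g ` e) = v t e)}"

definition ContG_pos :: "(ghat \<Rightarrow> edge \<Rightarrow> real) set" where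
  "ContG_pos = {v \<in> ContG. \<forall>t\<in>carrier Ghat. \<forall>e\<in>farey_edges. v t e > 0}"


section \<open>The Weil-Petersson form\<close>

text \<open>
  The value of the one form \<open>d log e\<close> at the point \<open>l\<close> on the vector \<open>u\<close>, and the value of
  \<open>d log a \<and> d log b\<close> on \<open>(u, v)\<close>.
\<close>

definition dlog :: "(edge \<Rightarrow> real) \<Rightarrow> edge \<Rightarrow> (edge \<Rightarrow> real) \<Rightarrow> real" where
  "dlog l e u = u e / l e"

definition dlog_wedge ::
    "(edge \<Rightarrow> real) \<Rightarrow> edge \<Rightarrow> edge \<Rightarrow> (edge \<Rightarrow> real) \<Rightarrow> (edge \<Rightarrow> real) \<Rightarrow> real" where
  "dlog_wedge l a b u v = dlog l a u * dlog l b v - dlog l a v * dlog l b u"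

definition local_form ::
    "(edge \<Rightarrow> real) \<Rightarrow> (edge \<Rightarrow> real) \<Rightarrow> (edge \<Rightarrow> real) \<Rightarrow> edge \<Rightarrow> edge \<Rightarrow> edge \<Rightarrow> real" where
  "local_form l u v a b c =
     -2 * (dlog_wedge l a b u v + dlog_wedge l b c u v + dlog_wedge l c a u v)"

definition counterclockwise :: "complex \<Rightarrow> complex \<Rightarrow> complex \<Rightarrow> bool" where
  "counterclockwise p q r \<longleftrightarrow> Im (cnj (q - p) * (r - p)) > 0"

text \<open>
  The local form depends only on the cyclic order of the edges, so the following value is
  determined by the triangle; see the subsequent lemma.
\<close>

definition triangle_form ::
    "(edge \<Rightarrow> real) \<Rightarrow> (edge \<Rightarrow> real) \<Rightarrow> (edge \<Rightarrow> real) \<Rightarrow> triangle \<Rightarrow> real" where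
  "triangle_form l u v T =
     (THE x. \<exists>p q r. T = {p, q, r} \<and> counterclockwise p q r \<and>
        x = local_form l u v {p, q} {q, r} {r, p})"

lemma triangle_form_eq:
  assumes ccw: "counterclockwise p q r"
  shows "triangle_form l u v {p, q, r} = local_form l u v {p, q} {q, r} {r, p}"
  unfolding triangle_form_def
proof (rule the_equality)
  show "\<exists>p' q' r'. {p, q, r} = {p', q', r'} \<and> counterclockwise p' q' r' \<and>
      local_form l u v {p, q} {q, r} {r, p} = local_form l u v {p', q'} {q', r'} {r', p'}"
    using ccw by blast
next
  fix x
  assume "\<exists>p' q' r'. {p, q, r} = {p', q', r'} \<and> counterclockwise p' q' r' \<and>
      x = local_form l u v {p', q'} {q', r'} {r', p'}"
  then obtain p' q' r' where eq: "{p, q, r} = {p', q', r'}"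
    and ccw': "counterclockwise p' q' r'"
    and x: "x = local_form l u v {p', q'} {q', r'} {r', p'}" by blast
  have distinct: "a \<noteq> b \<and> b \<noteq> c \<and> a \<noteq> c" if "counterclockwise a b c" for a b c
    using that by (auto simp: counterclockwise_def algebra_simps)
  have swap: "\<not> counterclockwise b a c \<and> \<not> counterclockwise a c b \<and> \<not> counterclockwise c b a"
    if "counterclockwise a b c" for a b c
    using that by (simp add: counterclockwise_def algebra_simps)
  have "(p' = p \<and> q' = q \<and> r' = r) \<or> (p' = q \<and> q' = r \<and> r' = p) \<or> (p' = r \<and> q' = p \<and> r' = q)"
  proof -
    have "p' \<in> {p, q, r}" "q' \<in> {p, q, r}" "r' \<in> {p, q, r}" using eq by auto
    then show ?thesis
      using distinct[OF ccw'] swap[OF ccw] ccw' by auto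
  qed
  then show "x = local_form l u v {p, q} {q, r} {r, p}"
    using x by (auto simp: local_form_def)
qed

definition weil_petersson_form ::
    "ghat measure \<Rightarrow> (ghat \<Rightarrow> edge \<Rightarrow> real) \<Rightarrow> (ghat \<Rightarrow> edge \<Rightarrow> real)
       \<Rightarrow> (ghat \<Rightarrow> edge \<Rightarrow> real) \<Rightarrow> real" where
  "weil_petersson_form m lam u v =
     (LINT t|m. triangle_form (lam t) (u t) (v t) {-1, -\<i>, 1}
              + triangle_form (lam t) (u t) (v t) {1, \<i>, -1})"


section \<open>Fundamental polygons\<close>

text \<open>
  A polygon with frontier edges in the Farey tesselation: a closed region of the disk with connected
  interior whose frontier in the disk is a finite union of Farey geodesics.
\<close>

definition farey_polygon :: "complex set \<Rightarrow> bool" where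
  "farey_polygon P \<longleftrightarrow>
     P \<subseteq> ball 0 1 \<and> P = ball 0 1 \<inter> closure (interior P) \<and>
     interior P \<noteq> {} \<and> connected (interior P) \<and>
     (\<exists>E. finite E \<and> E \<subseteq> farey_edges \<and> ball 0 1 \<inter> frontier P = (\<Union>e\<in>E. ideal_hull e))"

definition fundamental_polygon :: "(complex \<Rightarrow> complex) set \<Rightarrow> complex set \<Rightarrow> bool" where
  "fundamental_polygon \<Gamma> P \<longleftrightarrow>
     farey_polygon P \<and> (\<Union>g\<in>\<Gamma>. g ` P) = ball 0 1 \<and>
     (\<forall>g\<in>\<Gamma>. g \<noteq> \<one>\<^bsub>PSL2Z\<^esub> \<longrightarrow> g ` interior P \<inter> interior P = {})"

definition triangles_in :: "complex set \<Rightarrow> triangle set" where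
  "triangles_in P = {T \<in> farey_triangles. ideal_hull T \<subseteq> P}"

end

theory Submission
  imports Defs
begin

text \<open>
  By equivariance, the local form at the identity on a triangle \<open>g T\<^sub>i\<close> with \<open>g\<close> in the torus group
  is the value at \<open>g\<close> of the continuous function \<open>\<eta>\<^sup>i\<close> on the profinite completion.  Every Farey
  triangle has the form \<open>g T\<^sub>i\<close>.  A fundamental polygon for \<open>G\<^sub>n\<close> is a union of Farey triangles, because
  Farey edges do not cross them; hence, for each \<open>i\<close>, the elements \<open>g\<close> with \<open>g T\<^sub>i\<close> in the polygon form a
  transversal of the cosets of \<open>G\<^sub>n\<close>.  The average over the polygon is therefore a Riemann sum over the
  cosets of the closure of \<open>G\<^sub>n\<close>.  These are clopen of equal Haar measure, and they become arbitrarily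
  small because every subgroup of finite index contains some \<open>G\<^sub>n\<close>.

  Rotation by \<open>\<pi>\<close> normalizes the torus group and exchanges \<open>T\<^sub>1\<close> and \<open>T\<^sub>2\<close>, so all Farey triangles have
  the same number of representations \<open>g T\<^sub>i\<close>, and this number cancels in the average.
\<close>

section \<open>Subgroups of finite index\<close>

text \<open>The modular group is given by its action on edges, the tesselation by reflections and
  the torus group by prescribed values at ideal points, so facts usually read off from integer
  matrices have to be recovered. They come from one arithmetic model: ideal vertices are Cayley
  images of rational numbers, and edges are pairs of integer vectors of determinant 1 or -1.
  Noncrossing becomes a statement about signs of such determinants. The Klein disk links it to
  geometry, because isometries act there as projective maps with positive weights.

  That G_n has finite index is not part of its definition; it rests on the fact that a finitely
  generated group has only finitely many subgroups of bounded index. The inclusion of G_n in the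
  torus group holds only for large n (G_1 is the whole modular group), so the averages are compared
  from some index on.

  The factor 2 arises because each of the two base triangles contributes one group element per
  coset: if c is the index of G_n in the torus group and s the common number of representations of a
  triangle, then 2c = s k(n).\<close>

lemma (in group) r_coset_eq_iff:
  assumes "subgroup H G" "x \<in> carrier G" "y \<in> carrier G"
  shows "H #> x = H #> y \<longleftrightarrow> x \<otimes> inv y \<in> H"
proof
  assume "H #> x = H #> y"
  then have "x \<in> H #> y" using assms rcos_self by blast
  then show "x \<otimes> inv y \<in> H"
    using assms subgroup.rcos_module_imp[OF assms(1) is_group] by blast
next
  assume "x \<otimes> inv y \<in> H"
  then have "x \<in> H #> y"
    using assms subgroup.rcos_module_rev[OF assms(1) is_group] by blast
  then show "H #> x = H #> y" using assms repr_independence by blast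
qed

lemma rcosets_image: "rcosets\<^bsub>G\<^esub> H = (\<lambda>x. H #>\<^bsub>G\<^esub> x) ` carrier G"
  by (auto simp: RCOSETS_def)

text \<open>A value of \<open>f\<close> determines the coset of each of its preimages, so every
  coset is recovered from a value by choosing a preimage. The index bounds below all come from this,
  with different maps \<open>f\<close> that separate cosets.\<close>

lemma (in group) rcosets_card_le:
  assumes H: "subgroup H G" and f: "finite (f ` carrier G)"
    and inj: "\<And>x y. x \<in> carrier G \<Longrightarrow> y \<in> carrier G \<Longrightarrow> f x = f y \<Longrightarrow> x \<otimes> inv y \<in> H"
  shows "finite (rcosets H) \<and> card (rcosets H) \<le> card (f ` carrier G)"
proof -
  have sub: "rcosets H \<subseteq> (\<lambda>c. H #> (SOME x. x \<in> carrier G \<and> f x = c)) ` (f ` carrier G)"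
  proof
    fix C assume "C \<in> rcosets H"
    then obtain x where x: "x \<in> carrier G" "C = H #> x" by (auto simp: rcosets_image)
    define y where "y = (SOME y. y \<in> carrier G \<and> f y = f x)"
    have y: "y \<in> carrier G \<and> f y = f x" unfolding y_def by (rule someI[of _ x]) (use x in auto)
    have "C = H #> y" using r_coset_eq_iff[OF H] x y inj by simp
    then show "C \<in> (\<lambda>c. H #> (SOME x. x \<in> carrier G \<and> f x = c)) ` (f ` carrier G)"
      using x unfolding y_def by blast
  qed
  show ?thesis using sub f by (meson surj_card_le finite_surj)
qed

text \<open>The tuple of cosets with respect to the members of \<open>S\<close> separates the cosets
  of \<open>I\<close>, as in Poincare's theorem on intersections.\<close>

lemma (in group) rcosets_Int_finite:
  assumes S: "finite S" "\<And>H. H \<in> S \<Longrightarrow> subgroup H G \<and> finite (rcosets H)"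
    and I: "subgroup I G" "carrier G \<inter> \<Inter>S \<subseteq> I"
  shows "finite (rcosets I)"
proof -
  define f where "f x = (\<lambda>H\<in>S. H #> x)" for x
  have "f ` carrier G \<subseteq> (\<Pi>\<^sub>E H\<in>S. rcosets H)"
    by (auto simp: f_def rcosets_image)
  then have "finite (f ` carrier G)"
    using S by (meson finite_PiE finite_subset)
  moreover have "x \<otimes> inv y \<in> I" if x: "x \<in> carrier G" "y \<in> carrier G" and e: "f x = f y" for x y
  proof -
    have "x \<otimes> inv y \<in> H" if "H \<in> S" for H
      using fun_cong[OF e, of H] that S(2)[OF that] r_coset_eq_iff[of H x y] x by (simp add: f_def)
    then show ?thesis using I(2) x by auto
  qed
  ultimately show ?thesis using rcosets_card_le[OF I(1)] by blast
qed

definition bounded_index_subgroups :: "('a, 'b) monoid_scheme \<Rightarrow> nat \<Rightarrow> 'a set set" where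
  "bounded_index_subgroups G n =
     {H. subgroup H G \<and> finite (rcosets\<^bsub>G\<^esub> H) \<and> card (rcosets\<^bsub>G\<^esub> H) \<le> n}"

text \<open>A subgroup is the stabilizer of a point in the action on its own cosets. Once at most
  \<open>n\<close> cosets are labelled by numbers below \<open>n\<close>, this action is determined
  by what the generators do, and only finitely many such tables exist.\<close>

lemma (in group) finite_bounded_index_subgroups:
  assumes S: "finite S" "S \<subseteq> carrier G" and gen: "carrier G = generate G S"
  shows "finite (bounded_index_subgroups G n)"
proof -
  \<comment> \<open>Words in \<open>generate\<close> may contain inverses of generators, so their
    action is recorded as well.\<close>
  define S' where "S' = S \<union> m_inv G ` S"
  have S': "finite S'" "S' \<subseteq> carrier G" using S by (auto simp: S'_def)
  \<comment> \<open>Any labelling will do: subgroups with the same code coincide even though their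
    labellings are chosen independently.\<close>
  define enum where "enum H = (SOME e. inj_on e (rcosets H) \<and> e ` (rcosets H) \<subseteq> {..<n})" for H
  have enum: "inj_on (enum H) (rcosets H) \<and> enum H ` (rcosets H) \<subseteq> {..<n}"
    if "H \<in> bounded_index_subgroups G n" for H
  proof -
    have "\<exists>e. inj_on e (rcosets H) \<and> e ` (rcosets H) \<subseteq> {..<n}"
      using that card_le_inj[of "rcosets H" "{..<n}"] by (auto simp: bounded_index_subgroups_def)
    then show ?thesis unfolding enum_def by (rule someI_ex)
  qed
  define pos where "pos H x = enum H (H #> x)" for H x
  \<comment> \<open>Numbers that label no coset are sent to 0; the codomain
    \<open>{..<Suc n}\<close> used below has room for this value.\<close>
  define act where "act H = (\<lambda>p\<in>S' \<times> {..<n}.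
     if snd p \<in> enum H ` (rcosets H) then enum H (inv_into (rcosets H) (enum H) (snd p) #> fst p)
         else 0)" for H
  define code where "code H = (pos H \<one>, act H)" for H
  have in_rc: "H #> x \<in> rcosets H" if "x \<in> carrier G" for H x
    using that by (auto simp: rcosets_image)
  have pos_lt: "pos H x < n" if "H \<in> bounded_index_subgroups G n" "x \<in> carrier G" for H x
    using enum[OF that(1)] in_rc[OF that(2)] by (auto simp: pos_def)
  have pos_act: "pos H (x \<otimes> s) = act H (s, pos H x)"
    if H: "H \<in> bounded_index_subgroups G n" and x: "x \<in> carrier G" and s: "s \<in> S'" for H x s
  proof -
    have sub: "H \<subseteq> carrier G" using H by (auto simp: bounded_index_subgroups_def dest:
        subgroup.subset)
    have "inv_into (rcosets H) (enum H) (pos H x) = H #> x"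
      unfolding pos_def using enum[OF H] in_rc[OF x] by (simp add: inv_into_f_f)
    moreover have "H #> x #> s = H #> (x \<otimes> s)" using coset_mult_assoc sub x s S' by blast
    ultimately show ?thesis
      using pos_lt[OF H x] s in_rc[OF x, of H] by (auto simp: act_def pos_def)
  qed
  have "inj_on code (bounded_index_subgroups G n)"
  proof (rule inj_onI)
    fix H K assume H: "H \<in> bounded_index_subgroups G n" and K: "K \<in> bounded_index_subgroups G n"
      and e: "code H = code K"
    \<comment> \<open>The starting point \<open>y\<close> is quantified so that the product case can
      use the hypothesis for \<open>h2\<close> at \<open>y \<otimes> h1\<close>.\<close>
    have step: "\<forall>y\<in>carrier G. pos H y = pos K y \<longrightarrow> pos H (y \<otimes> x) = pos K (y \<otimes> x)"
      if "x \<in> generate G S" for x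
      using that
    proof induction
      case one then show ?case by simp
    next
      case (incl h) then show ?case using pos_act H K e by (auto simp: code_def S'_def)
    next
      case (inv h) then show ?case using pos_act H K e by (auto simp: code_def S'_def)
    next
      case (eng h1 h2)
      then have "h1 \<in> carrier G" "h2 \<in> carrier G" using gen by auto
      then show ?case using eng.IH by (metis m_assoc m_closed)
    qed
    have same: "pos H x = pos K x" if "x \<in> carrier G" for x
      using step[of x] that gen e by (metis code_def fst_conv l_one one_closed)
    \<comment> \<open>\<open>L\<close> is the stabilizer of its own label, hence determined by the
      base label and the action.\<close>
    have mem: "x \<in> L \<longleftrightarrow> x \<in> carrier G \<and> pos L x = pos L \<one>" if L: "L \<in> bounded_index_subgroups G n"
        for x L
    proof -
      have sg: "subgroup L G" using L by (simp add: bounded_index_subgroups_def)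
      have "pos L x = pos L \<one> \<longleftrightarrow> L #> x = L #> \<one>" if x: "x \<in> carrier G"
        unfolding pos_def
        using inj_on_eq_iff[OF conjunct1[OF enum[OF L]] in_rc[OF x] in_rc[OF one_closed]] .
      moreover have "L #> x = L #> \<one> \<longleftrightarrow> x \<in> L" if x: "x \<in> carrier G"
        using r_coset_eq_iff[OF sg x one_closed] x by simp
      ultimately show ?thesis using subgroup.subset[OF sg] by blast
    qed
    show "H = K" using mem[OF H] mem[OF K] same by auto
  qed
  moreover have "code ` bounded_index_subgroups G n \<subseteq> {..<n} \<times> (\<Pi>\<^sub>E p\<in>S' \<times> {..<n}. {..<Suc n})"
  proof (clarsimp simp: code_def pos_lt)
    fix H assume H: "H \<in> bounded_index_subgroups G n"
    have sg: "subgroup H G" using H by (simp add: bounded_index_subgroups_def)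
    have "enum H (C #> s) < Suc n" if C: "C \<in> rcosets H" and s': "s \<in> S'" for C s
    proof -
      obtain x where x: "x \<in> carrier G" "C = H #> x" using C by (auto simp: rcosets_image)
      have s: "s \<in> carrier G" using s' S' by auto
      have "C #> s = H #> (x \<otimes> s)" using coset_mult_assoc[OF subgroup.subset[OF sg]] x s by simp
      then show ?thesis using pos_lt[OF H, of "x \<otimes> s"] x s by (simp add: pos_def)
    qed
    then show "act H \<in> (\<Pi>\<^sub>E p\<in>S' \<times> {..<n}. {..<Suc n})"
      unfolding act_def
      by (intro restrict_PiE_iff[THEN iffD2] ballI) (auto simp: inv_into_into)
  qed
  ultimately show ?thesis
    using S'(1) by (meson finite_PiE finite_SigmaI finite_lessThan finite_imageD finite_subset)
qed

lemma (in group) mult_inv_cancel_right: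
  assumes "x \<in> carrier G" "y \<in> carrier G" "r \<in> carrier G"
  shows "x \<otimes> r \<otimes> inv (y \<otimes> r) = x \<otimes> inv y"
proof -
  have "r \<otimes> (inv r \<otimes> inv y) = inv y" using m_assoc[of r "inv r" "inv y"] assms by simp
  then show ?thesis using assms by (simp add: inv_mult_group m_assoc)
qed

text \<open>A quotient of two elements of \<open>G'\<close> lies in \<open>G'\<close> anyway, so the
  cosets of \<open>H\<close> already separate the cosets of the intersection inside
  \<open>G'\<close>.\<close>

lemma (in group) finite_rcosets_restrict:
  assumes G': "subgroup G' G" and H: "subgroup H G" "finite (rcosets H)"
  shows "subgroup (H \<inter> G') (G\<lparr>carrier := G'\<rparr>)"
    and "finite (rcosets\<^bsub>G\<lparr>carrier := G'\<rparr>\<^esub> (H \<inter> G'))"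
    and "card (rcosets\<^bsub>G\<lparr>carrier := G'\<rparr>\<^esub> (H \<inter> G')) \<le> card (rcosets H)"
proof -
  let ?G = "G\<lparr>carrier := G'\<rparr>"
  interpret G': group ?G by (rule subgroup.subgroup_is_group[OF G' is_group])
  have sub: "G' \<subseteq> carrier G" by (rule subgroup.subset[OF G'])
  show sg: "subgroup (H \<inter> G') ?G"
    using subgroups_Inter_pair[OF H(1) G'] subgroup_incl[OF _ G', of "H \<inter> G'"] by simp
  have im: "(\<lambda>x. H #> x) ` carrier ?G \<subseteq> rcosets H" using sub by (auto simp: rcosets_image)
  have inj: "x \<otimes>\<^bsub>?G\<^esub> inv\<^bsub>?G\<^esub> y \<in> H \<inter> G'"
    if "x \<in> carrier ?G" "y \<in> carrier ?G" "H #> x = H #> y" for x y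
  proof -
    have xy: "x \<in> G'" "y \<in> G'" using that by auto
    have "x \<otimes> inv y \<in> H" using r_coset_eq_iff[OF H(1)] that(3) xy sub by blast
    moreover have "x \<otimes> inv y \<in> G'" using xy subgroup.m_closed[OF G'] subgroup.m_inv_closed[OF G']
        by blast
    ultimately show ?thesis using m_inv_consistent[OF G' xy(2)] by simp
  qed
  have "finite ((\<lambda>x. H #> x) ` carrier ?G)" using im H(2) by (rule finite_subset)
  then have r: "finite (rcosets\<^bsub>?G\<^esub> (H \<inter> G')) \<and> card (rcosets\<^bsub>?G\<^esub> (H \<inter> G')) \<le> card ((\<lambda>x. H #> x) `
      carrier ?G)"
    by (rule G'.rcosets_card_le[OF sg _ inj])
  then show "finite (rcosets\<^bsub>?G\<^esub> (H \<inter> G'))" by (rule conjunct1)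
  show "card (rcosets\<^bsub>?G\<^esub> (H \<inter> G')) \<le> card (rcosets H)"
    using conjunct2[OF r] card_mono[OF H(2) im] by (rule order_trans)
qed

text \<open>Write \<open>x\<close> as an element of \<open>G'\<close> times the chosen
  representative of its \<open>G'\<close>-coset. The \<open>G'\<close>-coset together with the
  \<open>M\<close>-coset of the first factor separates the cosets of \<open>M\<close>.\<close>

lemma (in group) finite_rcosets_trans:
  assumes G': "subgroup G' G" "finite (rcosets G')"
    and M: "subgroup M (G\<lparr>carrier := G'\<rparr>)" "finite (rcosets\<^bsub>G\<lparr>carrier := G'\<rparr>\<^esub> M)"
  shows "subgroup M G" "finite (rcosets M)"
proof -
  show sg: "subgroup M G" by (rule incl_subgroup[OF G'(1) M(1)])
  define rep where "rep C = (SOME y. y \<in> C)" for C :: "'a set"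
  have rep: "rep (G' #> x) \<in> G' #> x" if "x \<in> carrier G" for x
    unfolding rep_def by (rule someI) (rule rcos_self[OF that G'(1)])
  have repc: "rep (G' #> x) \<in> carrier G" if "x \<in> carrier G" for x
    using rep[OF that] r_coset_subset_G[OF subgroup.subset[OF G'(1)] that] by blast
  have inG': "x \<otimes> inv rep (G' #> x) \<in> G'" if x: "x \<in> carrier G" for x
    using r_coset_eq_iff[OF G'(1) x repc[OF x]] repr_independence[OF rep[OF x] x G'(1)] by simp
  define f where "f x = (G' #> x, M #> (x \<otimes> inv rep (G' #> x)))" for x
  have "f ` carrier G \<subseteq> (rcosets G') \<times> (rcosets\<^bsub>G\<lparr>carrier := G'\<rparr>\<^esub> M)"
    using inG' by (auto simp: f_def rcosets_image)
  then have fin: "finite (f ` carrier G)" using G'(2) M(2) finite_subset by blast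
  have inj: "x \<otimes> inv y \<in> M" if x: "x \<in> carrier G" and y: "y \<in> carrier G" and e: "f x = f y" for x y
  proof -
    have e1: "G' #> x = G' #> y" and e2: "M #> (x \<otimes> inv rep (G' #> x)) = M #> (y \<otimes> inv rep (G' #>
        y))"
      using e unfolding f_def prod.inject by (rule conjunct1, rule conjunct2)
    \<comment> \<open>\<open>rep\<close> depends only on the coset, so \<open>x\<close> and
      \<open>y\<close> share the same \<open>r\<close>, which cancels in the quotient.\<close>
    define r where "r = inv rep (G' #> y)"
    have r: "r \<in> carrier G" using repc[OF y] by (simp add: r_def)
    have "M #> (x \<otimes> r) = M #> (y \<otimes> r)" using e2 by (simp only: r_def e1)
    then have "(x \<otimes> r) \<otimes> inv (y \<otimes> r) \<in> M" using r_coset_eq_iff[OF sg] x y r by simp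
    then show ?thesis using mult_inv_cancel_right[OF x y r] by simp
  qed
  show "finite (rcosets M)" using rcosets_card_le[OF sg fin inj] by blast
qed

text \<open>The coset of \<open>x \<otimes> y\<close> modulo \<open>H\<close> separates the cosets
  of the conjugate subgroup, so conjugation does not raise the index. This is what makes G_n
  normal.\<close>

lemma (in group) bounded_index_conjugate:
  assumes H: "H \<in> bounded_index_subgroups G n" and x: "x \<in> carrier G"
  shows "{y \<in> carrier G. x \<otimes> y \<otimes> inv x \<in> H} \<in> bounded_index_subgroups G n"
proof -
  let ?K = "{y \<in> carrier G. x \<otimes> y \<otimes> inv x \<in> H}"
  have sH: "subgroup H G" and fin: "finite (rcosets H)" and card: "card (rcosets H) \<le> n"
    using H by (auto simp: bounded_index_subgroups_def)
  have mult: "x \<otimes> (y \<otimes> z) \<otimes> inv x = (x \<otimes> y \<otimes> inv x) \<otimes> (x \<otimes> z \<otimes> inv x)"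
    if "y \<in> carrier G" "z \<in> carrier G" for y z
  proof -
    have "inv x \<otimes> (x \<otimes> (z \<otimes> inv x)) = z \<otimes> inv x"
      using m_assoc[of "inv x" x "z \<otimes> inv x"] that x by simp
    then show ?thesis using that x by (simp add: m_assoc)
  qed
  have inv: "x \<otimes> inv y \<otimes> inv x = inv (x \<otimes> y \<otimes> inv x)" if "y \<in> carrier G" for y
    using that x by (simp add: inv_mult_group m_assoc)
  have K: "subgroup ?K G"
  proof (rule subgroupI)
    show "?K \<noteq> {}" using x subgroup.one_closed[OF sH] by (auto intro!: exI[of _ \<one>])
    show "inv y \<in> ?K" if "y \<in> ?K" for y using that inv subgroup.m_inv_closed[OF sH] by auto
    show "y \<otimes> z \<in> ?K" if "y \<in> ?K" "z \<in> ?K" for y z using that mult subgroup.m_closed[OF sH] by auto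
  qed auto
  define f where "f y = H #> (x \<otimes> y)" for y
  have im: "f ` carrier G \<subseteq> rcosets H" using x by (auto simp: f_def rcosets_image)
  have inj: "y \<otimes> inv z \<in> ?K" if "y \<in> carrier G" "z \<in> carrier G" "f y = f z" for y z
    using that x r_coset_eq_iff[OF sH, of "x \<otimes> y" "x \<otimes> z"] by (simp add: f_def inv_mult_group
        m_assoc)
  have "finite (f ` carrier G)" using im fin by (rule finite_subset)
  then have r: "finite (rcosets ?K) \<and> card (rcosets ?K) \<le> card (f ` carrier G)"
    by (rule rcosets_card_le[OF K _ inj])
  have "card (rcosets ?K) \<le> n" using conjunct2[OF r] card_mono[OF fin im] card by linarith
  then show ?thesis using K r unfolding bounded_index_subgroups_def by blast
qed

section \<open>Equidistribution in the profinite completion\<close>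

lemma carrier_Mod_rcosets: "carrier (G Mod N) = rcosets\<^bsub>G\<^esub> N"
  by (simp add: FactGroup_def)

context
  fixes G :: "('a, 'b) monoid_scheme" (structure)
  assumes G: "group G"
begin

interpretation group G by (rule G)

private abbreviation (input) Gh where "Gh \<equiv> profinite_completion G"
private abbreviation (input) \<iota> where "\<iota> \<equiv> profinite_embedding G"
private abbreviation (input) \<N> where "\<N> \<equiv> finite_index_normals G"

lemma profinite_carrier_iff:
  "t \<in> carrier Gh \<longleftrightarrow> t \<in> extensional \<N> \<and> (\<forall>N\<in>\<N>. t N \<in> rcosets N) \<and>
     (\<forall>N\<in>\<N>. \<forall>M\<in>\<N>. N \<subseteq> M \<longrightarrow> t N \<subseteq> t M)"
  by (auto simp: profinite_completion_def carrier_Mod_rcosets PiE_iff)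

lemma profinite_mult: "s \<otimes>\<^bsub>Gh\<^esub> t = (\<lambda>N\<in>\<N>. s N <#> t N)"
  by (simp add: profinite_completion_def)

lemma profinite_one: "\<one>\<^bsub>Gh\<^esub> = (\<lambda>N\<in>\<N>. N)"
  by (simp add: profinite_completion_def)

lemma finite_index_normalsD: "N \<in> \<N> \<Longrightarrow> N \<lhd> G" "N \<in> \<N> \<Longrightarrow> subgroup N G" "N \<in> \<N> \<Longrightarrow> finite (rcosets N)"
  by (auto simp: finite_index_normals_def normal_imp_subgroup)

lemma profinite_mult_closed:
  assumes "s \<in> carrier Gh" "t \<in> carrier Gh" shows "s \<otimes>\<^bsub>Gh\<^esub> t \<in> carrier Gh"
  using assms normal.setmult_closed[OF finite_index_normalsD(1)]
  unfolding profinite_carrier_iff profinite_mult by (simp add: mono_set_mult)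

lemma monoid_profinite_completion: "monoid Gh"
proof (rule monoidI)
  show "\<one>\<^bsub>Gh\<^esub> \<in> carrier Gh"
    using finite_index_normalsD(2) subgroup.subgroup_in_rcosets[OF _ is_group]
    by (simp add: profinite_carrier_iff profinite_one)
next
  fix s t assume "s \<in> carrier Gh" "t \<in> carrier Gh"
  then show "s \<otimes>\<^bsub>Gh\<^esub> t \<in> carrier Gh" by (rule profinite_mult_closed)
next
  fix r s t assume c: "r \<in> carrier Gh" "s \<in> carrier Gh" "t \<in> carrier Gh"
  show "r \<otimes>\<^bsub>Gh\<^esub> s \<otimes>\<^bsub>Gh\<^esub> t = r \<otimes>\<^bsub>Gh\<^esub> (s \<otimes>\<^bsub>Gh\<^esub> t)"
    unfolding profinite_mult
  proof (rule restrict_ext)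
    fix N assume N: "N \<in> \<N>"
    show "(\<lambda>N\<in>\<N>. r N <#> s N) N <#> t N = r N <#> (\<lambda>N\<in>\<N>. s N <#> t N) N"
      using c N normal.rcosets_assoc[OF finite_index_normalsD(1)[OF N]]
      by (simp add: profinite_carrier_iff)
  qed
next
  fix t assume c: "t \<in> carrier Gh"
  show "\<one>\<^bsub>Gh\<^esub> \<otimes>\<^bsub>Gh\<^esub> t = t"
  proof (rule extensionalityI[where A = \<N>])
    fix N assume N: "N \<in> \<N>"
    show "(\<one>\<^bsub>Gh\<^esub> \<otimes>\<^bsub>Gh\<^esub> t) N = t N"
      using c N normal.rcosets_mult_eq[OF finite_index_normalsD(1)[OF N]]
      by (simp add: profinite_carrier_iff profinite_mult profinite_one)
  qed (use c in \<open>auto simp: profinite_mult profinite_carrier_iff\<close>)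
  show "t \<otimes>\<^bsub>Gh\<^esub> \<one>\<^bsub>Gh\<^esub> = t"
  proof (rule extensionalityI[where A = \<N>])
    fix N assume N: "N \<in> \<N>"
    have "t N \<in> carrier (G Mod N)" using c N by (simp add: profinite_carrier_iff
        carrier_Mod_rcosets)
    then have "t N <#> N = t N"
      using group.is_monoid[OF normal.factorgroup_is_group[OF finite_index_normalsD(1)[OF N]]]
        monoid.r_one by fastforce
    then show "(t \<otimes>\<^bsub>Gh\<^esub> \<one>\<^bsub>Gh\<^esub>) N = t N"
      using N by (simp add: profinite_mult profinite_one)
  qed (use c in \<open>auto simp: profinite_mult profinite_carrier_iff\<close>)
qed

lemma profinite_embedding_closed:
  assumes "g \<in> carrier G" shows "\<iota> g \<in> carrier Gh"
  using assms by (auto simp: profinite_carrier_iff profinite_embedding_def rcosets_image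
      r_coset_def)

lemma profinite_embedding_mult:
  assumes "g \<in> carrier G" "h \<in> carrier G" shows "\<iota> g \<otimes>\<^bsub>Gh\<^esub> \<iota> h = \<iota> (g \<otimes> h)"
  unfolding profinite_mult
  using assms by (intro ext) (simp add: profinite_embedding_def normal.rcos_sum[OF
      finite_index_normalsD(1)])

lemma profinite_embedding_one: "\<iota> \<one> = \<one>\<^bsub>Gh\<^esub>"
  unfolding profinite_one
  using finite_index_normalsD(2) by (intro ext) (simp add: profinite_embedding_def subgroup.subset)

text \<open>\<open>\<iota> (inv g)\<close> inverts \<open>\<iota> g\<close> on both sides. Hence
  \<open>\<iota> g\<close> is a unit of the monoid, and the \<open>inv\<close> in the equivariance
  condition of \<open>ContG\<close> is a true inverse.\<close>

lemma profinite_embedding_r_inv: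
  assumes g: "g \<in> carrier G" shows "\<iota> g \<otimes>\<^bsub>Gh\<^esub> inv\<^bsub>Gh\<^esub> (\<iota> g) = \<one>\<^bsub>Gh\<^esub>"
proof -
  interpret Gh: monoid Gh by (rule monoid_profinite_completion)
  have "\<iota> g \<in> Units Gh"
    unfolding Units_def
    using g profinite_embedding_closed profinite_embedding_mult profinite_embedding_one
    by (auto intro!: bexI[of _ "\<iota> (inv g)"])
  then show ?thesis by simp
qed

text \<open>A coset of \<open>N\<close> lies in exactly one coset of the larger group
  \<open>M\<close>, and compatibility says that this is the coordinate at \<open>M\<close>. A
  coordinate therefore determines all those above it.\<close>

lemma profinite_coset_eq_mono:
  assumes s: "s \<in> carrier Gh" and t: "t \<in> carrier Gh" and NM: "N \<in> \<N>" "M \<in> \<N>" "N \<subseteq> M" and e: "s N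
      = t N"
  shows "s M = t M"
proof -
  have ne: "s N \<noteq> {}"
    using s NM subgroup.rcosets_non_empty[OF finite_index_normalsD(2)[OF NM(1)]] by (simp add:
        profinite_carrier_iff)
  have sub: "s N \<subseteq> s M" "t N \<subseteq> t M" using s t NM by (auto simp only: profinite_carrier_iff)
  have rc: "s M \<in> rcosets M" "t M \<in> rcosets M" using s t NM by (auto simp only:
      profinite_carrier_iff)
  show ?thesis
  proof (rule ccontr)
    assume "s M \<noteq> t M"
    then have "disjnt (s M) (t M)"
      by (rule pairwiseD[OF rcos_disjoint[OF finite_index_normalsD(2)[OF NM(2)]] rc])
    then show False using ne sub e by (auto simp: disjnt_def)
  qed
qed

section \<open>Topology of the profinite completion: cylinders and compactness\<close>

lemma topspace_profinite: "topspace (profinite_topology G) = carrier Gh"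
  by (auto simp: profinite_topology_def profinite_completion_def)

lemma openin_profinite_cylinder:
  assumes N: "N \<in> \<N>" shows "openin (profinite_topology G) {t \<in> carrier Gh. t N = c}"
proof -
  let ?X = "\<lambda>N. discrete_topology (carrier (G Mod N))"
  have "continuous_map (profinite_topology G) (?X N) (\<lambda>t. t N)"
    unfolding profinite_topology_def
    by (intro continuous_map_from_subtopology continuous_map_product_projection N)
  \<comment> \<open>The intersection with the carrier covers the case that \<open>c\<close> is no
    coset; the cylinder is then empty.\<close>
  then have "openin (profinite_topology G) {t \<in> topspace (profinite_topology G). t N \<in> {c} \<inter>
      carrier (G Mod N)}"
    by (rule openin_continuous_map_preimage) auto
  moreover have "{t \<in> topspace (profinite_topology G). t N \<in> {c} \<inter> carrier (G Mod N)} = {t \<in>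
      carrier Gh. t N = c}"
    using N by (auto simp: topspace_profinite profinite_carrier_iff carrier_Mod_rcosets)
  ultimately show ?thesis by simp
qed

text \<open>Tychonoff applies to the product of the finite quotients. The completion is closed in it
  because a violation of \<open>t N \<subseteq> t M\<close> is visible in two coordinates and is
  therefore an open condition.\<close>

lemma compact_space_profinite: "compact_space (profinite_topology G)"
proof -
  let ?X = "\<lambda>N. discrete_topology (carrier (G Mod N))"
  let ?P = "product_topology ?X \<N>"
  have "compact_space ?P"
    using finite_index_normalsD(3)
    by (simp add: compact_space_product_topology compact_space_discrete_topology
        carrier_Mod_rcosets)
  moreover have "closedin ?P (carrier Gh)"
  proof -
    have op: "openin ?P {t \<in> topspace ?P. t N = c}" if N: "N \<in> \<N>" for N c
    proof -
      have "openin ?P {t \<in> topspace ?P. t N \<in> {c} \<inter> carrier (G Mod N)}"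
        by (rule openin_continuous_map_preimage[OF continuous_map_product_projection[OF N]]) auto
      moreover have "{t \<in> topspace ?P. t N \<in> {c} \<inter> carrier (G Mod N)} = {t \<in> topspace ?P. t N = c}"
        using N by auto
      ultimately show ?thesis by simp
    qed
    define X where "X = topspace ?P"
    have car: "t \<in> carrier Gh \<longleftrightarrow> t \<in> X \<and> (\<forall>N\<in>\<N>. \<forall>M\<in>\<N>. N \<subseteq> M \<longrightarrow> t N \<subseteq> t M)" for t
      by (simp add: profinite_completion_def X_def)
    define D where "D N M c d = {t \<in> X. t N = c} \<inter> {t \<in> X. t M = d}" for N M c d
    define I :: "('a set \<times> 'a set \<times> 'a set \<times> 'a set) set"
      where "I = {(N, M, c, d). N \<in> \<N> \<and> M \<in> \<N> \<and> N \<subseteq> M \<and> \<not> c \<subseteq> d}"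
    have "X - carrier Gh = (\<Union>(N, M, c, d) \<in> I. D N M c d)"
    proof (rule equalityI; rule subsetI)
      fix t assume "t \<in> X - carrier Gh"
      then obtain N M where NM: "t \<in> X" "N \<in> \<N>" "M \<in> \<N>" "N \<subseteq> M" "\<not> t N \<subseteq> t M"
        unfolding Diff_iff car by blast
      show "t \<in> (\<Union>(N, M, c, d) \<in> I. D N M c d)"
        using NM by (intro UN_I[of "(N, M, t N, t M)"]) (auto simp: I_def D_def)
    next
      fix t assume "t \<in> (\<Union>(N, M, c, d) \<in> I. D N M c d)"
      then obtain N M where NM: "t \<in> X" "N \<in> \<N>" "M \<in> \<N>" "N \<subseteq> M" "\<not> t N \<subseteq> t M"
        unfolding I_def D_def by blast
      show "t \<in> X - carrier Gh" unfolding Diff_iff car using NM by blast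
    qed
    moreover have "openin ?P \<dots>"
      by (rule openin_Union) (auto simp: I_def D_def intro!: openin_Int op[folded X_def])
    moreover have "carrier Gh \<subseteq> X" using car by blast
    ultimately show ?thesis unfolding closedin_def X_def[symmetric] by metis
  qed
  ultimately have "compactin ?P (carrier Gh)" by (rule closedin_compact_space)
  then show ?thesis unfolding profinite_topology_def by (rule compact_space_subtopology)
qed

text \<open>A basic neighbourhood constrains finitely many coordinates. If \<open>K n\<close> lies
  in all the corresponding subgroups, its coordinate fixes all of them, so the cylinder through
  \<open>t\<close> at \<open>K n\<close> stays in the neighbourhood.\<close>

lemma continuous_locally_cylinder:
  fixes F :: "_ \<Rightarrow> real"
  assumes F: "continuous_map (profinite_topology G) euclideanreal F" and t: "t \<in> carrier Gh" and
      e: "e > 0"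
    and cofinal: "\<And>S. finite S \<Longrightarrow> S \<subseteq> \<N> \<Longrightarrow> \<exists>n. K n \<in> \<N> \<and> (\<forall>M\<in>S. K n \<subseteq> M)"
  shows "\<exists>n. K n \<in> \<N> \<and> (\<forall>s\<in>carrier Gh. s (K n) = t (K n) \<longrightarrow> \<bar>F s - F t\<bar> < e)"
proof -
  let ?X = "\<lambda>N. discrete_topology (carrier (G Mod N))"
  have "openin (profinite_topology G) {s \<in> topspace (profinite_topology G). F s \<in> ball (F t) e}"
    by (rule openin_continuous_map_preimage[OF F]) auto
  then have "openin (profinite_topology G) {s \<in> carrier Gh. F s \<in> ball (F t) e}"
    unfolding topspace_profinite .
  then obtain V where V: "openin (product_topology ?X \<N>) V"
    and VF: "{s \<in> carrier Gh. F s \<in> ball (F t) e} = V \<inter> carrier Gh"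
    unfolding profinite_topology_def openin_subtopology by blast
  have "t \<in> {s \<in> carrier Gh. F s \<in> ball (F t) e}" using t e by simp
  then have "t \<in> V" unfolding VF by simp
  then obtain U where U: "finite {N \<in> \<N>. U N \<noteq> topspace (?X N)}" "t \<in> Pi\<^sub>E \<N> U" "Pi\<^sub>E \<N> U \<subseteq> V"
    using V unfolding openin_product_topology_alt by meson
  obtain n where n: "K n \<in> \<N>" "\<forall>M\<in>{N \<in> \<N>. U N \<noteq> topspace (?X N)}. K n \<subseteq> M"
    using cofinal[OF U(1)] by blast
  have "\<bar>F s - F t\<bar> < e" if s: "s \<in> carrier Gh" and st: "s (K n) = t (K n)" for s
  proof -
    have "s N \<in> U N" if N: "N \<in> \<N>" for N
    proof (cases "U N = topspace (?X N)")
      case True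
      then show ?thesis using s N by (simp add: profinite_carrier_iff carrier_Mod_rcosets)
    next
      case False
      then have "s N = t N" using profinite_coset_eq_mono[OF s t n(1) N _ st] n(2) N by blast
      then show ?thesis using U(2) N by auto
    qed
    then have "s \<in> Pi\<^sub>E \<N> U" using s by (auto simp: profinite_carrier_iff PiE_iff)
    then have "F s \<in> ball (F t) e" using U(3) VF s by blast
    then show ?thesis by (simp add: dist_real_def abs_minus_commute)
  qed
  then show ?thesis using n(1) by blast
qed

text \<open>This is a Lebesgue number argument. Finitely many cylinders on which \<open>F\<close>
  stays within \<open>e/2\<close> of its value at the centre cover the compact space. Once
  \<open>K k\<close> lies below all their levels, two points that agree at \<open>K k\<close> share
  one of them.\<close>

lemma continuous_uniformly_cylinder:
  fixes F :: "_ \<Rightarrow> real" and n0 :: nat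
  assumes F: "continuous_map (profinite_topology G) euclideanreal F" and e: "e > 0"
    and K: "\<And>n. n \<ge> n0 \<Longrightarrow> K n \<in> \<N>"
    and cofinal: "\<And>M. M \<in> \<N> \<Longrightarrow> \<exists>n. \<forall>k\<ge>n. K k \<subseteq> M"
  shows "\<exists>n. \<forall>k\<ge>n. \<forall>s\<in>carrier Gh. \<forall>t\<in>carrier Gh. s (K k) = t (K k) \<longrightarrow> \<bar>F s - F t\<bar> < e"
proof -
  have cof: "\<exists>n\<ge>n0. \<forall>k\<ge>n. \<forall>M\<in>S. K k \<subseteq> M" if "finite S" "S \<subseteq> \<N>" for S
    using that
  proof (induction S rule: finite_induct)
    case empty then show ?case by (intro exI[of _ n0]) simp
  next
    case (insert M S)
    then obtain n where n: "n \<ge> n0" "\<forall>k\<ge>n. \<forall>M\<in>S. K k \<subseteq> M" by auto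
    obtain n' where "\<forall>k\<ge>n'. K k \<subseteq> M" using cofinal[of M] insert by auto
    then show ?case using n by (intro exI[of _ "max n n'"]) auto
  qed
  have cof': "\<exists>n. K n \<in> \<N> \<and> (\<forall>M\<in>S. K n \<subseteq> M)" if "finite S" "S \<subseteq> \<N>" for S
    using cof[OF that] K by blast
  have "\<forall>t\<in>carrier Gh. \<exists>n. K n \<in> \<N> \<and> (\<forall>s\<in>carrier Gh. s (K n) = t (K n) \<longrightarrow> \<bar>F s - F t\<bar> < e/2)"
    using continuous_locally_cylinder[OF F _ half_gt_zero[OF e] cof'] by (intro ballI) simp
  from bchoice[OF this] obtain \<nu> where "\<forall>t\<in>carrier Gh. K (\<nu> t) \<in> \<N> \<and>
      (\<forall>s\<in>carrier Gh. s (K (\<nu> t)) = t (K (\<nu> t)) \<longrightarrow> \<bar>F s - F t\<bar> < e/2)" by (rule exE)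
  then have \<nu>: "\<And>t. t \<in> carrier Gh \<Longrightarrow> K (\<nu> t) \<in> \<N>"
    "\<And>s t. t \<in> carrier Gh \<Longrightarrow> s \<in> carrier Gh \<Longrightarrow> s (K (\<nu> t)) = t (K (\<nu> t)) \<Longrightarrow> \<bar>F s - F t\<bar> < e/2"
    by blast+
  define C where "C t = {s \<in> carrier Gh. s (K (\<nu> t)) = t (K (\<nu> t))}" for t
  have "\<exists>\<F>. finite \<F> \<and> \<F> \<subseteq> C ` carrier Gh \<and> topspace (profinite_topology G) \<subseteq> \<Union>\<F>"
  proof (rule compactinD[OF compact_space_profinite[unfolded compact_space_def]])
    show "openin (profinite_topology G) U" if "U \<in> C ` carrier Gh" for U
      using that openin_profinite_cylinder \<nu>(1) unfolding C_def by blast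
    show "topspace (profinite_topology G) \<subseteq> \<Union> (C ` carrier Gh)"
      unfolding topspace_profinite C_def by blast
  qed
  then obtain T where T: "finite T" "T \<subseteq> carrier Gh" "carrier Gh \<subseteq> (\<Union>t\<in>T. C t)"
    unfolding topspace_profinite by (metis finite_subset_image)
  obtain n where n: "n \<ge> n0" "\<forall>k\<ge>n. \<forall>t\<in>T. K k \<subseteq> K (\<nu> t)"
    using cof[of "(\<lambda>t. K (\<nu> t)) ` T"] T \<nu>(1) by auto
  have "\<bar>F s - F s'\<bar> < e" if k: "k \<ge> n" and s: "s \<in> carrier Gh" and s': "s' \<in> carrier Gh" and eq:
      "s (K k) = s' (K k)" for k s s'
  proof -
    obtain t where t: "t \<in> T" "s \<in> C t" using T(3) s by auto
    have tc: "t \<in> carrier Gh" using t T by auto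
    have "s (K (\<nu> t)) = s' (K (\<nu> t))"
      using profinite_coset_eq_mono[OF s s' _ \<nu>(1)[OF tc] _ eq] K[of k] n t k by auto
    then have "\<bar>F s - F t\<bar> < e/2" "\<bar>F s' - F t\<bar> < e/2"
      using \<nu>(2)[OF tc] s s' t by (auto simp: C_def)
    then show ?thesis by linarith
  qed
  then show ?thesis by blast
qed

text \<open>Translation by an embedded group element carries one cylinder of level \<open>N\<close>
  into any other. The resulting inequalities in both directions make their measures equal, and the
  cylinders partition a probability space.\<close>

lemma measure_profinite_cylinder:
  assumes m: "haar_probability Gh (profinite_topology G) m" and N: "N \<in> \<N>" and c: "c \<in> rcosets N"
  shows "{t \<in> carrier Gh. t N = c} \<in> sets m"
    and "measure m {t \<in> carrier Gh. t N = c} = 1 / card (rcosets N)"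
proof -
  interpret prob_space m using m by (simp add: haar_probability_def)
  define C where "C c = {t \<in> carrier Gh. t N = c}" for c
  have sm: "sets m = sigma_sets (carrier Gh) {U. openin (profinite_topology G) U}" "space m =
      carrier Gh"
    using m by (auto simp: haar_probability_def)
  have C: "C c \<in> sets m" for c
    unfolding sm C_def using openin_profinite_cylinder[OF N] by (intro sigma_sets.Basic) auto
  then show "{t \<in> carrier Gh. t N = c} \<in> sets m" by (simp add: C_def)
  have le: "measure m (C a) \<le> measure m (C b)" if ab: "a \<in> rcosets N" "b \<in> rcosets N" for a b
  proof -
    obtain x y where x: "x \<in> carrier G" "a = N #> x" and y: "y \<in> carrier G" "b = N #> y"
      using ab unfolding rcosets_image by blast
    \<comment> \<open>Normality of \<open>N\<close> gives (N g)(N x) = N g x = N y for this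
      choice.\<close>
    define g where "g = y \<otimes> inv x"
    have g: "g \<in> carrier G" using x y by (simp add: g_def)
    have "(N #> g) <#> a = b"
      using x y g normal.rcos_sum[OF finite_index_normalsD(1)[OF N]] by (simp add: g_def m_assoc)
    then have "\<iota> g <#\<^bsub>Gh\<^esub> C a \<subseteq> C b"
      using N g profinite_mult_closed[OF profinite_embedding_closed]
      by (auto simp: l_coset_def C_def profinite_mult profinite_embedding_def)
    then have "emeasure m (\<iota> g <#\<^bsub>Gh\<^esub> C a) \<le> emeasure m (C b)" by (rule emeasure_mono) (rule C)
    then have "emeasure m (C a) \<le> emeasure m (C b)"
      using m C profinite_embedding_closed[OF g] by (simp add: haar_probability_def)
    then show ?thesis by (simp add: emeasure_eq_measure)
  qed
  have "1 = measure m (\<Union>a\<in>rcosets N. C a)"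
  proof -
    have "(\<Union>a\<in>rcosets N. C a) = space m" using N by (auto simp: sm C_def profinite_carrier_iff)
    then show ?thesis using prob_space by simp
  qed
  also have "\<dots> = (\<Sum>a\<in>rcosets N. measure m (C a))"
    using finite_index_normalsD(3)[OF N] C
    by (intro finite_measure_finite_Union) (auto simp: disjoint_family_on_def C_def)
  also have "\<dots> = (\<Sum>a\<in>rcosets N. measure m (C c))"
    using le c by (intro sum.cong) (auto intro: antisym)
  finally have "1 = card (rcosets N) * measure m (C c)" by simp
  then show "measure m {t \<in> carrier Gh. t N = c} = 1 / card (rcosets N)"
    unfolding C_def by (cases "card (rcosets N) = 0") (simp_all add: field_simps)
qed

text \<open>The average over the transversal is exactly the integral of a step function, since all
  cylinders of level \<open>K n\<close> have the same measure. Uniform continuity along cylinders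
  makes these step functions converge uniformly to \<open>F\<close>.\<close>

theorem profinite_equidistribution:
  fixes F :: "_ \<Rightarrow> real" and n0 :: nat
  assumes m: "haar_probability Gh (profinite_topology G) m"
    and F: "continuous_map (profinite_topology G) euclideanreal F"
    and K: "\<And>n. n \<ge> n0 \<Longrightarrow> K n \<in> \<N>"
    and cofinal: "\<And>M. M \<in> \<N> \<Longrightarrow> \<exists>n. \<forall>k\<ge>n. K k \<subseteq> M"
    and R: "\<And>n. n \<ge> n0 \<Longrightarrow> R n \<subseteq> carrier G"
      "\<And>n. n \<ge> n0 \<Longrightarrow> bij_betw (\<lambda>g. K n #> g) (R n) (rcosets (K n))"
  shows "integrable m F"
    and "(\<lambda>n. (\<Sum>g\<in>R n. F (\<iota> g)) / card (R n)) \<longlonglongrightarrow> (LINT t|m. F t)"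
proof -
  interpret prob_space m using m by (simp add: haar_probability_def)
  have sm: "sets m = sigma_sets (carrier Gh) {U. openin (profinite_topology G) U}" "space m =
      carrier Gh"
    using m by (auto simp: haar_probability_def)
  have meas: "F \<in> borel_measurable m"
  proof (rule borel_measurableI)
    fix S :: "real set" assume "open S"
    then have "openin (profinite_topology G) {t \<in> topspace (profinite_topology G). F t \<in> S}"
      by (intro openin_continuous_map_preimage[OF F]) simp
    moreover have "{t \<in> topspace (profinite_topology G). F t \<in> S} = F -` S \<inter> space m"
      by (auto simp: topspace_profinite sm)
    ultimately show "F -` S \<inter> space m \<in> sets m" unfolding sm(1) by auto
  qed
  have "compactin euclideanreal (F ` carrier Gh)"
    using image_compactin[OF _ F, of "carrier Gh"] compact_space_profinite
    by (simp add: compact_space_def topspace_profinite)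
  then have "bounded (F ` carrier Gh)" by (simp add: compact_imp_bounded)
  then obtain B where B: "\<And>t. t \<in> carrier Gh \<Longrightarrow> \<bar>F t\<bar> \<le> B" by (auto simp: bounded_iff)
  show int: "integrable m F"
    using B meas by (intro integrable_const_bound[where B = B]) (auto simp: sm)
  show "(\<lambda>n. (\<Sum>g\<in>R n. F (\<iota> g)) / card (R n)) \<longlonglongrightarrow> (LINT t|m. F t)"
  proof (rule LIMSEQ_I)
    fix e :: real assume e: "e > 0"
    obtain n1 where n1: "\<And>k s t. k \<ge> n1 \<Longrightarrow> s \<in> carrier Gh \<Longrightarrow> t \<in> carrier Gh \<Longrightarrow> s (K k) = t (K k) \<Longrightarrow> \<bar>F
        s - F t\<bar> < e/2"
      using continuous_uniformly_cylinder[OF F, of "e/2" n0 K] K cofinal e by (metis half_gt_zero)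
    have "\<bar>(\<Sum>g\<in>R n. F (\<iota> g)) / card (R n) - (LINT t|m. F t)\<bar> < e" if n: "n \<ge> max n0 n1" for n
    proof -
      define N where "N = K n"
      have N: "N \<in> \<N>" using K n by (simp add: N_def)
      have bij: "bij_betw (\<lambda>g. N #> g) (R n) (rcosets N)" and Rc: "R n \<subseteq> carrier G"
        using R n by (auto simp: N_def)
      have finR: "finite (R n)" using bij finite_index_normalsD(3)[OF N] bij_betw_finite by blast
      define A where "A g = {t \<in> carrier Gh. t N = N #> g}" for g
      have A: "A g \<in> sets m" "measure m (A g) = 1 / card (R n)" if "g \<in> R n" for g
        using measure_profinite_cylinder[OF m N, of "N #> g"] that bij bij_betw_same_card[OF bij]
        by (auto simp: A_def bij_betw_def)
      \<comment> \<open>The step function: as \<open>R n\<close> is a transversal, exactly one of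
        the indicators is 1 at each point of the space.\<close>
      define f where "f t = (\<Sum>g\<in>R n. indicator (A g) t * F (\<iota> g))" for t
      have inf: "integrable m f"
        unfolding f_def using A by (intro Bochner_Integration.integrable_sum integrable_mult_left)
            (auto simp: emeasure_eq_measure)
      have If: "(LINT t|m. f t) = (\<Sum>g\<in>R n. F (\<iota> g)) / card (R n)"
      proof -
        have "(LINT t|m. f t) = (\<Sum>g\<in>R n. measure m (A g) * F (\<iota> g))"
          unfolding f_def using A
          by (subst Bochner_Integration.integral_sum) (auto simp: emeasure_eq_measure)
        then show ?thesis using A by (simp add: sum_divide_distrib)
      qed
      have close: "\<bar>f t - F t\<bar> \<le> e/2" if t: "t \<in> space m" for t
      proof -
        have tc: "t \<in> carrier Gh" using t by (simp add: sm)
        then have "t N \<in> rcosets N" using N by (simp add: profinite_carrier_iff)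
        then obtain g where g: "g \<in> R n" "t N = N #> g" using bij by (auto simp: bij_betw_def)
        have "f t = (\<Sum>h\<in>R n. if h = g then F (\<iota> g) else 0)"
          unfolding f_def
        proof (rule sum.cong)
          fix h assume h: "h \<in> R n"
          have "t \<in> A h \<longleftrightarrow> h = g"
            using bij h g tc by (auto simp: A_def bij_betw_def inj_on_def)
          then show "indicator (A h) t * F (\<iota> h) = (if h = g then F (\<iota> g) else 0)" by auto
        qed simp
        then have "f t = F (\<iota> g)" using g finR by simp
        moreover have "\<bar>F (\<iota> g) - F t\<bar> < e/2"
          using n1[of n "\<iota> g" t] n tc g Rc N profinite_embedding_closed
          by (auto simp: N_def profinite_embedding_def)
        ultimately show ?thesis by simp
      qed
      have "\<bar>(LINT t|m. f t - F t)\<bar> \<le> (LINT t|m. e/2)"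
        using inf int close by (intro integral_abs_bound[THEN order_trans] integral_mono) auto
      then show ?thesis using e inf int by (simp add: If prob_space)
    qed
    then show "\<exists>no. \<forall>n\<ge>no. norm ((\<Sum>g\<in>R n. F (\<iota> g)) / card (R n) - (LINT t|m. F t)) < e"
      by (intro exI[of _ "max n0 n1"]) (simp add: real_norm_def)
  qed
qed

end

section \<open>Isometries of the disk\<close>

lemma of_real_norm_power2: "(complex_of_real (norm z))\<^sup>2 = z * cnj z"
  by (metis complex_norm_square of_real_power)

text \<open>Conjugation becomes a rational map on the unit circle, which turns identities between
  ideal points into field arithmetic.\<close>

lemma sphere_cnj: "norm z = 1 \<Longrightarrow> cnj z = 1 / z"
  using of_real_norm_power2[of z] by (cases "z = 0") (auto simp: field_simps)

text \<open>The matrices with rows (a, b) and (conj b, conj a), where |b| < |a|, are the positive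
  real multiples of elements of SU(1,1). Without normalization, products and inverses stay
  polynomial in the coefficients and their conjugates.\<close>

definition disk_moebius :: "complex \<Rightarrow> complex \<Rightarrow> complex \<Rightarrow> complex" where
  "disk_moebius a b z = (a * z + b) / (cnj b * z + cnj a)"

lemma disk_moebius_denominator_nz:
  assumes "norm b < norm a" "norm z \<le> 1" shows "cnj b * z + cnj a \<noteq> 0"
proof
  assume "cnj b * z + cnj a = 0"
  then have "cnj a = - (cnj b * z)" by (simp add: eq_neg_iff_add_eq_0 add.commute)
  then have "norm a = norm b * norm z" by (metis complex_mod_cnj norm_minus_cancel norm_mult)
  also have "\<dots> \<le> norm b" using assms(2) by (simp add: mult_left_le)
  finally show False using assms(1) by simp
qed

text \<open>The matrix preserves the Hermitian form of signature (1,1) up to its determinant |a|^2 -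
  |b|^2. The invariance of circle and disk can be read off from the sign of both sides.\<close>

lemma disk_moebius_norm_identity:
  assumes "norm b < norm a" "norm z \<le> 1"
  shows "1 - (norm (disk_moebius a b z))\<^sup>2 =
    ((norm a)\<^sup>2 - (norm b)\<^sup>2) * (1 - (norm z)\<^sup>2) / (norm (cnj b * z + cnj a))\<^sup>2"
proof -
  let ?n = "a * z + b" and ?d = "cnj b * z + cnj a"
  have d: "?d \<noteq> 0" by (rule disk_moebius_denominator_nz[OF assms])
  have "of_real ((norm ?d)\<^sup>2 - (norm ?n)\<^sup>2) = (of_real (((norm a)\<^sup>2 - (norm b)\<^sup>2) * (1 - (norm
      z)\<^sup>2)) :: complex)"
    by (simp add: of_real_norm_power2 algebra_simps)
  then have "(norm ?d)\<^sup>2 - (norm ?n)\<^sup>2 = ((norm a)\<^sup>2 - (norm b)\<^sup>2) * (1 - (norm z)\<^sup>2)"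
    using of_real_eq_iff by blast
  moreover have "1 - (norm (disk_moebius a b z))\<^sup>2 = ((norm ?d)\<^sup>2 - (norm ?n)\<^sup>2) / (norm ?d)\<^sup>2"
    using d by (simp add: disk_moebius_def norm_divide power_divide field_simps)
  ultimately show ?thesis by simp
qed

lemma disk_moebius_norm_sphere:
  assumes "norm b < norm a" "norm z = 1" shows "norm (disk_moebius a b z) = 1"
  using disk_moebius_norm_identity[of b a z] assms norm_ge_zero[of "disk_moebius a b z"]
  by (auto simp: power2_eq_1_iff simp del: norm_ge_zero)

lemma disk_moebius_norm_ball:
  assumes "norm b < norm a" "norm z < 1" shows "norm (disk_moebius a b z) < 1"
proof -
  have "0 < ((norm a)\<^sup>2 - (norm b)\<^sup>2) * (1 - (norm z)\<^sup>2) / (norm (cnj b * z + cnj a))\<^sup>2"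
    using assms disk_moebius_denominator_nz[of b a z]
    by (intro divide_pos_pos mult_pos_pos) (auto simp: power_strict_mono abs_square_less_1)
  then have "0 < 1 - (norm (disk_moebius a b z))\<^sup>2"
    using disk_moebius_norm_identity[of b a z] assms by simp
  then show ?thesis by (simp add: abs_square_less_1)
qed

lemma disk_moebius_norm_cball:
  assumes "norm b < norm a" "norm z \<le> 1" shows "norm (disk_moebius a b z) \<le> 1"
  using disk_moebius_norm_sphere[of b a z] disk_moebius_norm_ball[of b a z] assms by fastforce

text \<open>The determinant |a|^2 - |b|^2 is multiplicative.\<close>

lemma disk_moebius_compose_coeffs:
  assumes "norm b < norm a" "norm d < norm c"
  shows "norm (a * d + b * cnj c) < norm (a * c + b * cnj d)"
proof -
  have "of_real ((norm (a * c + b * cnj d))\<^sup>2 - (norm (a * d + b * cnj c))\<^sup>2) =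
    (of_real (((norm a)\<^sup>2 - (norm b)\<^sup>2) * ((norm c)\<^sup>2 - (norm d)\<^sup>2)) :: complex)"
    by (simp add: of_real_norm_power2 algebra_simps)
  then have "(norm (a * c + b * cnj d))\<^sup>2 - (norm (a * d + b * cnj c))\<^sup>2
      = ((norm a)\<^sup>2 - (norm b)\<^sup>2) * ((norm c)\<^sup>2 - (norm d)\<^sup>2)"
    using of_real_eq_iff by blast
  also have "\<dots> > 0" using assms by (intro mult_pos_pos) (auto simp: power_strict_mono)
  finally show ?thesis by (simp add: power2_less_imp_less)
qed

lemma disk_moebius_compose:
  assumes "norm b < norm a" "norm d < norm c" "norm z \<le> 1"
  shows "disk_moebius a b (disk_moebius c d z) = disk_moebius (a * c + b * cnj d) (a * d + b * cnj
      c) z"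
proof -
  have 1: "cnj d * z + cnj c \<noteq> 0" by (rule disk_moebius_denominator_nz[OF assms(2,3)])
  have 2: "cnj b * disk_moebius c d z + cnj a \<noteq> 0"
    by (rule disk_moebius_denominator_nz[OF assms(1) disk_moebius_norm_cball[OF assms(2,3)]])
  have "cnj (a * d + b * cnj c) * z + cnj (a * c + b * cnj d) =
      (cnj b * disk_moebius c d z + cnj a) * (cnj d * z + cnj c)"
    using 1 by (simp add: disk_moebius_def field_simps)
  moreover have "(a * c + b * cnj d) * z + (a * d + b * cnj c) =
      (a * disk_moebius c d z + b) * (cnj d * z + cnj c)"
    using 1 by (simp add: disk_moebius_def field_simps)
  ultimately show ?thesis using 1 unfolding disk_moebius_def[of a b] disk_moebius_def[of "a * c +
      b * cnj d"] by simp
qed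

text \<open>The coefficients \<open>cnj a\<close> and \<open>- b\<close> are those of the adjugate
  matrix; the product is a nonzero real scalar.\<close>

lemma disk_moebius_inverse:
  assumes "norm b < norm a" "norm z \<le> 1" shows "disk_moebius (cnj a) (- b) (disk_moebius a b z) = z"
proof -
  have "disk_moebius (cnj a) (- b) (disk_moebius a b z)
      = disk_moebius (cnj a * a + - b * cnj b) (cnj a * b + - b * cnj a) z"
    using assms by (intro disk_moebius_compose) auto
  also have "\<dots> = disk_moebius (of_real ((norm a)\<^sup>2 - (norm b)\<^sup>2)) 0 z"
    by (simp add: of_real_norm_power2 mult.commute)
  also have "\<dots> = z"
  proof -
    have "(norm b)\<^sup>2 < (norm a)\<^sup>2" using assms by (simp add: power_strict_mono)
    then have "of_real ((norm a)\<^sup>2 - (norm b)\<^sup>2) \<noteq> (0 :: complex)" unfolding of_real_eq_0_iff by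
        linarith
    then show ?thesis by (simp only: disk_moebius_def complex_cnj_complex_of_real) simp
  qed
  finally show ?thesis .
qed

lemma disk_moebius_inverse':
  assumes "norm b < norm a" "norm z \<le> 1" shows "disk_moebius a b (disk_moebius (cnj a) (- b) z) = z"
  using disk_moebius_inverse[of "- b" "cnj a" z] assms by simp

lemma disk_isometries_iff:
  "f \<in> disk_isometries \<longleftrightarrow> (\<exists>a b. norm b < norm a \<and> f = restrict (disk_moebius a b) (cball 0 1))"
proof
  assume "f \<in> disk_isometries"
  then obtain t w where w: "norm w < 1" and f: "f = restrict (Moebius_function t w) (cball 0 1)"
    by (auto simp: disk_isometries_def)
  \<comment> \<open>The angle is halved because the rotation factor enters as \<open>a\<close>
    divided by its conjugate, which is the square of \<open>a\<close> here.\<close>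
  define a where "a = exp (\<i> * of_real (t / 2))"
  have na: "norm a = 1" by (simp add: a_def norm_exp_i_times del: of_real_divide)
  have aa: "a * a = exp (\<i> * of_real t)" by (simp add: a_def flip: exp_add)
  have ca: "cnj a * a = 1" using na by (simp add: of_real_norm_power2[symmetric] mult.commute)
  have "Moebius_function t w z = disk_moebius a (- a * w) z" for z
  proof -
    have "disk_moebius a (- a * w) z = (a * (z - w)) / (cnj a * (1 - cnj w * z))"
      by (simp add: disk_moebius_def algebra_simps)
    also have "\<dots> = (a * a * (z - w)) / (cnj a * a * (1 - cnj w * z))"
      using na by (metis (no_types, lifting) mult.assoc mult.left_commute
          mult_divide_mult_cancel_left norm_zero zero_neq_one)
    finally show ?thesis by (simp add: aa ca Moebius_function_def)
  qed
  then show "\<exists>a b. norm b < norm a \<and> f = restrict (disk_moebius a b) (cball 0 1)"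
    using f w na by (intro exI[of _ a] exI[of _ "- a * w"]) (auto simp: norm_mult)
next
  assume "\<exists>a b. norm b < norm a \<and> f = restrict (disk_moebius a b) (cball 0 1)"
  then obtain a b where ab: "norm b < norm a" and f: "f = restrict (disk_moebius a b) (cball 0 1)"
      by blast
  have a0: "a \<noteq> 0" using ab by auto
  define w where "w = - b / a"
  define t where "t = Arg (a / cnj a)"
  have et: "exp (\<i> * of_real t) = a / cnj a"
    using Arg_eq[of "a / cnj a"] a0 by (simp add: t_def norm_divide)
  have "Moebius_function t w z = disk_moebius a b z" for z
  proof -
    have "disk_moebius a b z = (a * (z - w)) / (cnj a * (1 - cnj w * z))"
      using a0 by (simp add: disk_moebius_def w_def algebra_simps)
    then show ?thesis by (simp add: Moebius_function_def et)
  qed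
  moreover have "norm w < 1" using ab a0 by (simp add: w_def norm_divide)
  ultimately show "f \<in> disk_isometries" unfolding disk_isometries_def f by (auto intro!: exI[of _
      t] exI[of _ w])
qed

lemma disk_moebius_in_isometries:
  "norm b < norm a \<Longrightarrow> restrict (disk_moebius a b) (cball 0 1) \<in> disk_isometries"
  unfolding disk_isometries_iff by blast

lemma disk_isometriesE:
  assumes "f \<in> disk_isometries"
  obtains a b where "norm b < norm a" "\<And>z. norm z \<le> 1 \<Longrightarrow> f z = disk_moebius a b z"
    "f = restrict (disk_moebius a b) (cball 0 1)"
  using assms unfolding disk_isometries_iff by auto

lemma disk_isometry_norm:
  assumes "f \<in> disk_isometries"
  shows "norm z = 1 \<Longrightarrow> norm (f z) = 1" "norm z < 1 \<Longrightarrow> norm (f z) < 1" "norm z \<le> 1 \<Longrightarrow> norm (f z) \<le> 1"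
  using disk_isometriesE[OF assms] disk_moebius_norm_sphere disk_moebius_norm_ball
      disk_moebius_norm_cball
  by (metis order_refl less_imp_le)+

lemma disk_isometry_compose:
  assumes "f \<in> disk_isometries" "g \<in> disk_isometries"
  shows "compose (cball 0 1) f g \<in> disk_isometries"
proof -
  obtain a b where f: "norm b < norm a" "\<And>z. norm z \<le> 1 \<Longrightarrow> f z = disk_moebius a b z"
    using disk_isometriesE[OF assms(1)] by blast
  obtain c d where g: "norm d < norm c" "\<And>z. norm z \<le> 1 \<Longrightarrow> g z = disk_moebius c d z"
    using disk_isometriesE[OF assms(2)] by blast
  have "compose (cball 0 1) f g = restrict (disk_moebius (a * c + b * cnj d) (a * d + b * cnj c))
      (cball 0 1)"
    using f g disk_moebius_compose[OF f(1) g(1)] disk_moebius_norm_cball[OF g(1)]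
    by (auto simp: compose_def)
  then show ?thesis using disk_moebius_in_isometries[OF disk_moebius_compose_coeffs[OF f(1) g(1)]]
      by simp
qed

lemma disk_isometry_inverse:
  assumes "f \<in> disk_isometries"
  obtains g where "g \<in> disk_isometries" "\<And>z. norm z \<le> 1 \<Longrightarrow> g (f z) = z" "\<And>z. norm z \<le> 1 \<Longrightarrow> f (g z) =
      z"
proof -
  obtain a b where f: "norm b < norm a" "\<And>z. norm z \<le> 1 \<Longrightarrow> f z = disk_moebius a b z"
    using disk_isometriesE[OF assms] by blast
  define g where "g = restrict (disk_moebius (cnj a) (- b)) (cball 0 1)"
  have n: "norm (- b) < norm (cnj a)" using f by simp
  have g: "g \<in> disk_isometries" unfolding g_def by (rule disk_moebius_in_isometries[OF n])
  show ?thesis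
  proof
    show "g (f z) = z" if "norm z \<le> 1" for z
      using that f disk_isometry_norm(3)[OF assms that] disk_moebius_inverse[OF f(1) that] by
          (simp add: g_def)
    show "f (g z) = z" if "norm z \<le> 1" for z
      using that f disk_isometry_norm(3)[OF g that] disk_moebius_inverse'[OF f(1) that] by (simp
          add: g_def)
  qed (rule g)
qed

lemma disk_isometry_in_Bij:
  assumes "f \<in> disk_isometries" shows "f \<in> Bij (cball 0 1)"
proof -
  obtain g where g: "g \<in> disk_isometries" "\<And>z. norm z \<le> 1 \<Longrightarrow> g (f z) = z" "\<And>z. norm z \<le> 1 \<Longrightarrow> f (g z)
      = z"
    using disk_isometry_inverse[OF assms] by blast
  have "bij_betw f (cball 0 1) (cball 0 1)"
    by (rule bij_betw_byWitness[where f' = g])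
      (use g disk_isometry_norm(3)[OF assms] disk_isometry_norm(3)[OF g(1)] in auto)
  moreover have "f \<in> extensional (cball 0 1)" using disk_isometriesE[OF assms] by (metis
      restrict_extensional)
  ultimately show ?thesis by (simp add: Bij_def)
qed

lemma quadratic_three_roots:
  fixes A B C :: "'a::field"
  assumes "A * p\<^sup>2 + B * p + C = 0" "A * q\<^sup>2 + B * q + C = 0" "A * r\<^sup>2 + B * r + C = 0"
    and "p \<noteq> q" "q \<noteq> r" "p \<noteq> r"
  shows "A = 0 \<and> B = 0 \<and> C = 0"
proof -
  have "(p - q) * (A * (p + q) + B) = 0" "(p - r) * (A * (p + r) + B) = 0"
    using assms(1-3) by algebra+
  then have 1: "A * (p + q) + B = 0" and 2: "A * (p + r) + B = 0" using assms by auto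
  then have "A * (q - r) = 0" by algebra
  then have "A = 0" using assms by auto
  then show ?thesis using 1 assms(1) by simp
qed

text \<open>Agreement of two Moebius maps at \<open>z\<close> clears to a quadratic equation in
  \<open>z\<close>; three zeros make all its coefficients vanish.\<close>

lemma disk_isometry_eqI:
  assumes f: "f \<in> disk_isometries" and g: "g \<in> disk_isometries"
    and pqr: "norm p \<le> 1" "norm q \<le> 1" "norm r \<le> 1" "p \<noteq> q" "q \<noteq> r" "p \<noteq> r"
    and eq: "f p = g p" "f q = g q" "f r = g r"
  shows "f = g"
proof -
  obtain a b where ab: "norm b < norm a" "\<And>z. norm z \<le> 1 \<Longrightarrow> f z = disk_moebius a b z"
    "f = restrict (disk_moebius a b) (cball 0 1)" using disk_isometriesE[OF f] by blast
  obtain c d where cd: "norm d < norm c" "\<And>z. norm z \<le> 1 \<Longrightarrow> g z = disk_moebius c d z"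
    "g = restrict (disk_moebius c d) (cball 0 1)" using disk_isometriesE[OF g] by blast
  define A where "A = a * cnj d - c * cnj b"
  define B where "B = a * cnj c + b * cnj d - c * cnj a - d * cnj b"
  define C where "C = b * cnj c - d * cnj a"
  have iff: "disk_moebius a b z = disk_moebius c d z \<longleftrightarrow> A * z\<^sup>2 + B * z + C = 0" if "norm z \<le> 1"
      for z
  proof -
    have "disk_moebius a b z = disk_moebius c d z \<longleftrightarrow>
        (a * z + b) * (cnj d * z + cnj c) = (c * z + d) * (cnj b * z + cnj a)"
      using disk_moebius_denominator_nz[OF ab(1) that] disk_moebius_denominator_nz[OF cd(1) that]
      by (simp add: disk_moebius_def frac_eq_eq)
    also have "\<dots> \<longleftrightarrow> A * z\<^sup>2 + B * z + C = 0"
      unfolding A_def B_def C_def by (subst eq_iff_diff_eq_0) (simp add: algebra_simps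
          power2_eq_square)
    finally show ?thesis .
  qed
  have "A = 0 \<and> B = 0 \<and> C = 0"
    using eq pqr iff ab(2) cd(2) by (intro quadratic_three_roots[of A p B C q r]) auto
  then have "disk_moebius a b z = disk_moebius c d z" if "norm z \<le> 1" for z using iff[OF that] by
      simp
  then show ?thesis unfolding ab(3) cd(3) by (intro restrict_ext) simp
qed

lemma finite_disk_isometries:
  assumes "A \<subseteq> disk_isometries" "finite X" "norm p \<le> 1" "norm q \<le> 1" "norm r \<le> 1" "p \<noteq> q" "q \<noteq> r"
      "p \<noteq> r"
    and "\<And>f. f \<in> A \<Longrightarrow> f p \<in> X \<and> f q \<in> X \<and> f r \<in> X"
  shows "finite A"
proof (rule inj_on_finite)
  show "inj_on (\<lambda>f. (f p, f q, f r)) A"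
    using disk_isometry_eqI[of _ _ p q r] assms by (intro inj_onI) auto
  show "(\<lambda>f. (f p, f q, f r)) ` A \<subseteq> X \<times> X \<times> X" using assms by auto
  show "finite (X \<times> X \<times> X)" using assms by simp
qed

text \<open>The factor splits into contributions of the two points. A relation between differences
  that is homogeneous in each point, such as harmonicity, therefore survives the map.\<close>

lemma disk_moebius_diff:
  assumes "norm b < norm a" "norm p \<le> 1" "norm q \<le> 1"
  shows "disk_moebius a b p - disk_moebius a b q =
    of_real ((norm a)\<^sup>2 - (norm b)\<^sup>2) * (p - q) / ((cnj b * p + cnj a) * (cnj b * q + cnj a))"
  using disk_moebius_denominator_nz[OF assms(1,2)] disk_moebius_denominator_nz[OF assms(1,3)]
  by (simp add: disk_moebius_def of_real_norm_power2 diff_frac_eq) (simp add: algebra_simps)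

text \<open>The imaginary part comes from \<open>w - cnj w\<close>, which on the circle is a
  rational expression that factors into differences of the points. Isometries multiply such
  differences in a controlled way.\<close>

lemma counterclockwise_sphere:
  assumes "norm p = 1" "norm q = 1" "norm r = 1"
  shows "counterclockwise p q r \<longleftrightarrow> Im ((p - q) * (r - p) * (r - q) / (p * q * r)) > 0"
proof -
  define w where "w = cnj (q - p) * (r - p)"
  have nz: "p \<noteq> 0" "q \<noteq> 0" "r \<noteq> 0" using assms by auto
  have "w - cnj w = (p - q) * (r - p) * (r - q) / (p * q * r)"
    unfolding w_def using nz by (simp add: sphere_cnj assms field_simps)
  moreover have "Im (w - cnj w) = 2 * Im w" by simp
  ultimately have "Im ((p - q) * (r - p) * (r - q) / (p * q * r)) = 2 * Im w" by metis
  then show ?thesis unfolding counterclockwise_def w_def[symmetric] by simp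
qed

text \<open>The expression \<open>V\<close> is multiplied by the positive number
  \<open>\<kappa>\<close>: the three differences contribute \<open>D ^ 3\<close> over squared
  denominators, and the product of the image points turns these squares into squared moduli.\<close>

lemma disk_isometry_counterclockwise:
  assumes f: "f \<in> disk_isometries" and n: "norm p = 1" "norm q = 1" "norm r = 1"
  shows "counterclockwise (f p) (f q) (f r) \<longleftrightarrow> counterclockwise p q r"
proof -
  obtain a b where ab: "norm b < norm a" "\<And>z. norm z \<le> 1 \<Longrightarrow> f z = disk_moebius a b z"
    using disk_isometriesE[OF f] by blast
  define d where "d z = cnj b * z + cnj a" for z
  define D where "D = (norm a)\<^sup>2 - (norm b)\<^sup>2"
  have D: "D > 0" using ab by (simp add: D_def power_strict_mono)
  have d0: "d z \<noteq> 0" if "norm z = 1" for z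
    using disk_moebius_denominator_nz[OF ab(1)] that by (simp add: d_def)
  have c: "x * cnj x = 1" if "norm x = 1" for x
    using that of_real_norm_power2[of x] by simp
  \<comment> \<open>On the circle the numerator \<open>a * z + b\<close> is \<open>z\<close> times
    the conjugate of the denominator.\<close>
  have fz: "f z = z * cnj (d z) / d z" if "norm z = 1" for z
  proof -
    have "a * z + b = z * cnj (d z)"
      using c[OF that] unfolding d_def complex_cnj_add complex_cnj_mult complex_cnj_cnj by algebra
    then show ?thesis using ab(2) that by (simp add: disk_moebius_def d_def)
  qed
  have fd: "f x - f y = of_real D * (x - y) / (d x * d y)" if "norm x = 1" "norm y = 1" for x y
    using that ab disk_moebius_diff[OF ab(1)] by (simp add: D_def d_def)
  define V where "V = (p - q) * (r - p) * (r - q) / (p * q * r)"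
  define \<kappa> where "\<kappa> = D ^ 3 / ((norm (d p))\<^sup>2 * (norm (d q))\<^sup>2 * (norm (d r))\<^sup>2)"
  have k: "\<kappa> > 0" using D d0 n by (simp add: \<kappa>_def)
  have nz: "p \<noteq> 0" "q \<noteq> 0" "r \<noteq> 0" using n by auto
  have "(f p - f q) * (f r - f p) * (f r - f q) / (f p * f q * f r) = of_real \<kappa> * V"
  proof -
    have alg: "(c * x / (u * v)) * (c * y / (w * u)) * (c * z / (w * v)) / ((p * u' / u) * (q * v'
        / v) * (r * w' / w))
        = c ^ 3 / ((u * u') * (v * v') * (w * w')) * (x * y * z / (p * q * r))"
      if "u \<noteq> 0" "v \<noteq> 0" "w \<noteq> 0" "u' \<noteq> 0" "v' \<noteq> 0" "w' \<noteq> 0" for c x y z u v w u' v' w' :: complex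
      using that nz by (simp add: field_simps power3_eq_cube)
    show ?thesis
      unfolding fd[OF n(1) n(2)] fd[OF n(3) n(1)] fd[OF n(3) n(2)]
      unfolding fz[OF n(1)] fz[OF n(2)] fz[OF n(3)] \<kappa>_def V_def
      by (subst alg) (use d0 n in \<open>auto simp: of_real_norm_power2\<close>)
  qed
  then have "counterclockwise (f p) (f q) (f r) \<longleftrightarrow> Im (of_real \<kappa> * V) > 0"
    using counterclockwise_sphere disk_isometry_norm(1)[OF f] n by simp
  also have "Im (of_real \<kappa> * V) = \<kappa> * Im V" by simp
  also have "\<kappa> * Im V > 0 \<longleftrightarrow> counterclockwise p q r"
    unfolding counterclockwise_sphere[OF n] V_def[symmetric] using k by (simp add:
        zero_less_mult_iff)
  finally show ?thesis .
qed

section \<open>Isometries as projective maps of the Klein disk\<close>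

definition klein :: "complex \<Rightarrow> complex" where
  "klein z = (2 / (1 + (norm z)\<^sup>2)) *\<^sub>R z"

text \<open>In the Klein disk an isometry is a projective map, so the weight on the left and the
  numerator on the right are real affine in \<open>w\<close>. Multiplication by \<open>s\<close>,
  with \<open>s * w = 2 * z\<close>, removes the fractions.\<close>

lemma klein_moebius:
  assumes ab: "norm b < norm a" and z: "norm z \<le> 1"
  defines "w \<equiv> klein z"
  shows "of_real ((norm a)\<^sup>2 + (norm b)\<^sup>2 + 2 * Re (a * cnj b * w)) * klein (disk_moebius a b z)
      = a\<^sup>2 * w + b\<^sup>2 * cnj w + 2 * a * b"
proof -
  define d where "d = cnj b * z + cnj a"
  define n where "n = a * z + b"
  have d: "d \<noteq> 0" using disk_moebius_denominator_nz[OF ab z] by (simp add: d_def)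
  define s where "s = 1 + (norm z)\<^sup>2"
  have s: "s > 0" by (simp add: s_def add_pos_nonneg)
  have s': "of_real s = 1 + z * cnj z" by (simp add: s_def of_real_norm_power2)
  have w: "of_real s * w = 2 * z" 
    unfolding w_def klein_def s_def[symmetric] scaleR_conv_of_real using s by simp
  have w': "of_real s * cnj w = 2 * cnj z" using arg_cong[OF w, of cnj] by simp
  define N where "N = (norm d)\<^sup>2 + (norm n)\<^sup>2"
  have N: "N > 0" using d by (simp add: N_def add_pos_nonneg)
  have N': "of_real N = d * cnj d + n * cnj n" by (simp add: N_def of_real_norm_power2)
  have k: "of_real N * klein (disk_moebius a b z) = 2 * n * cnj d"
  proof -
    have "disk_moebius a b z = n / d" by (simp add: disk_moebius_def n_def d_def)
    moreover have "(1 + (norm (n / d))\<^sup>2) * (norm d)\<^sup>2 = N"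
      using d by (simp add: N_def norm_divide field_simps)
    then have "1 + (norm (n / d))\<^sup>2 = N / (norm d)\<^sup>2" using d by (simp add: field_simps)
    ultimately have "klein (disk_moebius a b z) = of_real (2 / (N / (norm d)\<^sup>2)) * (n / d)"
      unfolding klein_def by (simp only: scaleR_conv_of_real)
    also have "\<dots> = 2 * (d * cnj d) / of_real N * (n / d)" by (simp add: of_real_norm_power2)
    finally show ?thesis using N d by (simp add: field_simps)
  qed
  have "of_real s * of_real ((norm a)\<^sup>2 + (norm b)\<^sup>2 + 2 * Re (a * cnj b * w)) = (of_real N ::
      complex)"
  proof -
    have "of_real (2 * Re (a * cnj b * w)) = a * cnj b * w + cnj a * b * cnj w"
      using complex_add_cnj[of "a * cnj b * w"] by simp
    then have "of_real s * of_real ((norm a)\<^sup>2 + (norm b)\<^sup>2 + 2 * Re (a * cnj b * w))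
      = of_real s * (a * cnj a + b * cnj b) + a * cnj b * (of_real s * w) + cnj a * b * (of_real s
          * cnj w)"
      by (simp add: of_real_norm_power2 algebra_simps)
    also have "\<dots> = of_real s * (a * cnj a + b * cnj b) + a * cnj b * (2 * z) + cnj a * b * (2 *
        cnj z)"
      by (simp only: w w')
    also have "\<dots> = of_real N"
      unfolding N' s' d_def n_def by (simp add: algebra_simps)
    finally show ?thesis .
  qed
  then have "of_real s * (of_real ((norm a)\<^sup>2 + (norm b)\<^sup>2 + 2 * Re (a * cnj b * w)) * klein
      (disk_moebius a b z)) = 2 * n * cnj d"
    using k by (simp add: mult.assoc[symmetric])
  also have "\<dots> = a\<^sup>2 * (2 * z) + b\<^sup>2 * (2 * cnj z) + 2 * a * b * of_real s"
    unfolding s' d_def n_def by (simp add: algebra_simps power2_eq_square)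
  also have "\<dots> = a\<^sup>2 * (of_real s * w) + b\<^sup>2 * (of_real s * cnj w) + 2 * a * b * of_real s"
    by (simp only: w w')
  also have "\<dots> = of_real s * (a\<^sup>2 * w + b\<^sup>2 * cnj w + 2 * a * b)" by (simp add: algebra_simps)
  finally show ?thesis using s by simp
qed

lemma klein_sphere: "norm z = 1 \<Longrightarrow> klein z = z"
  by (simp add: klein_def)

text \<open>A projective map multiplies the barycentric weights by the values of its denominator
  \<open>d\<close> at the vertices and then divides by their weighted sum. Positivity of
  \<open>d\<close> keeps the weights positive.\<close>

lemma disk_isometry_positive_combination:
  assumes f: "f \<in> disk_isometries" and n: "norm p = 1" "norm q = 1" "norm r = 1" and z: "norm z \<le> 1"
    and x: "x > 0" "y > 0" "t > 0" "x + y + t = 1" and kz: "klein z = x *\<^sub>R p + y *\<^sub>R q + t *\<^sub>R r"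
  shows "\<exists>x y t. 0 < x \<and> 0 < y \<and> 0 < t \<and> x + y + t = 1 \<and> klein (f z) = x *\<^sub>R f p + y *\<^sub>R f q + t
      *\<^sub>R f r"
proof -
  obtain a b where ab: "norm b < norm a" "\<And>z. norm z \<le> 1 \<Longrightarrow> f z = disk_moebius a b z"
    using disk_isometriesE[OF f] by blast
  define d where "d w = (norm a)\<^sup>2 + (norm b)\<^sup>2 + 2 * Re (a * cnj b * w)" for w
  have key: "of_real (d (klein w)) * klein (f w) = a\<^sup>2 * klein w + b\<^sup>2 * cnj (klein w) + 2 * a *
      b" if "norm w \<le> 1" for w
    using klein_moebius[OF ab(1) that] ab(2) that by (simp add: d_def)
  have keys: "of_real (d w) * f w = a\<^sup>2 * w + b\<^sup>2 * cnj w + 2 * a * b" if "norm w = 1" for w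
    using key[of w] that klein_sphere disk_isometry_norm(1)[OF f] by simp
  \<comment> \<open>The weight is bounded below by (|a| - |b|)^2.\<close>
  have dpos: "d w > 0" if "norm w = 1" for w
  proof -
    have "\<bar>Re (a * cnj b * w)\<bar> \<le> norm a * norm b"
      using abs_Re_le_cmod[of "a * cnj b * w"] that by (simp add: norm_mult)
    moreover have "(norm a - norm b)\<^sup>2 > 0" using ab by simp
    ultimately show ?thesis by (simp add: d_def power2_diff abs_le_iff)
  qed
  have dz: "d (klein z) = x * d p + y * d q + t * d r"
  proof -
    have t: "t = 1 - x - y" using x by simp
    show ?thesis unfolding kz d_def t by (simp add: algebra_simps)
  qed
  have pos: "x * d p > 0" "y * d q > 0" "t * d r > 0" using dpos n x by auto
  have D: "d (klein z) > 0" unfolding dz using pos by linarith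
  have "of_real (d (klein z)) * klein (f z) =
      of_real (x * d p) * f p + of_real (y * d q) * f q + of_real (t * d r) * f r"
  proof -
    have t: "of_real t = (1 - of_real x - of_real y :: complex)" using x(4) by (metis
        add_diff_cancel_left' diff_diff_eq of_real_1 of_real_diff)
    have "of_real (x * d p) * f p + of_real (y * d q) * f q + of_real (t * d r) * f r
      = of_real x * (a\<^sup>2 * p + b\<^sup>2 * cnj p + 2 * a * b) + of_real y * (a\<^sup>2 * q + b\<^sup>2 * cnj q + 2 *
          a * b)
        + of_real t * (a\<^sup>2 * r + b\<^sup>2 * cnj r + 2 * a * b)"
      using keys[OF n(1)] keys[OF n(2)] keys[OF n(3)] by (simp add: mult.assoc)
    also have "\<dots> = a\<^sup>2 * klein z + b\<^sup>2 * cnj (klein z) + 2 * a * b"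
      unfolding kz scaleR_conv_of_real complex_cnj_add complex_cnj_mult
          complex_cnj_complex_of_real t
      by (simp add: algebra_simps)
    finally show ?thesis using key[OF z] by simp
  qed
  then have "klein (f z) = (x * d p / d (klein z)) *\<^sub>R f p + (y * d q / d (klein z)) *\<^sub>R f q + (t
      * d r / d (klein z)) *\<^sub>R f r"
    using D by (simp add: scaleR_conv_of_real field_simps)
  moreover have "x * d p / d (klein z) + y * d q / d (klein z) + t * d r / d (klein z) = 1"
    using D dz by (simp add: add_divide_distrib[symmetric])
  ultimately show ?thesis using pos D by (intro exI conjI) (auto simp del: of_real_mult)
qed

section \<open>The Farey tesselation\<close>

text \<open>Conjugating the equation on the circle and eliminating \<open>z\<close> leaves (p - q)^2
  = 0. This keeps the denominator of a reflection away from zero.\<close>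

lemma midpoint_sphere_ne:
  fixes p q z :: complex
  assumes "norm p = 1" "norm q = 1" "norm z = 1" "p \<noteq> q"
  shows "2 * z \<noteq> p + q"
proof
  assume h: "2 * z = p + q"
  have nz: "p \<noteq> 0" "q \<noteq> 0" "z \<noteq> 0" using assms by auto
  have "2 * (1 / z) = 1 / p + 1 / q" using arg_cong[OF h, of cnj] by (simp add: sphere_cnj assms)
  then have "2 * (p * q) = z * (p + q)" using nz by (simp add: field_simps)
  then have "(p - q)\<^sup>2 = 0" using h by algebra
  then show False using assms by simp
qed

text \<open>On the circle the antiholomorphic reflection coincides with a Moebius map, since
  conjugation is inversion there.\<close>

lemma geodesic_reflection_sphere_eq:
  assumes "norm z = 1"
  shows "geodesic_reflection p q z = (2 * p * q - (p + q) * z) / ((p + q) - 2 * z)"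
proof -
  have "z \<noteq> 0" using assms by auto
  then have "2 * p * q - (p + q) * z = z * (2 * p * q * (1 / z) - (p + q))"
    "(p + q) - 2 * z = z * ((p + q) * (1 / z) - 2)"
    by (simp_all add: field_simps)
  then show ?thesis using \<open>z \<noteq> 0\<close> unfolding geodesic_reflection_def sphere_cnj[OF assms] by simp
qed

text \<open>The equation says that \<open>z\<close> and \<open>r\<close> are harmonic conjugates
  with respect to \<open>p\<close> and \<open>q\<close>. It is symmetric in \<open>z\<close> and
  \<open>r\<close> and covariant under Moebius maps, which yields involutivity and equivariance of
  reflections.\<close>

lemma geodesic_reflection_eq_iff:
  assumes "norm p = 1" "norm q = 1" "norm z = 1" "p \<noteq> q"
  shows "r = geodesic_reflection p q z \<longleftrightarrow> (z - p) * (r - q) + (z - q) * (r - p) = 0"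
proof -
  have "(p + q) - 2 * z \<noteq> 0" using midpoint_sphere_ne[OF assms] by simp
  then have "r = geodesic_reflection p q z \<longleftrightarrow> r * ((p + q) - 2 * z) - (2 * p * q - (p + q) * z) = 0"
    unfolding geodesic_reflection_sphere_eq[OF assms(3)] by (simp add: nonzero_eq_divide_eq)
  also have "r * ((p + q) - 2 * z) - (2 * p * q - (p + q) * z) = - ((z - p) * (r - q) + (z - q) *
      (r - p))"
    by algebra
  finally show ?thesis by (simp only: neg_equal_0_iff_equal)
qed

text \<open>The numerator is \<open>- p * q * z\<close> times the conjugate of the
  denominator.\<close>

lemma geodesic_reflection_norm:
  assumes "norm p = 1" "norm q = 1" "norm z = 1" "p \<noteq> q"
  shows "norm (geodesic_reflection p q z) = 1"
proof -
  let ?D = "(p + q) - 2 * z"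
  have nz: "p \<noteq> 0" "q \<noteq> 0" "z \<noteq> 0" using assms by auto
  have D: "?D \<noteq> 0" using midpoint_sphere_ne[OF assms] by simp
  have "2 * p * q - (p + q) * z = - p * q * z * cnj ?D"
    using nz by (simp add: sphere_cnj assms field_simps)
  then have "norm (2 * p * q - (p + q) * z) = norm ?D"
    by (simp add: norm_mult assms flip: complex_cnj_add complex_cnj_mult complex_cnj_diff)
  then show ?thesis using D by (simp add: geodesic_reflection_sphere_eq assms norm_divide)
qed

lemma geodesic_reflection_involution:
  assumes "norm p = 1" "norm q = 1" "norm z = 1" "p \<noteq> q"
  shows "geodesic_reflection p q (geodesic_reflection p q z) = z"
proof -
  let ?r = "geodesic_reflection p q z"
  have "(z - p) * (?r - q) + (z - q) * (?r - p) = 0" using geodesic_reflection_eq_iff[OF assms, of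
      ?r] by simp
  then have "(?r - p) * (z - q) + (?r - q) * (z - p) = 0" by (simp add: algebra_simps)
  then show ?thesis
    using geodesic_reflection_eq_iff[OF assms(1,2) geodesic_reflection_norm[OF assms] assms(4), of
        z] by simp
qed

lemma geodesic_reflection_endpoints:
  assumes "norm p = 1" "norm q = 1" "p \<noteq> q"
  shows "geodesic_reflection p q p = p" "geodesic_reflection p q q = q"
  using geodesic_reflection_eq_iff[of p q p p] geodesic_reflection_eq_iff[of p q q q] assms by auto

lemma disk_isometry_inj:
  assumes "f \<in> disk_isometries" "norm x \<le> 1" "norm y \<le> 1" "f x = f y" shows "x = y"
  using disk_isometry_inverse[OF assms(1)] assms(2-4) by metis

lemma disk_isometry_geodesic_reflection:
  assumes f: "f \<in> disk_isometries" and n: "norm p = 1" "norm q = 1" "norm z = 1" "p \<noteq> q"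
  shows "f (geodesic_reflection p q z) = geodesic_reflection (f p) (f q) (f z)"
proof -
  obtain a b where ab: "norm b < norm a" "\<And>z. norm z \<le> 1 \<Longrightarrow> f z = disk_moebius a b z"
    using disk_isometriesE[OF f] by blast
  define d where "d z = cnj b * z + cnj a" for z
  define D where "D = complex_of_real ((norm a)\<^sup>2 - (norm b)\<^sup>2)"
  have d0: "d z \<noteq> 0" if "norm z = 1" for z
    using disk_moebius_denominator_nz[OF ab(1)] that by (simp add: d_def)
  have fd: "f x - f y = D * (x - y) / (d x * d y)" if "norm x = 1" "norm y = 1" for x y
    using that ab disk_moebius_diff[OF ab(1)] by (simp add: D_def d_def)
  let ?r = "geodesic_reflection p q z"
  have r: "norm ?r = 1" by (rule geodesic_reflection_norm[OF n])
  have "(f z - f p) * (f ?r - f q) + (f z - f q) * (f ?r - f p) =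
      D * D / (d z * d p * d ?r * d q) * ((z - p) * (?r - q) + (z - q) * (?r - p))"
    unfolding fd[OF n(3,1)] fd[OF r n(2)] fd[OF n(3,2)] fd[OF r n(1)]
    using d0 n r by (simp add: field_simps)
  also have "\<dots> = 0" using geodesic_reflection_eq_iff[OF n, of ?r] by simp
  finally have "(f z - f p) * (f ?r - f q) + (f z - f q) * (f ?r - f p) = 0" .
  moreover have "f p \<noteq> f q" using disk_isometry_inj[OF f, of p q] n by auto
  ultimately show ?thesis
    using geodesic_reflection_eq_iff[of "f p" "f q" "f z" "f ?r"] disk_isometry_norm(1)[OF f] n by
        simp
qed

lemma geodesic_reflection_commute: "geodesic_reflection p q = geodesic_reflection q p"
  by (simp add: geodesic_reflection_def fun_eq_iff add.commute mult.commute mult.left_commute)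

lemma geodesic_reflection_third:
  assumes "norm p = 1" "norm q = 1" "p \<noteq> q"
  shows "geodesic_reflection p q ` {p, q, r} = {p, q, geodesic_reflection p q r}"
  using geodesic_reflection_endpoints[OF assms] by simp

text \<open>
  The Cayley transform from the upper half plane to the disk that takes \<open>\<infinity>, 0, 1\<close> to \<open>1, -1, -\<i>\<close>,
  evaluated at the rational number \<open>p/q\<close>.
\<close>

definition farey_point :: "int \<Rightarrow> int \<Rightarrow> complex" where
  "farey_point p q = (of_int p - \<i> * of_int q) / (of_int p + \<i> * of_int q)"

lemma farey_point_denominator_nz: "p \<noteq> 0 \<or> q \<noteq> 0 \<Longrightarrow> of_int p + \<i> * of_int q \<noteq> (0 :: complex)"
  by (simp add: complex_eq_iff)

lemma farey_point_norm:
  assumes "p \<noteq> 0 \<or> q \<noteq> 0" shows "norm (farey_point p q) = 1"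
proof -
  have "of_int p - \<i> * of_int q = cnj (of_int p + \<i> * of_int q :: complex)" by simp
  then have "norm (of_int p - \<i> * of_int q :: complex) = norm (of_int p + \<i> * of_int q :: complex)"
    by (metis complex_mod_cnj)
  then show ?thesis using farey_point_denominator_nz[OF assms] by (simp add: farey_point_def
      norm_divide)
qed

lemma farey_point_uminus: "farey_point (- p) (- q) = farey_point p q"
proof -
  have "farey_point (- p) (- q) = - (of_int p - \<i> * of_int q) / - (of_int p + \<i> * of_int q)"
    by (simp add: farey_point_def algebra_simps)
  then show ?thesis by (simp only: farey_point_def minus_divide_divide)
qed

lemma farey_point_eq_iff:
  assumes "a \<noteq> 0 \<or> b \<noteq> 0" "c \<noteq> 0 \<or> d \<noteq> 0"
  shows "farey_point a b = farey_point c d \<longleftrightarrow> a * d - b * c = 0"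
proof -
  have "farey_point a b = farey_point c d \<longleftrightarrow>
      (of_int a - \<i> * of_int b) * (of_int c + \<i> * of_int d) - (of_int c - \<i> * of_int d) * (of_int
          a + \<i> * of_int b) = 0"
    using assms farey_point_denominator_nz by (simp add: farey_point_def frac_eq_eq)
  also have "(of_int a - \<i> * of_int b) * (of_int c + \<i> * of_int d) - (of_int c - \<i> * of_int d) *
      (of_int a + \<i> * of_int b)
      = 2 * \<i> * of_int (a * d - b * c)" by (simp add: algebra_simps)
  finally show ?thesis by (metis (no_types, lifting) complex_i_not_zero mult_eq_0_iff
      of_int_eq_0_iff zero_neq_numeral)
qed

text \<open>The point is (a - i b)^2 / (a^2 + b^2). Quadratic forms in the integers
  \<open>a\<close>, \<open>b\<close> can thus be evaluated as affine functions of the point, which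
  the noncrossing argument exploits.\<close>

lemma farey_point_Re_Im:
  assumes "a \<noteq> 0 \<or> b \<noteq> 0"
  shows "(of_int a ^ 2 + of_int b ^ 2) * Re (farey_point a b) = of_int a ^ 2 - of_int b ^ 2"
    "(of_int a ^ 2 + of_int b ^ 2) * Im (farey_point a b) = - 2 * of_int a * of_int b"
proof -
  have "of_real (of_int a ^ 2 + of_int b ^ 2) * farey_point a b = (of_int a - \<i> * of_int b)\<^sup>2"
  proof -
    have "of_real (of_int a ^ 2 + of_int b ^ 2) = (of_int a - \<i> * of_int b) * (of_int a + \<i> *
        of_int b)"
      by (simp add: algebra_simps power2_eq_square)
    then show ?thesis using farey_point_denominator_nz[OF assms]
      by (simp add: farey_point_def power2_eq_square)
  qed
  from arg_cong[OF this, of Re] arg_cong[OF this, of Im]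
  show "(of_int a ^ 2 + of_int b ^ 2) * Re (farey_point a b) = of_int a ^ 2 - of_int b ^ 2"
    "(of_int a ^ 2 + of_int b ^ 2) * Im (farey_point a b) = - 2 * of_int a * of_int b"
    by (simp_all add: power2_eq_square algebra_simps)
qed

text \<open>Sum and difference of two integer vectors give harmonic conjugates with respect to the
  points of the vectors: all four differences are \<open>D\<close> or \<open>- D\<close> over
  products of denominators, and the two terms cancel.\<close>

lemma geodesic_reflection_farey_point:
  assumes "a * d - b * c \<noteq> 0" "a + c \<noteq> 0 \<or> b + d \<noteq> 0" "a - c \<noteq> 0 \<or> b - d \<noteq> 0"
  shows "geodesic_reflection (farey_point a b) (farey_point c d) (farey_point (a + c) (b + d)) =
      farey_point (a - c) (b - d)"
proof -
  have nz: "a \<noteq> 0 \<or> b \<noteq> 0" "c \<noteq> 0 \<or> d \<noteq> 0" using assms(1) by auto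
  define u u' v v' :: complex where "u = of_int a - \<i> * of_int b" and "u' = of_int a + \<i> * of_int b"
    and "v = of_int c - \<i> * of_int d" and "v' = of_int c + \<i> * of_int d"
  have P: "farey_point a b = u / u'" "farey_point c d = v / v'" "farey_point (a + c) (b + d) = (u
      + v) / (u' + v')"
    "farey_point (a - c) (b - d) = (u - v) / (u' - v')"
    by (simp_all add: farey_point_def u_def u'_def v_def v'_def algebra_simps)
  have n: "u' \<noteq> 0" "v' \<noteq> 0" "u' + v' \<noteq> 0" "u' - v' \<noteq> 0"
    using farey_point_denominator_nz[OF nz(1)] farey_point_denominator_nz[OF nz(2)]
      farey_point_denominator_nz[OF assms(2)] farey_point_denominator_nz[OF assms(3)]
    by (simp_all add: u'_def v'_def algebra_simps)
  define D where "D = v * u' - u * v'"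
  have eqs: "(u + v) / (u' + v') - u / u' = D / (u' * (u' + v'))"
    "(u - v) / (u' - v') - v / v' = - D / (v' * (u' - v'))"
    "(u + v) / (u' + v') - v / v' = - D / (v' * (u' + v'))"
    "(u - v) / (u' - v') - u / u' = - D / (u' * (u' - v'))"
    using n by (simp_all add: D_def diff_frac_eq) (simp_all add: algebra_simps)
  have "((u + v) / (u' + v') - u / u') * ((u - v) / (u' - v') - v / v') +
      ((u + v) / (u' + v') - v / v') * ((u - v) / (u' - v') - u / u') = 0"
    unfolding eqs by (simp add: mult.commute mult.left_commute)
  moreover have "farey_point a b \<noteq> farey_point c d" using farey_point_eq_iff[OF nz] assms(1) by simp
  ultimately show ?thesis
    using geodesic_reflection_eq_iff[OF farey_point_norm[OF nz(1)] farey_point_norm[OF nz(2)]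
        farey_point_norm[OF assms(2)]]
    unfolding P by metis
qed

section \<open>Farey triangles and edges as unimodular integer vectors\<close>

lemma unimodular_nz:
  fixes a b c d :: int
  assumes "\<bar>a * d - b * c\<bar> = 1"
  shows "a \<noteq> 0 \<or> b \<noteq> 0" "c \<noteq> 0 \<or> d \<noteq> 0" "a + c \<noteq> 0 \<or> b + d \<noteq> 0" "a - c \<noteq> 0 \<or> b - d \<noteq> 0"
proof -
  show "a + c \<noteq> 0 \<or> b + d \<noteq> 0"
  proof (rule ccontr)
    assume "\<not> (a + c \<noteq> 0 \<or> b + d \<noteq> 0)"
    then have "c = - a" "d = - b" by auto
    then show False using assms by simp
  qed
qed (use assms in auto)

text \<open>From vectors (v, w) with third vertex v + w one passes to (v + w, -v) with third vertex
  w. Together with the exchange of v and w this reaches every ordered pair of vertices; the signs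
  are immaterial for \<open>farey_point\<close>.\<close>

lemma unimodular_triangle_edge:
  assumes det: "\<bar>a * d - b * c\<bar> = 1" and T: "T = {farey_point a b, farey_point c d, farey_point (a
      + c) (b + d)}"
    and pq: "p \<in> T" "q \<in> T" "p \<noteq> q"
  obtains x y z w where "\<bar>x * w - y * z\<bar> = 1" "p = farey_point x y" "q = farey_point z w"
    "T = {p, q, farey_point (x + z) (y + w)}"
proof -
  define R where "R a b c d \<longleftrightarrow> \<bar>a * d - b * c\<bar> = 1 \<and>
    T = {farey_point a b, farey_point c d, farey_point (a + c) (b + d)}" for a b c d
  have swap: "R c d a b" if "R a b c d" for a b c d
    using that unfolding R_def by (auto simp: insert_commute add.commute mult.commute
        abs_minus_commute)
  have rotate: "R (a + c) (b + d) (- a) (- b)" if "R a b c d" for a b c d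
    using that unfolding R_def farey_point_uminus
    by (auto simp: insert_commute algebra_simps abs_if split: if_splits)
  have R1: "R a b c d" using det T by (simp add: R_def)
  define Q where "Q p q \<longleftrightarrow> (\<exists>x y z w. R x y z w \<and> p = farey_point x y \<and> q = farey_point z w)" for p q
  have "Q (farey_point a b) (farey_point c d)" "Q (farey_point c d) (farey_point a b)"
    using R1 swap[OF R1] unfolding Q_def by metis+
  moreover have "Q (farey_point (a + c) (b + d)) (farey_point a b)" "Q (farey_point a b)
      (farey_point (a + c) (b + d))"
    using rotate[OF R1] swap[OF rotate[OF R1]] farey_point_uminus unfolding Q_def by metis+
  moreover have "Q (farey_point (a + c) (b + d)) (farey_point c d)" "Q (farey_point c d)
      (farey_point (a + c) (b + d))"
    using rotate[OF swap[OF R1]] swap[OF rotate[OF swap[OF R1]]] farey_point_uminus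
    unfolding Q_def add.commute[of c a] add.commute[of d b] by metis+
  ultimately have "Q p q" using pq unfolding T by auto
  then show thesis using that by (auto simp: R_def Q_def)
qed

text \<open>The base triangle is 1/0, 0/1, 1/1. Reflection in the side of v and w replaces v + w by
  v - w, which is again a sum after w has changed sign.\<close>

lemma farey_triangle_cases:
  assumes "T \<in> farey_triangles"
  obtains a b c d where "\<bar>a * d - b * c\<bar> = 1"
    "T = {farey_point a b, farey_point c d, farey_point (a + c) (b + d)}"
proof -
  from assms have "\<exists>a b c d. \<bar>a * d - b * c\<bar> = 1 \<and>
      T = {farey_point a b, farey_point c d, farey_point (a + c) (b + d)}"
  proof induction
    case base
    have "farey_point 1 0 = 1" "farey_point 0 1 = -1" "farey_point (1 + 0) (0 + 1) = - \<i>"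
      by (simp_all add: farey_point_def complex_eq_iff Re_divide Im_divide)
    then show ?case by (intro exI[of _ 1] exI[of _ 0]) (simp add: insert_commute)
  next
    case (reflect T p q)
    then obtain a b c d where det: "\<bar>a * d - b * c\<bar> = 1"
      and T: "T = {farey_point a b, farey_point c d, farey_point (a + c) (b + d)}" by blast
    have main: "\<exists>a b c d. \<bar>a * d - b * c\<bar> = 1 \<and>
        geodesic_reflection (farey_point x y) (farey_point z w) ` T = {farey_point a b,
            farey_point c d, farey_point (a + c) (b + d)}"
      if xyzw: "\<bar>x * w - y * z\<bar> = 1" and T': "T = {farey_point x y, farey_point z w, farey_point
          (x + z) (y + w)}" for x y z w
    proof -
      note nz = unimodular_nz[OF xyzw]
      have ne: "farey_point x y \<noteq> farey_point z w" using farey_point_eq_iff[OF nz(1,2)] xyzw by auto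
      have "geodesic_reflection (farey_point x y) (farey_point z w) ` T = {farey_point x y,
          farey_point z w, farey_point (x - z) (y - w)}"
        unfolding T' geodesic_reflection_third[OF farey_point_norm[OF nz(1)] farey_point_norm[OF
            nz(2)] ne]
        using geodesic_reflection_farey_point[OF _ nz(3,4)] xyzw by auto
      then show ?thesis using xyzw farey_point_uminus[of z w]
        by (intro exI[of _ x] exI[of _ y] exI[of _ "- z"] exI[of _ "- w"]) (auto simp:
            algebra_simps)
    qed
    obtain x y z w where "\<bar>x * w - y * z\<bar> = 1" "p = farey_point x y" "q = farey_point z w"
      "T = {p, q, farey_point (x + z) (y + w)}"
      by (rule unimodular_triangle_edge[OF det T reflect(2-4)])
    then show ?case using main[of x w y z] by simp
  qed
  then show thesis using that by blast
qed

lemma farey_triangle_vertices: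
  assumes "T \<in> farey_triangles"
  obtains p q r where "T = {p, q, r}" "p \<noteq> q" "q \<noteq> r" "p \<noteq> r" "norm p = 1" "norm q = 1" "norm r = 1"
proof -
  obtain a b c d where det: "\<bar>a * d - b * c\<bar> = 1"
    and T: "T = {farey_point a b, farey_point c d, farey_point (a + c) (b + d)}"
    by (rule farey_triangle_cases[OF assms])
  note nz = unimodular_nz[OF det]
  show thesis
  proof (rule that[OF T])
    show "farey_point a b \<noteq> farey_point c d" using farey_point_eq_iff[OF nz(1,2)] det by auto
    show "farey_point c d \<noteq> farey_point (a + c) (b + d)" using farey_point_eq_iff[OF nz(2,3)] det
        by (auto simp: algebra_simps)
    show "farey_point a b \<noteq> farey_point (a + c) (b + d)" using farey_point_eq_iff[OF nz(1,3)] det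
        by (auto simp: algebra_simps)
  qed (use farey_point_norm nz in auto)
qed

lemma farey_triangle_sphere: "T \<in> farey_triangles \<Longrightarrow> z \<in> T \<Longrightarrow> norm z = 1"
  by (metis farey_triangle_vertices insertE singletonD)

lemma farey_edge_cases:
  assumes "e \<in> farey_edges"
  obtains a b c d where "\<bar>a * d - b * c\<bar> = 1" "e = {farey_point a b, farey_point c d}"
proof -
  obtain p q T where pq: "e = {p, q}" "p \<noteq> q" "T \<in> farey_triangles" "p \<in> T" "q \<in> T"
    using assms by (auto simp: farey_edges_def)
  obtain a b c d where det: "\<bar>a * d - b * c\<bar> = 1"
    and T: "T = {farey_point a b, farey_point c d, farey_point (a + c) (b + d)}"
    by (rule farey_triangle_cases[OF pq(3)])
  have "e = {farey_point a b, farey_point c d} \<or> e = {farey_point a b, farey_point (a + c) (b + d)}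
     \<or> e = {farey_point c d, farey_point (a + c) (b + d)}"
    using pq T by auto
  moreover have "\<bar>a * (b + d) - b * (a + c)\<bar> = 1" "\<bar>c * (b + d) - d * (a + c)\<bar> = 1"
    using det by (auto simp: algebra_simps abs_if split: if_splits)
  ultimately show thesis using that det by blast
qed

lemma farey_edge_sphere:
  assumes "e \<in> farey_edges" "z \<in> e" shows "norm z = 1"
  using assms farey_triangle_sphere by (auto simp: farey_edges_def)

text \<open>Both vectors are primitive, so one is an integer multiple \<open>k\<close> of the other
  and \<open>k\<close> must be a unit.\<close>

lemma unimodular_parallel:
  fixes a b c d x y z w :: int
  assumes 1: "\<bar>a * d - b * c\<bar> = 1" and 2: "\<bar>x * w - y * z\<bar> = 1" and par: "a * y - b * x = 0"
  shows "(x = a \<and> y = b) \<or> (x = - a \<and> y = - b)"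
proof -
  define k where "k = (a * d - b * c) * (x * d - y * c)"
  have s: "(a * d - b * c) * (a * d - b * c) = 1" using 1 by (metis abs_mult_self_eq mult_1)
  have "x = (a * d - b * c) * (a * d - b * c) * x" "y = (a * d - b * c) * (a * d - b * c) * y"
      using s by simp_all
  moreover have "(a * d - b * c) * x = a * (x * d - y * c)" "(a * d - b * c) * y = b * (x * d - y
      * c)"
    using par by algebra+
  ultimately have xy: "x = k * a" "y = k * b" unfolding k_def by (metis mult.assoc mult.commute)+
  then have "x * w - y * z = k * (a * w - b * z)" by (simp add: algebra_simps)
  then have "\<bar>k\<bar> = 1" using 2 by (metis abs_mult abs_ge_zero zmult_eq_1_iff abs_zmult_eq_1)
  then show ?thesis using xy by (auto simp: abs_if split: if_splits)
qed

text \<open>An edge comes with some integer vectors for its endpoints, and the one over the given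
  vertex is \<open>(g, h)\<close> up to sign. The numbers \<open>g'\<close>, \<open>h'\<close>
  certify that \<open>(g, h)\<close> is primitive.\<close>

lemma farey_neighbour:
  assumes gh: "\<bar>g * h' - h * g'\<bar> = 1" and e: "{farey_point g h, r} \<in> farey_edges"
  shows "\<exists>x y. \<bar>g * y - h * x\<bar> = 1 \<and> r = farey_point x y"
proof -
  obtain a b c d where det: "\<bar>a * d - b * c\<bar> = 1" "{farey_point g h, r} = {farey_point a b,
      farey_point c d}"
    by (rule farey_edge_cases[OF e])
  have "\<bar>c * b - d * a\<bar> = 1" using det(1) by (metis abs_minus_commute mult.commute)
  then obtain x' y' x y where xy: "\<bar>x' * y - y' * x\<bar> = 1" "farey_point g h = farey_point x' y'" "r
      = farey_point x y"
    using det by (metis doubleton_eq_iff)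
  have "g * y' - h * x' = 0"
    using xy(2) farey_point_eq_iff[OF unimodular_nz(1)[OF gh] unimodular_nz(1)[OF xy(1)]] by simp
  then have "(x' = g \<and> y' = h) \<or> (x' = - g \<and> y' = - h)" using unimodular_parallel[OF gh xy(1)] by
      blast
  then have "\<bar>g * y - h * x\<bar> = 1" using xy(1) by (auto simp: abs_if split: if_splits)
  then show ?thesis using xy(3) by blast
qed

text \<open>A vector of \<open>r\<close> has determinant 1 or -1 with both endpoint vectors v and w.
  Cramer's rule \<open>D * x = c * A - a * B\<close> leaves only v + w and v - w up to sign, so at
  most two triangles share the side.\<close>

lemma farey_common_neighbour:
  assumes T: "T \<in> farey_triangles" "p \<in> T" "q \<in> T" "p \<noteq> q" and r: "{p, r} \<in> farey_edges" "{q, r} \<in>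
      farey_edges"
  shows "{p, q, r} = T \<or> {p, q, r} = geodesic_reflection p q ` T"
proof -
  obtain a b c d where ac: "\<bar>a * d - b * c\<bar> = 1" "p = farey_point a b" "q = farey_point c d"
    "T = {p, q, farey_point (a + c) (b + d)}"
    using farey_triangle_cases[OF T(1)] unimodular_triangle_edge[OF _ _ T(2-4)] by metis
  note nz = unimodular_nz[OF ac(1)]
  have ca: "\<bar>c * b - d * a\<bar> = 1" using ac(1) by (metis abs_minus_commute mult.commute)
  have "geodesic_reflection p q ` T = {p, q, geodesic_reflection p q (farey_point (a + c) (b + d))}"
    by (subst ac(4), rule geodesic_reflection_third) (use ac(2,3) nz farey_point_norm T(4) in auto)
  also have "geodesic_reflection p q (farey_point (a + c) (b + d)) = farey_point (a - c) (b - d)"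
    unfolding ac(2,3) by (rule geodesic_reflection_farey_point) (use nz ac(1) in auto)
  finally have refl: "geodesic_reflection p q ` T = {p, q, farey_point (a - c) (b - d)}" .
  obtain x y where xy: "\<bar>a * y - b * x\<bar> = 1" "r = farey_point x y" using farey_neighbour[OF ac(1)]
      r(1) ac(2) by blast
  obtain x' y' where xy': "\<bar>c * y' - d * x'\<bar> = 1" "r = farey_point x' y'" using farey_neighbour[OF
      ca] r(2) ac(3) by blast
  have xy2: "\<bar>x * b - y * a\<bar> = 1" "\<bar>x' * d - y' * c\<bar> = 1"
    using xy(1) xy'(1) by (metis abs_minus_commute mult.commute)+
  have "x * y' - y * x' = 0"
    using xy(2) xy'(2) farey_point_eq_iff[OF unimodular_nz(1)[OF xy2(1)] unimodular_nz(1)[OF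
        xy2(2)]] by simp
  then have "(x' = x \<and> y' = y) \<or> (x' = - x \<and> y' = - y)" by (rule unimodular_parallel[OF xy2])
  then have cy: "\<bar>c * y - d * x\<bar> = 1" using xy'(1) by (auto simp: abs_if split: if_splits)
  define A B D where "A = a * y - b * x" and "B = c * y - d * x" and "D = a * d - b * c"
  have unit: "A = 1 \<or> A = -1" "B = 1 \<or> B = -1" "D = 1 \<or> D = -1"
    using xy(1) cy ac(1) by (auto simp: A_def B_def D_def abs_if split: if_splits)
  have "D * x = c * A - a * B" "D * y = d * A - b * B" by (auto simp: A_def B_def D_def
      algebra_simps)
  then have "(x = a + c \<and> y = b + d) \<or> (x = - (a + c) \<and> y = - (b + d)) \<or> (x = a - c \<and> y = b - d) \<or>
      (x = - (a - c) \<and> y = - (b - d))"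
    using unit by auto
  then have "r = farey_point (a + c) (b + d) \<or> r = farey_point (a - c) (b - d)"
    using xy(2) farey_point_uminus by metis
  then show ?thesis using ac(4) refl by auto
qed

text \<open>The vertex \<open>r\<close> is a common neighbour of the ends of an edge, which leaves
  only the triangles on both sides of it. This lets isometries that preserve edges act on
  triangles.\<close>

lemma farey_triangleI:
  assumes "p \<noteq> q" "{p, q} \<in> farey_edges" "{p, r} \<in> farey_edges" "{q, r} \<in> farey_edges"
  shows "{p, q, r} \<in> farey_triangles"
proof -
  obtain x y T where xy: "{p, q} = {x, y}" "T \<in> farey_triangles" "{x, y} \<subseteq> T"
    using assms(2) unfolding farey_edges_def mem_Collect_eq by metis
  then have T: "T \<in> farey_triangles" "p \<in> T" "q \<in> T" by auto
  show ?thesis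
    using farey_common_neighbour[OF T assms(1,3,4)] T farey_triangles.reflect[OF T assms(1)] by auto
qed

text \<open>Otherwise \<open>x * y'\<close> and \<open>x' * y\<close> are nonzero integers of
  opposite sign, and their difference has absolute value at least 2.\<close>

lemma unimodular_no_sign_change:
  fixes x x' y y' :: int
  assumes "\<bar>x * y' - x' * y\<bar> = 1" shows "\<not> (x * x' > 0 \<and> y * y' < 0)"
proof
  assume h: "x * x' > 0 \<and> y * y' < 0"
  have "(x * y') * (x' * y) < 0" using h by (metis mult.assoc mult.commute mult.left_commute
      mult_pos_neg)
  then have "(0 < x * y' \<and> x' * y < 0) \<or> (x * y' < 0 \<and> 0 < x' * y)"
    by (simp only: mult_less_0_iff[of "x * y'" "x' * y"])
  then show False using assms by (elim disjE) linarith+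
qed

text \<open>The affine function \<open>L\<close> vanishes on the chord, and at a vertex its sign is
  that of a product of two determinants. By unimodularity no two vertices lie strictly on opposite
  sides and not all lie on the chord, so \<open>L\<close> is nonzero at every strictly positive
  combination.\<close>

lemma farey_noncrossing:
  assumes T: "\<bar>a * d - b * c\<bar> = 1" and e: "\<bar>g * l - h * k\<bar> = (1::int)"
    and pos: "x > 0" "y > 0" "t > 0" "x + y + t = 1"
    and w: "w = x *\<^sub>R farey_point a b + y *\<^sub>R farey_point c d + t *\<^sub>R farey_point (a + c) (b + d)"
  shows "w \<notin> convex hull {farey_point g h, farey_point k l}"
proof
  assume "w \<in> convex hull {farey_point g h, farey_point k l}"
  then obtain s where s: "w = (1 - s) *\<^sub>R farey_point g h + s *\<^sub>R farey_point k l"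
    unfolding convex_hull_2_alt by (auto simp: algebra_simps)
  \<comment> \<open>This is twice the quadratic form
    \<open>(i * h - j * g) * (i * l - j * k)\<close> divided by i^2 + j^2 and written in the
    coordinates of the point: 1 + Re, Im and 1 - Re stand for 2 i^2, -2 i j and 2 j^2.\<close>
  define L :: "complex \<Rightarrow> real" where
    "L w = (1 + Re w) * (h * l) + Im w * (h * k + g * l) + (1 - Re w) * (g * k)" for w
  have L: "(real_of_int i ^ 2 + real_of_int j ^ 2) * L (farey_point i j) = 2 * of_int ((i * h - j
      * g) * (i * l - j * k))"
    if ij: "i \<noteq> 0 \<or> j \<noteq> 0" for i j
  proof -
    let ?n = "real_of_int i ^ 2 + real_of_int j ^ 2"
    have "?n * L (farey_point i j) = (?n + ?n * Re (farey_point i j)) * (h * l)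
        + (?n * Im (farey_point i j)) * (h * k + g * l) + (?n - ?n * Re (farey_point i j)) * (g *
            k)"
      unfolding L_def by (simp add: algebra_simps)
    then show ?thesis unfolding farey_point_Re_Im[OF ij] by (simp add: algebra_simps
        power2_eq_square)
  qed
  have npos: "real_of_int i ^ 2 + real_of_int j ^ 2 > 0" if "i \<noteq> 0 \<or> j \<noteq> 0" for i j
    using that by (auto simp: sum_power2_gt_zero_iff)
  have zero: "L (farey_point g h) = 0" "L (farey_point k l) = 0"
  proof -
    have "L (farey_point i j) = 0" if "i \<noteq> 0 \<or> j \<noteq> 0" "(i * h - j * g) * (i * l - j * k) = 0" for
        i j
      using L[OF that(1)] npos[OF that(1)] that(1) unfolding that(2) by auto
    then show "L (farey_point g h) = 0" "L (farey_point k l) = 0"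
      using unimodular_nz(1,2)[OF e] by (simp_all add: mult.commute)
  qed
  have "L w = (1 - s) * L (farey_point g h) + s * L (farey_point k l)"
    unfolding s L_def by (simp add: algebra_simps)
  then have Lw: "L w = 0" using zero by simp
  have comb: "L w = x * L (farey_point a b) + y * L (farey_point c d) + t * L (farey_point (a + c)
      (b + d))"
  proof -
    have t: "t = 1 - x - y" using pos by simp
    show ?thesis unfolding w t L_def by (simp add: algebra_simps)
  qed
  define A A' B B' where "A = a * h - b * g" and "A' = a * l - b * k" and "B = c * h - d * g" and
      "B' = c * l - d * k"
  have sgn: "sgn (L (farey_point a b)) = of_int (sgn (A * A'))" "sgn (L (farey_point c d)) =
      of_int (sgn (B * B'))"
    "sgn (L (farey_point (a + c) (b + d))) = of_int (sgn ((A + B) * (A' + B')))"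
  proof -
    have ofint: "sgn (real_of_int n) = of_int (sgn n)" for n by (simp add: sgn_if)
    have S: "sgn (L (farey_point i j)) = of_int (sgn ((i * h - j * g) * (i * l - j * k)))" if ij:
        "i \<noteq> 0 \<or> j \<noteq> 0" for i j
    proof -
      have "sgn (L (farey_point i j)) = sgn ((real_of_int i ^ 2 + real_of_int j ^ 2) * L
          (farey_point i j))"
        using npos[OF ij] by (simp add: sgn_mult)
      also have "\<dots> = sgn (real_of_int ((i * h - j * g) * (i * l - j * k)))" unfolding L[OF ij] by
          (simp add: sgn_mult)
      finally show ?thesis by (simp only: ofint)
    qed
    note nz = unimodular_nz[OF T]
    show "sgn (L (farey_point a b)) = of_int (sgn (A * A'))" "sgn (L (farey_point c d)) = of_int
        (sgn (B * B'))"
      using S[OF nz(1)] S[OF nz(2)] by (simp_all add: A_def A'_def B_def B'_def)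
    have "(a + c) * h - (b + d) * g = A + B" "(a + c) * l - (b + d) * k = A' + B'"
      by (simp_all add: A_def A'_def B_def B'_def algebra_simps)
    then show "sgn (L (farey_point (a + c) (b + d))) = of_int (sgn ((A + B) * (A' + B')))"
      using S[OF nz(3)] by simp
  qed
  \<comment> \<open>The passage to \<open>(A, A')\<close> and \<open>(B, B')\<close> is linear of
    determinant 1 or -1, so these vectors are unimodular again.\<close>
  have "A * B' - A' * B = (a * d - b * c) * (g * l - h * k)"
    by (simp add: A_def A'_def B_def B'_def algebra_simps)
  then have det: "\<bar>A * B' - A' * B\<bar> = 1" using T e by (simp add: abs_mult)
  have det1: "\<bar>A * (A' + B') - A' * (A + B)\<bar> = 1" "\<bar>B * (A' + B') - B' * (A + B)\<bar> = 1"
    using det by (auto simp: algebra_simps abs_if split: if_splits)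
  have det': "\<bar>B * A' - B' * A\<bar> = 1" "\<bar>(A + B) * A' - (A' + B') * A\<bar> = 1" "\<bar>(A + B) * B' - (A' +
      B') * B\<bar> = 1"
    using det det1 by (metis abs_minus_commute mult.commute)+
  \<comment> \<open>All six ordered pairs formed from the two vectors and their sum.\<close>
  note ns = unimodular_no_sign_change[OF det] unimodular_no_sign_change[OF det1(1)]
      unimodular_no_sign_change[OF det1(2)]
    unimodular_no_sign_change[OF det'(1)] unimodular_no_sign_change[OF det'(2)]
        unimodular_no_sign_change[OF det'(3)]
  have nz: "A * A' \<noteq> 0 \<or> B * B' \<noteq> 0 \<or> (A + B) * (A' + B') \<noteq> 0"
    using det by auto
  have spos: "L z > 0 \<longleftrightarrow> n > 0" "L z < 0 \<longleftrightarrow> n < 0" "L z = 0 \<longleftrightarrow> n = 0"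
    if "sgn (L z) = of_int (sgn n)" for z and n :: int
    using that by (auto simp: sgn_if split: if_splits)
  note sp = spos[OF sgn(1)] spos[OF sgn(2)] spos[OF sgn(3)]
  have sum3: "u + v + z \<noteq> (0::real)" if "u \<noteq> 0 \<or> v \<noteq> 0 \<or> z \<noteq> 0"
    "\<not> (u > 0 \<and> v < 0)" "\<not> (u > 0 \<and> z < 0)" "\<not> (v > 0 \<and> z < 0)" "\<not> (v > 0 \<and> u < 0)" "\<not> (z > 0 \<and> u
        < 0)" "\<not> (z > 0 \<and> v < 0)" for u v z
    using that by linarith
  have "x * L (farey_point a b) + y * L (farey_point c d) + t * L (farey_point (a + c) (b + d)) \<noteq> 0"
    by (rule sum3) (use ns nz pos in \<open>simp_all add: zero_less_mult_iff mult_less_0_iff sp\<close>)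
  then show False using Lw comb by simp
qed

text \<open>Collinearity would make \<open>w\<close> real, whereas \<open>w - cnj w\<close> is a
  product of nonzero differences over \<open>p * q * r\<close>.\<close>

lemma sphere_not_collinear:
  fixes p q r :: complex
  assumes n: "norm p = 1" "norm q = 1" "norm r = 1" and ne: "p \<noteq> q" "q \<noteq> r" "p \<noteq> r"
  shows "\<not> collinear {p, q, r}"
proof
  assume "collinear {p, q, r}"
  then obtain u where u: "\<And>x y. x \<in> {p, q, r} \<Longrightarrow> y \<in> {p, q, r} \<Longrightarrow> \<exists>c. x - y = c *\<^sub>R u"
    unfolding collinear_def by blast
  obtain c c' where c: "q - p = c *\<^sub>R u" "r - p = c' *\<^sub>R u" using u[of q p] u[of r p] by auto
  define w where "w = cnj (q - p) * (r - p)"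
  have "w = of_real (c * c') * (u * cnj u)" unfolding w_def c by (simp add: scaleR_conv_of_real)
  then have "cnj w = w" by (simp add: mult.commute)
  moreover have "w - cnj w = (p - q) * (r - p) * (r - q) / (p * q * r)"
  proof -
    have nz: "p \<noteq> 0" "q \<noteq> 0" "r \<noteq> 0" using n by auto
    show ?thesis unfolding w_def using nz by (simp add: sphere_cnj n field_simps)
  qed
  ultimately show False using n ne by auto
qed

section \<open>The modular group and the torus group\<close>

lemma farey_edge_subset_cball: "e \<in> farey_edges \<Longrightarrow> e \<subseteq> cball 0 1"
  using farey_edge_sphere by fastforce

lemma farey_triangle_subset_cball: "T \<in> farey_triangles \<Longrightarrow> T \<subseteq> cball 0 1"
  using farey_triangle_sphere by fastforce

lemma compose_image: "A \<subseteq> S \<Longrightarrow> compose S f g ` A = f ` g ` A"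
  by (force simp: compose_def)

lemma isometry_group_mult: "f \<in> disk_isometries \<Longrightarrow> g \<in> disk_isometries \<Longrightarrow> f \<otimes>\<^bsub>BijGroup (cball 0 1)\<^esub>
    g = compose (cball 0 1) f g"
  by (simp add: BijGroup_def disk_isometry_in_Bij)

lemma carrier_PSL2Z: "carrier PSL2Z = {f \<in> disk_isometries. (`) f ` farey_edges = farey_edges}"
  by (simp add: PSL2Z_def)

lemma compose_image_farey_edges: "(`) (compose (cball 0 1) f g) ` farey_edges = (`) f ` (`) g `
    farey_edges"
proof -
  have "(`) (compose (cball 0 1) f g) ` farey_edges = (\<lambda>e. f ` g ` e) ` farey_edges"
    by (intro image_cong refl compose_image farey_edge_subset_cball)
  then show ?thesis by (simp only: image_image[of "(`) f" "(`) g"])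
qed

lemma restrict_id_image: "A \<subseteq> S \<Longrightarrow> (\<lambda>z\<in>S. z) ` A = A"
  by force

lemma restrict_id_farey_edges: "(`) (\<lambda>z\<in>cball 0 1. z) ` farey_edges = farey_edges"
proof -
  have "(`) (\<lambda>z\<in>cball 0 1. z) ` farey_edges = (\<lambda>e. e) ` farey_edges"
    by (intro image_cong refl restrict_id_image farey_edge_subset_cball)
  then show ?thesis by simp
qed

lemma subgroup_PSL2Z: "subgroup (carrier PSL2Z) (BijGroup (cball 0 1))"
proof (rule group.subgroupI[OF group_BijGroup])
  have "(\<lambda>z\<in>cball 0 1. z) = restrict (disk_moebius 1 0) (cball 0 1)"
    by (auto simp: disk_moebius_def)
  then have "(\<lambda>z\<in>cball 0 1. z) \<in> disk_isometries" using disk_moebius_in_isometries[of 0 1] by simp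
  then show "carrier PSL2Z \<noteq> {}" using restrict_id_farey_edges unfolding carrier_PSL2Z by blast
  show "carrier PSL2Z \<subseteq> carrier (BijGroup (cball 0 1))"
    by (auto simp: carrier_PSL2Z BijGroup_def disk_isometry_in_Bij)
next
  fix f assume "f \<in> carrier PSL2Z"
  then have f: "f \<in> disk_isometries" "(`) f ` farey_edges = farey_edges" by (auto simp:
      carrier_PSL2Z)
  obtain g where g: "g \<in> disk_isometries" "\<And>z. norm z \<le> 1 \<Longrightarrow> g (f z) = z" "\<And>z. norm z \<le> 1 \<Longrightarrow> f (g z)
      = z"
    using disk_isometry_inverse[OF f(1)] by blast
  have gf: "compose (cball 0 1) g f = (\<lambda>z\<in>cball 0 1. z)" using g by (auto simp: compose_def)
  have "inv\<^bsub>BijGroup (cball 0 1)\<^esub> f = g"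
    using disk_isometry_in_Bij[OF f(1)] disk_isometry_in_Bij[OF g(1)] gf isometry_group_mult[OF
        g(1) f(1)]
    by (intro group.inv_equality[OF group_BijGroup]) (simp_all add: BijGroup_def)
  moreover have "(`) g ` farey_edges = farey_edges"
  proof -
    have "(`) g ` (`) f ` farey_edges = (`) (\<lambda>z\<in>cball 0 1. z) ` farey_edges"
      using compose_image_farey_edges[of g f] unfolding gf by (rule sym)
    then show ?thesis unfolding f(2) restrict_id_farey_edges .
  qed
  ultimately show "inv\<^bsub>BijGroup (cball 0 1)\<^esub> f \<in> carrier PSL2Z" using g by (simp add: carrier_PSL2Z)
next
  fix f g assume "f \<in> carrier PSL2Z" "g \<in> carrier PSL2Z"
  then show "f \<otimes>\<^bsub>BijGroup (cball 0 1)\<^esub> g \<in> carrier PSL2Z"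
    by (simp add: carrier_PSL2Z isometry_group_mult disk_isometry_compose compose_image_farey_edges)
qed

lemma group_PSL2Z: "group PSL2Z"
  using subgroup.subgroup_is_group[OF subgroup_PSL2Z group_BijGroup] by (simp add: PSL2Z_def)

interpretation PSL2Z: group PSL2Z by (rule group_PSL2Z)

lemma PSL2Z_isometry: "f \<in> carrier PSL2Z \<Longrightarrow> f \<in> disk_isometries"
  by (simp add: carrier_PSL2Z)

lemma PSL2Z_mult:
  assumes "f \<in> carrier PSL2Z" "g \<in> carrier PSL2Z"
  shows "f \<otimes>\<^bsub>PSL2Z\<^esub> g = compose (cball 0 1) f g"
  using isometry_group_mult[OF PSL2Z_isometry[OF assms(1)] PSL2Z_isometry[OF assms(2)]]
  by (simp add: PSL2Z_def)

lemma PSL2Z_mult_apply: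
  assumes "f \<in> carrier PSL2Z" "g \<in> carrier PSL2Z" "norm z \<le> 1"
  shows "(f \<otimes>\<^bsub>PSL2Z\<^esub> g) z = f (g z)"
  using assms by (simp add: PSL2Z_mult compose_def)

lemma PSL2Z_mult_image:
  assumes "f \<in> carrier PSL2Z" "g \<in> carrier PSL2Z" "A \<subseteq> cball 0 1"
  shows "(f \<otimes>\<^bsub>PSL2Z\<^esub> g) ` A = f ` g ` A"
  using assms by (simp add: PSL2Z_mult compose_image)

lemma PSL2Z_one_apply: "norm z \<le> 1 \<Longrightarrow> \<one>\<^bsub>PSL2Z\<^esub> z = z"
  by (simp add: PSL2Z_def BijGroup_def)

lemma PSL2Z_one_image: "A \<subseteq> cball 0 1 \<Longrightarrow> \<one>\<^bsub>PSL2Z\<^esub> ` A = A"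
proof -
  assume A: "A \<subseteq> cball 0 1"
  have "\<one>\<^bsub>PSL2Z\<^esub> = (\<lambda>z\<in>cball 0 1. z)" by (simp add: PSL2Z_def BijGroup_def)
  then show ?thesis using restrict_id_image[OF A] by (simp only:)
qed

lemma PSL2Z_inv_apply:
  assumes "f \<in> carrier PSL2Z" "norm z \<le> 1"
  shows "(inv\<^bsub>PSL2Z\<^esub> f) (f z) = z" "f ((inv\<^bsub>PSL2Z\<^esub> f) z) = z"
  using assms PSL2Z_mult_apply[of "inv\<^bsub>PSL2Z\<^esub> f" f z, symmetric] PSL2Z_mult_apply[of f "inv\<^bsub>PSL2Z\<^esub>
      f" z, symmetric]
  by (simp_all add: PSL2Z_one_apply)

lemma PSL2Z_inv_image:
  assumes "f \<in> carrier PSL2Z" "A \<subseteq> cball 0 1"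
  shows "(inv\<^bsub>PSL2Z\<^esub> f) ` f ` A = A" "f ` (inv\<^bsub>PSL2Z\<^esub> f) ` A = A"
  using assms PSL2Z_mult_image[of "inv\<^bsub>PSL2Z\<^esub> f" f A, symmetric] PSL2Z_mult_image[of f "inv\<^bsub>PSL2Z\<^esub>
      f" A, symmetric]
  by (simp_all add: PSL2Z_one_image)

section \<open>Isometries that preserve the Farey triangles\<close>

lemma disk_isometry_reflect_triangle:
  assumes "f \<in> disk_isometries" "T \<in> farey_triangles" "p \<in> T" "q \<in> T" "p \<noteq> q"
  shows "f ` geodesic_reflection p q ` T = geodesic_reflection (f p) (f q) ` f ` T"
  unfolding image_image
  using assms by (intro image_cong refl disk_isometry_geodesic_reflection) (auto intro:
      farey_triangle_sphere)

lemma reflect_triangle_involution: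
  assumes "T \<in> farey_triangles" "p \<in> T" "q \<in> T" "p \<noteq> q"
  shows "geodesic_reflection p q ` geodesic_reflection p q ` T = T"
proof -
  have "geodesic_reflection p q (geodesic_reflection p q z) = z" if "z \<in> T" for z
    using assms that by (intro geodesic_reflection_involution) (auto intro: farey_triangle_sphere)
  then show ?thesis by (force simp: image_image)
qed

lemma reflect_triangle_endpoints:
  assumes "T \<in> farey_triangles" "p \<in> T" "q \<in> T" "p \<noteq> q"
  shows "p \<in> geodesic_reflection p q ` T" "q \<in> geodesic_reflection p q ` T"
proof -
  have n: "norm p = 1" "norm q = 1" using assms by (auto intro: farey_triangle_sphere)
  show "p \<in> geodesic_reflection p q ` T" "q \<in> geodesic_reflection p q ` T"
    by (rule image_eqI[OF _ assms(2)], simp add: geodesic_reflection_endpoints n assms)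
      (rule image_eqI[OF _ assms(3)], simp add: geodesic_reflection_endpoints n assms)
qed

text \<open>Isometries commute with reflections, and every reflection can be undone. The first
  induction carries the property from \<open>T0\<close> back to the base triangle, the second from
  there to \<open>T\<close>.\<close>

lemma disk_isometry_farey_triangles:
  assumes f: "f \<in> disk_isometries" and T0: "T0 \<in> farey_triangles" "f ` T0 \<in> farey_triangles" and
      T: "T \<in> farey_triangles"
  shows "f ` T \<in> farey_triangles"
proof -
  have ne: "f p \<noteq> f q" if "T \<in> farey_triangles" "p \<in> T" "q \<in> T" "p \<noteq> q" for T p q
    using disk_isometry_inj[OF f, of p q] farey_triangle_sphere[OF that(1)] that(2-4) by force
  have "f ` {1, -1, -\<i>} \<in> farey_triangles"
    using T0
  proof induction
    case (reflect T p q)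
    have "geodesic_reflection (f p) (f q) ` f ` geodesic_reflection p q ` T \<in> farey_triangles"
      using reflect reflect_triangle_endpoints[OF reflect(1-4)] ne[OF reflect(1-4)]
      by (intro farey_triangles.reflect) auto
    also have "geodesic_reflection (f p) (f q) ` f ` geodesic_reflection p q ` T = f ` T"
      using disk_isometry_reflect_triangle[OF f farey_triangles.reflect[OF reflect(1-4)]
          reflect_triangle_endpoints[OF reflect(1-4)] reflect(4)]
        reflect_triangle_involution[OF reflect(1-4)] by simp
    finally show ?case by (rule reflect.IH)
  qed
  with T show ?thesis
  proof induction
    case (reflect T p q)
    then show ?case
      using disk_isometry_reflect_triangle[OF f reflect(1-4)] ne[OF reflect(1-4)]
        farey_triangles.reflect[of "f ` T" "f p" "f q"] by auto
  qed
qed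

text \<open>One triangle suffices because all others follow by reflections. Applied to
  \<open>f\<close> and to its inverse, this gives equality of the edge sets and not only an
  inclusion.\<close>

lemma PSL2Z_I:
  assumes f: "f \<in> disk_isometries" and T0: "T0 \<in> farey_triangles" "f ` T0 \<in> farey_triangles"
  shows "f \<in> carrier PSL2Z"
proof -
  have edges: "g ` e \<in> farey_edges" if g: "g \<in> disk_isometries" "\<And>T. T \<in> farey_triangles \<Longrightarrow> g ` T \<in>
      farey_triangles"
    and e: "e \<in> farey_edges" for g e
  proof -
    obtain p q T where pq: "e = {p, q}" "p \<noteq> q" "T \<in> farey_triangles" "{p, q} \<subseteq> T"
      using e by (auto simp: farey_edges_def)
    have "g p \<noteq> g q" using disk_isometry_inj[OF g(1), of p q] farey_triangle_sphere[OF pq(3)] pq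
        by force
    moreover have "{g p, g q} \<subseteq> g ` T" using pq by auto
    ultimately show ?thesis
      using g(2)[OF pq(3)] unfolding pq(1) image_insert image_empty farey_edges_def by blast
  qed
  obtain g where g: "g \<in> disk_isometries" "\<And>z. norm z \<le> 1 \<Longrightarrow> g (f z) = z" "\<And>z. norm z \<le> 1 \<Longrightarrow> f (g z)
      = z"
    using disk_isometry_inverse[OF f] by blast
  have gf: "g ` f ` A = A" "f ` g ` A = A" if "A \<subseteq> cball 0 1" for A
  proof -
    have "g ` f ` A = (\<lambda>z. z) ` A" "f ` g ` A = (\<lambda>z. z) ` A"
      unfolding image_image by (rule image_cong[OF refl]; use that g in auto)+
    then show "g ` f ` A = A" "f ` g ` A = A" by simp_all
  qed
  have fT: "f ` T \<in> farey_triangles" if "T \<in> farey_triangles" for T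
    using disk_isometry_farey_triangles[OF f T0 that] .
  have gT: "g ` T \<in> farey_triangles" if "T \<in> farey_triangles" for T
    using disk_isometry_farey_triangles[OF g(1) T0(2) _ that] T0(1) gf(1)[OF
        farey_triangle_subset_cball[OF T0(1)]] by simp
  have "(`) f ` farey_edges = farey_edges"
  proof
    show "(`) f ` farey_edges \<subseteq> farey_edges" using edges[OF f fT] by auto
    show "farey_edges \<subseteq> (`) f ` farey_edges"
    proof
      fix e assume e: "e \<in> farey_edges"
      then have "e = f ` (g ` e)" using gf(2)[OF farey_edge_subset_cball[OF e]] by simp
      then show "e \<in> (`) f ` farey_edges" using edges[OF g(1) gT e] by blast
    qed
  qed
  then show ?thesis using f by (simp add: carrier_PSL2Z)
qed

lemma PSL2Z_farey_triangle:
  assumes f: "f \<in> carrier PSL2Z" and T: "T \<in> farey_triangles" shows "f ` T \<in> farey_triangles"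
proof -
  obtain p q r where pqr: "T = {p, q, r}" "p \<noteq> q" "q \<noteq> r" "p \<noteq> r" "norm p = 1" "norm q = 1" "norm
      r = 1"
    by (rule farey_triangle_vertices[OF T])
  have "{p, q} \<in> farey_edges" "{p, r} \<in> farey_edges" "{q, r} \<in> farey_edges"
    using T pqr unfolding farey_edges_def by blast+
  then have "f ` {p, q} \<in> farey_edges" "f ` {p, r} \<in> farey_edges" "f ` {q, r} \<in> farey_edges"
    using f unfolding carrier_PSL2Z by blast+
  moreover have "f p \<noteq> f q" using disk_isometry_inj[OF PSL2Z_isometry[OF f], of p q] pqr by auto
  ultimately show ?thesis unfolding pqr(1) by (simp add: farey_triangleI)
qed

section \<open>The base triangles T_1 (lower) and T_2 (upper), and the half turn\<close>

definition lower_triangle :: triangle where "lower_triangle = {-1, -\<i>, 1}"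
definition upper_triangle :: triangle where "upper_triangle = {1, \<i>, -1}"

lemma reflection_values:
  "geodesic_reflection 1 (-1) (-\<i>) = \<i>"
  "geodesic_reflection (-1) (-\<i>) 1 = - (3 / 5) - (4 / 5) * \<i>"
  "geodesic_reflection (-\<i>) 1 (-1) = 3 / 5 - (4 / 5) * \<i>"
  by (simp_all add: geodesic_reflection_def complex_eq_iff Re_divide Im_divide power2_eq_square)

lemma lower_triangle_farey: "lower_triangle \<in> farey_triangles"
  using farey_triangles.base by (simp add: lower_triangle_def insert_commute)

lemma lower_triangle_reflections:
  "geodesic_reflection 1 (-1) ` lower_triangle = upper_triangle"
  "geodesic_reflection (-1) (-\<i>) ` lower_triangle = {-1, -\<i>, - (3 / 5) - (4 / 5) * \<i>}"
  "geodesic_reflection (-\<i>) 1 ` lower_triangle = {-\<i>, 1, 3 / 5 - (4 / 5) * \<i>}"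
proof -
  have ne: "(1::complex) \<noteq> -1" "-1 \<noteq> -\<i>" "-\<i> \<noteq> 1" by (simp_all add: complex_eq_iff)
  show "geodesic_reflection 1 (-1) ` lower_triangle = upper_triangle"
    using geodesic_reflection_third[OF _ _ ne(1), of "-\<i>"]
    by (auto simp: reflection_values lower_triangle_def upper_triangle_def insert_commute)
  show "geodesic_reflection (-1) (-\<i>) ` lower_triangle = {-1, -\<i>, - (3 / 5) - (4 / 5) * \<i>}"
    using geodesic_reflection_third[OF _ _ ne(2), of 1] by (simp only: reflection_values
        lower_triangle_def) simp
  show "geodesic_reflection (-\<i>) 1 ` lower_triangle = {-\<i>, 1, 3 / 5 - (4 / 5) * \<i>}"
    using geodesic_reflection_third[OF _ _ ne(3), of "-1"]
    by (simp only: reflection_values lower_triangle_def insert_commute) simp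
qed

lemma upper_triangle_farey: "upper_triangle \<in> farey_triangles"
  using farey_triangles.reflect[OF lower_triangle_farey, of 1 "-1"] lower_triangle_reflections(1)
  by (simp add: lower_triangle_def)

text \<open>The coefficient i acts as i / conj i = -1, which is rotation by the angle
  \<open>\<pi>\<close>.\<close>

definition half_turn :: "complex \<Rightarrow> complex" where
  "half_turn = restrict (disk_moebius \<i> 0) (cball 0 1)"

lemma half_turn_apply: "norm z \<le> 1 \<Longrightarrow> half_turn z = - z"
  by (simp add: half_turn_def disk_moebius_def complex_eq_iff)

lemma half_turn_triangles: "half_turn ` lower_triangle = upper_triangle" "half_turn `
    upper_triangle = lower_triangle"
  by (auto simp: lower_triangle_def upper_triangle_def half_turn_apply)

lemma half_turn_PSL2Z: "half_turn \<in> carrier PSL2Z"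
  using PSL2Z_I[OF _ lower_triangle_farey, of half_turn] half_turn_triangles(1) upper_triangle_farey
    disk_moebius_in_isometries[of 0 \<i>] by (simp add: half_turn_def)

lemma half_turn_square: "half_turn \<otimes>\<^bsub>PSL2Z\<^esub> half_turn = \<one>\<^bsub>PSL2Z\<^esub>"
proof -
  have "(half_turn \<otimes>\<^bsub>PSL2Z\<^esub> half_turn) z = \<one>\<^bsub>PSL2Z\<^esub> z" if "norm z \<le> 1" for z
    using that half_turn_PSL2Z by (simp add: PSL2Z_mult_apply half_turn_apply PSL2Z_one_apply)
  then show ?thesis
    by (intro disk_isometry_eqI[of _ _ 1 "-1" \<i>] PSL2Z_isometry PSL2Z.m_closed PSL2Z.one_closed
        half_turn_PSL2Z)
      (auto simp: complex_eq_iff)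
qed

section \<open>Generators, orbits and index of the torus group\<close>

definition torus_generators :: "(complex \<Rightarrow> complex) set" where
  "torus_generators = {f \<in> carrier PSL2Z. (f 1 = -\<i> \<and> f \<i> = -1) \<or> (f \<i> = 1 \<and> f (-1) = -\<i>)}"

lemma torus_generators_subset: "torus_generators \<subseteq> carrier PSL2Z"
  by (auto simp: torus_generators_def)

lemma torus_group_eq: "torus_group = PSL2Z\<lparr>carrier := generate PSL2Z torus_generators\<rparr>"
  by (simp add: torus_group_def torus_generators_def)

lemma carrier_torus_group: "carrier torus_group = generate PSL2Z torus_generators"
  by (simp add: torus_group_eq)

lemma torus_group_eq_carrier: "torus_group = PSL2Z\<lparr>carrier := carrier torus_group\<rparr>"
  by (simp add: torus_group_eq)

lemma subgroup_torus_group: "subgroup (carrier torus_group) PSL2Z"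
  unfolding carrier_torus_group by (rule PSL2Z.generate_is_subgroup[OF torus_generators_subset])

lemma torus_group_subset: "carrier torus_group \<subseteq> carrier PSL2Z"
  by (rule subgroup.subset[OF subgroup_torus_group])

lemma group_torus_group: "group torus_group"
  using subgroup.subgroup_is_group[OF subgroup_torus_group group_PSL2Z] by (simp only:
      torus_group_eq_carrier[symmetric])

lemma mult_torus_group [simp]: "mult torus_group = mult PSL2Z" and one_torus_group [simp]: "one
    torus_group = one PSL2Z"
  by (simp_all add: torus_group_eq)

lemma r_coset_torus_group [simp]: "H #>\<^bsub>torus_group\<^esub> x = H #>\<^bsub>PSL2Z\<^esub> x"
  by (simp add: r_coset_def)

text \<open>The coefficients result from sending the third vertex of the upper triangle to the
  mirror image of the opposite vertex of the lower one. The determinant is 9 - 5 = 4; scaled to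
  determinant 1, both matrices have trace 3.\<close>

lemma torus_generator_exists:
  obtains a b where "a \<in> torus_generators" "b \<in> torus_generators" "a 1 = -\<i>" "a \<i> = -1" "b \<i> = 1"
      "b (-1) = -\<i>"
    "a ` upper_triangle = geodesic_reflection (-1) (-\<i>) ` lower_triangle"
    "b ` upper_triangle = geodesic_reflection (-\<i>) 1 ` lower_triangle"
proof -
  define a where "a = restrict (disk_moebius 3 (- (1 + 2 * \<i>))) (cball 0 1)"
  define b where "b = restrict (disk_moebius 3 (1 - 2 * \<i>)) (cball 0 1)"
  have "(norm (1 + 2 * \<i>))\<^sup>2 < 3\<^sup>2" "(norm (1 - 2 * \<i>))\<^sup>2 < 3\<^sup>2" by (simp_all add: cmod_power2)
  then have n: "norm (1 + 2 * \<i>) < 3" "norm (1 - 2 * \<i>) < 3" by (auto intro: power2_less_imp_less)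
  have iso: "a \<in> disk_isometries" "b \<in> disk_isometries"
    unfolding a_def b_def by (rule disk_moebius_in_isometries; use n in \<open>simp add:
        norm_minus_cancel[of "1 + 2 * \<i>"] del: minus_add_distrib\<close>)+
  have va: "a 1 = -\<i>" "a \<i> = -1" "a (-1) = - (3 / 5) - (4 / 5) * \<i>"
    by (simp_all add: a_def disk_moebius_def complex_eq_iff Re_divide Im_divide power2_eq_square)
  have vb: "b \<i> = 1" "b (-1) = -\<i>" "b 1 = 3 / 5 - (4 / 5) * \<i>"
    by (simp_all add: b_def disk_moebius_def complex_eq_iff Re_divide Im_divide power2_eq_square)
  have ima: "a ` upper_triangle = geodesic_reflection (-1) (-\<i>) ` lower_triangle"
    unfolding lower_triangle_reflections upper_triangle_def by (auto simp: va)
  have imb: "b ` upper_triangle = geodesic_reflection (-\<i>) 1 ` lower_triangle"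
    unfolding lower_triangle_reflections upper_triangle_def by (auto simp: vb)
  have far: "geodesic_reflection (-1) (-\<i>) ` lower_triangle \<in> farey_triangles"
      "geodesic_reflection (-\<i>) 1 ` lower_triangle \<in> farey_triangles"
    by (intro farey_triangles.reflect lower_triangle_farey; simp add: lower_triangle_def
        complex_eq_iff)+
  have "a \<in> carrier PSL2Z" "b \<in> carrier PSL2Z"
    using PSL2Z_I[OF iso(1) upper_triangle_farey] PSL2Z_I[OF iso(2) upper_triangle_farey] ima imb
        far by simp_all
  then show thesis using that va vb ima imb by (simp add: torus_generators_def)
qed

lemma reflection_of_preimage:
  assumes g: "g \<in> carrier PSL2Z" and T: "T \<in> farey_triangles" "T' \<in> farey_triangles" "p \<in> T'" "q \<in>
      T'" "p \<noteq> q"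
    and pq: "g p \<in> T" "g q \<in> T" and e: "g ` T' = geodesic_reflection (g p) (g q) ` T"
  shows "geodesic_reflection p q ` T' = (inv\<^bsub>PSL2Z\<^esub> g) ` T"
proof -
  have iso: "g \<in> disk_isometries" by (rule PSL2Z_isometry[OF g])
  have ne: "g p \<noteq> g q" using disk_isometry_inj[OF iso, of p q] farey_triangle_sphere[OF T(2)] T by
      force
  have "g ` geodesic_reflection p q ` T' = T"
    unfolding disk_isometry_reflect_triangle[OF iso T(2-5)] e
    by (rule reflect_triangle_involution[OF T(1) pq ne])
  then show ?thesis
    using PSL2Z_inv_image(1)[OF g farey_triangle_subset_cball[OF farey_triangles.reflect[OF
        T(2-5)]]] by simp
qed

text \<open>The common side exchanges the two triangles. Across the other sides of the lower one lie
  the images of the upper one under \<open>a\<close> and \<open>b\<close>, and across the other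
  sides of the upper one the images of the lower one under their inverses.\<close>

lemma base_triangle_reflection:
  assumes T: "T = lower_triangle \<or> T = upper_triangle" and pq: "p \<in> T" "q \<in> T" "p \<noteq> q"
  shows "\<exists>g\<in>carrier torus_group. geodesic_reflection p q ` T = g ` lower_triangle \<or>
      geodesic_reflection p q ` T = g ` upper_triangle"
proof -
  obtain a b where ab: "a \<in> torus_generators" "b \<in> torus_generators" "a 1 = -\<i>" "a \<i> = -1" "b \<i> =
      1" "b (-1) = -\<i>"
    "a ` upper_triangle = geodesic_reflection (-1) (-\<i>) ` lower_triangle"
    "b ` upper_triangle = geodesic_reflection (-\<i>) 1 ` lower_triangle"
    by (rule torus_generator_exists)
  have c: "a \<in> carrier PSL2Z" "b \<in> carrier PSL2Z" using ab torus_generators_subset by auto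
  have G: "a \<in> carrier torus_group" "b \<in> carrier torus_group" "inv\<^bsub>PSL2Z\<^esub> a \<in> carrier torus_group"
      "inv\<^bsub>PSL2Z\<^esub> b \<in> carrier torus_group"
    "\<one>\<^bsub>PSL2Z\<^esub> \<in> carrier torus_group"
    unfolding carrier_torus_group using ab(1,2) by (auto intro: generate.intros)
  have one: "\<one>\<^bsub>PSL2Z\<^esub> ` lower_triangle = lower_triangle" "\<one>\<^bsub>PSL2Z\<^esub> ` upper_triangle =
      upper_triangle"
    by (intro PSL2Z_one_image farey_triangle_subset_cball lower_triangle_farey
        upper_triangle_farey)+
  have L: "geodesic_reflection 1 (-1) ` lower_triangle = \<one>\<^bsub>PSL2Z\<^esub> ` upper_triangle"
    by (simp only: one lower_triangle_reflections)
  have U: "geodesic_reflection 1 (-1) ` upper_triangle = \<one>\<^bsub>PSL2Z\<^esub> ` lower_triangle"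
    unfolding one lower_triangle_reflections(1)[symmetric]
    by (rule reflect_triangle_involution[OF lower_triangle_farey]) (auto simp: lower_triangle_def)
  have A: "geodesic_reflection \<i> 1 ` upper_triangle = (inv\<^bsub>PSL2Z\<^esub> a) ` lower_triangle"
  proof (rule reflection_of_preimage[OF c(1) lower_triangle_farey upper_triangle_farey])
    show "a ` upper_triangle = geodesic_reflection (a \<i>) (a 1) ` lower_triangle" by (simp only: ab)
  qed (simp_all add: upper_triangle_def lower_triangle_def ab(3,4))
  have B: "geodesic_reflection (-1) \<i> ` upper_triangle = (inv\<^bsub>PSL2Z\<^esub> b) ` lower_triangle"
  proof (rule reflection_of_preimage[OF c(2) lower_triangle_farey upper_triangle_farey])
    show "b ` upper_triangle = geodesic_reflection (b (-1)) (b \<i>) ` lower_triangle" by (simp only: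
        ab)
    show "-1 \<noteq> \<i>" by (simp add: complex_eq_iff)
  qed (simp_all add: upper_triangle_def lower_triangle_def ab(5,6))
  define P where "P S \<longleftrightarrow> (\<exists>g\<in>carrier torus_group. S = g ` lower_triangle \<or> S = g ` upper_triangle)"
      for S
  have P: "P (geodesic_reflection 1 (-1) ` lower_triangle)" "P (geodesic_reflection (-1) (-\<i>) `
      lower_triangle)"
    "P (geodesic_reflection (-\<i>) 1 ` lower_triangle)" "P (geodesic_reflection 1 (-1) `
        upper_triangle)"
    "P (geodesic_reflection \<i> 1 ` upper_triangle)" "P (geodesic_reflection (-1) \<i> ` upper_triangle)"
    using G L U A B ab(7,8)[symmetric] unfolding P_def by blast+
  from T have "P (geodesic_reflection p q ` T)"
  proof
    assume T: "T = lower_triangle"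
    have "geodesic_reflection p q \<in> {geodesic_reflection 1 (-1), geodesic_reflection (-1) (-\<i>),
        geodesic_reflection (-\<i>) 1}"
      using pq unfolding T lower_triangle_def by (auto simp: geodesic_reflection_commute)
    then show ?thesis unfolding T using P by (elim insertE emptyE) (simp_all only:)
  next
    assume T: "T = upper_triangle"
    have "geodesic_reflection p q \<in> {geodesic_reflection 1 (-1), geodesic_reflection \<i> 1,
        geodesic_reflection (-1) \<i>}"
      using pq unfolding T upper_triangle_def by (auto simp: geodesic_reflection_commute)
    then show ?thesis unfolding T using P by (elim insertE emptyE) (simp_all only:)
  qed
  then show ?thesis by (simp only: P_def)
qed

lemma torus_group_orbit:
  assumes "T \<in> farey_triangles"
  shows "\<exists>g\<in>carrier torus_group. T = g ` lower_triangle \<or> T = g ` upper_triangle"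
  using assms
proof induction
  case base
  have "\<one>\<^bsub>PSL2Z\<^esub> ` lower_triangle = lower_triangle"
    by (intro PSL2Z_one_image farey_triangle_subset_cball lower_triangle_farey)
  then show ?case
    using subgroup.one_closed[OF subgroup_torus_group] by (auto simp: lower_triangle_def
        insert_commute)
next
  case (reflect T p q)
  then obtain g T0 where g: "g \<in> carrier torus_group" and T0: "T0 = lower_triangle \<or> T0 =
      upper_triangle" and T: "T = g ` T0"
    by blast
  have gP: "g \<in> carrier PSL2Z" using g torus_group_subset by auto
  have far: "T0 \<in> farey_triangles" using T0 lower_triangle_farey upper_triangle_farey by auto
  obtain p' q' where pq: "p' \<in> T0" "q' \<in> T0" "p = g p'" "q = g q'" using reflect T by auto
  have ne: "p' \<noteq> q'" using pq reflect by auto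
  obtain h S where h: "h \<in> carrier torus_group" "geodesic_reflection p' q' ` T0 = h ` S" "S =
      lower_triangle \<or> S = upper_triangle"
    using base_triangle_reflection[OF T0 pq(1,2) ne] by blast
  have hP: "h \<in> carrier PSL2Z" using h torus_group_subset by auto
  have S: "S \<subseteq> cball 0 1" using h(3) lower_triangle_farey upper_triangle_farey
      farey_triangle_subset_cball by blast
  have "geodesic_reflection p q ` T = (g \<otimes>\<^bsub>PSL2Z\<^esub> h) ` S"
    using disk_isometry_reflect_triangle[OF PSL2Z_isometry[OF gP] far pq(1,2) ne] T pq h(2)
        PSL2Z_mult_image[OF gP hP S] by simp
  moreover have "g \<otimes>\<^bsub>PSL2Z\<^esub> h \<in> carrier torus_group" using g h subgroup.m_closed[OF
      subgroup_torus_group] by blast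
  ultimately show ?case using h(3) by blast
qed

text \<open>The half turn exchanges the two sides paired by \<open>f\<close>, so conjugation
  reverses the pairing; the inverse restores its direction.\<close>

lemma half_turn_conj_generator:
  assumes "f \<in> torus_generators"
  shows "half_turn \<otimes>\<^bsub>PSL2Z\<^esub> inv\<^bsub>PSL2Z\<^esub> f \<otimes>\<^bsub>PSL2Z\<^esub> half_turn \<in> torus_generators"
proof -
  have f: "f \<in> carrier PSL2Z" using assms torus_generators_subset by auto
  let ?g = "inv\<^bsub>PSL2Z\<^esub> f"
  have g: "?g \<in> carrier PSL2Z" using f by simp
  have c: "half_turn \<otimes>\<^bsub>PSL2Z\<^esub> ?g \<otimes>\<^bsub>PSL2Z\<^esub> half_turn \<in> carrier PSL2Z"
    using g half_turn_PSL2Z by simp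
  have app: "(half_turn \<otimes>\<^bsub>PSL2Z\<^esub> ?g \<otimes>\<^bsub>PSL2Z\<^esub> half_turn) z = - ?g (- z)" if "norm z \<le> 1" for z
    using that g half_turn_PSL2Z disk_isometry_norm(3)[OF PSL2Z_isometry[OF g], of "- z"]
    by (simp add: PSL2Z_mult_apply half_turn_apply)
  have inv: "?g (f z) = z" if "norm z \<le> 1" for z using PSL2Z_inv_apply(1)[OF f that] .
  from assms have "(f 1 = -\<i> \<and> f \<i> = -1) \<or> (f \<i> = 1 \<and> f (-1) = -\<i>)" by (simp add:
      torus_generators_def)
  then show ?thesis
  proof
    assume "f 1 = -\<i> \<and> f \<i> = -1"
    then show ?thesis using inv[of 1] inv[of \<i>] app[of 1] app[of \<i>] c by (simp add:
        torus_generators_def)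
  next
    assume "f \<i> = 1 \<and> f (-1) = -\<i>"
    then show ?thesis using inv[of "-1"] inv[of \<i>] app[of "-1"] app[of \<i>] c by (simp add:
        torus_generators_def)
  qed
qed

lemma half_turn_conj_torus_group:
  assumes "g \<in> carrier torus_group"
  shows "half_turn \<otimes>\<^bsub>PSL2Z\<^esub> g \<otimes>\<^bsub>PSL2Z\<^esub> half_turn \<in> carrier torus_group"
proof -
  note s = half_turn_PSL2Z
  have sinv: "inv\<^bsub>PSL2Z\<^esub> half_turn = half_turn" using half_turn_square s by (intro
      PSL2Z.inv_equality)
  have conj: "half_turn \<otimes>\<^bsub>PSL2Z\<^esub> inv\<^bsub>PSL2Z\<^esub> x \<otimes>\<^bsub>PSL2Z\<^esub> half_turn = inv\<^bsub>PSL2Z\<^esub> (half_turn \<otimes>\<^bsub>PSL2Z\<^esub>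
      x \<otimes>\<^bsub>PSL2Z\<^esub> half_turn)"
    if "x \<in> carrier PSL2Z" for x
    using that s by (simp add: PSL2Z.inv_mult_group sinv PSL2Z.m_assoc)
  show ?thesis
    using assms unfolding carrier_torus_group
  proof induction
    case one
    then show ?case using s half_turn_square by (simp add: generate.one)
  next
    case (incl f)
    have f: "f \<in> carrier PSL2Z" using incl torus_generators_subset by auto
    have "half_turn \<otimes>\<^bsub>PSL2Z\<^esub> f \<otimes>\<^bsub>PSL2Z\<^esub> half_turn = inv\<^bsub>PSL2Z\<^esub> (half_turn \<otimes>\<^bsub>PSL2Z\<^esub> inv\<^bsub>PSL2Z\<^esub> f
        \<otimes>\<^bsub>PSL2Z\<^esub> half_turn)"
      using conj[of "inv\<^bsub>PSL2Z\<^esub> f"] f by simp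
    then show ?case using generate.inv[OF half_turn_conj_generator[OF incl]] by simp
  next
    case (inv f)
    then show ?case by (intro generate.incl half_turn_conj_generator)
  next
    case (eng g h)
    have c: "g \<in> carrier PSL2Z" "h \<in> carrier PSL2Z"
      using eng torus_group_subset unfolding carrier_torus_group by auto
    have "half_turn \<otimes>\<^bsub>PSL2Z\<^esub> (g \<otimes>\<^bsub>PSL2Z\<^esub> h) \<otimes>\<^bsub>PSL2Z\<^esub> half_turn
      = half_turn \<otimes>\<^bsub>PSL2Z\<^esub> g \<otimes>\<^bsub>PSL2Z\<^esub> (half_turn \<otimes>\<^bsub>PSL2Z\<^esub> half_turn) \<otimes>\<^bsub>PSL2Z\<^esub> h \<otimes>\<^bsub>PSL2Z\<^esub> half_turn"
      using c s half_turn_square by (simp add: PSL2Z.m_assoc)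
    also have "\<dots> = (half_turn \<otimes>\<^bsub>PSL2Z\<^esub> g \<otimes>\<^bsub>PSL2Z\<^esub> half_turn) \<otimes>\<^bsub>PSL2Z\<^esub> (half_turn \<otimes>\<^bsub>PSL2Z\<^esub> h
        \<otimes>\<^bsub>PSL2Z\<^esub> half_turn)"
      using c s by (simp add: PSL2Z.m_assoc)
    finally show ?case using generate.eng[OF eng.IH] by simp
  qed
qed

text \<open>A generator is prescribed at two ideal vertices only. The third vertex of the image
  triangle is a common Farey neighbour of the two given images, which leaves finitely many
  positions.\<close>

lemma finite_torus_generators: "finite torus_generators"
proof (rule finite_disk_isometries[where p = 1 and q = \<i> and r = "-1"])
  let ?X = "lower_triangle \<union> geodesic_reflection (-1) (-\<i>) ` lower_triangle \<union> geodesic_reflection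
      (-\<i>) 1 ` lower_triangle"
  show "torus_generators \<subseteq> disk_isometries" using torus_generators_subset PSL2Z_isometry by blast
  show "finite ?X" by (simp add: lower_triangle_def)
  fix f assume f: "f \<in> torus_generators"
  have fP: "f \<in> carrier PSL2Z" using f torus_generators_subset by auto
  have "f ` upper_triangle \<in> farey_triangles" using PSL2Z_farey_triangle[OF fP
      upper_triangle_farey] .
  then have far: "{f 1, f \<i>, f (-1)} \<in> farey_triangles" by (simp add: upper_triangle_def)
  have inj: "f x \<noteq> f y" if "norm x \<le> 1" "norm y \<le> 1" "x \<noteq> y" for x y
    using disk_isometry_inj[OF PSL2Z_isometry[OF fP] that(1,2)] that(3) by blast
  have ne: "f 1 \<noteq> f \<i>" "f \<i> \<noteq> f (-1)" "f 1 \<noteq> f (-1)" by (rule inj; simp add: complex_eq_iff)+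
  have edges: "{f 1, f \<i>} \<in> farey_edges" "{f 1, f (-1)} \<in> farey_edges" "{f \<i>, f (-1)} \<in> farey_edges"
    using far ne unfolding farey_edges_def by blast+
  from f have "(f 1 = -\<i> \<and> f \<i> = -1) \<or> (f \<i> = 1 \<and> f (-1) = -\<i>)" by (simp add: torus_generators_def)
  then show "f 1 \<in> ?X \<and> f \<i> \<in> ?X \<and> f (-1) \<in> ?X"
  proof
    assume h: "f 1 = -\<i> \<and> f \<i> = -1"
    have "{-1, -\<i>, f (-1)} = lower_triangle \<or> {-1, -\<i>, f (-1)} = geodesic_reflection (-1) (-\<i>) `
        lower_triangle"
      using farey_common_neighbour[OF lower_triangle_farey, of "-1" "-\<i>" "f (-1)"] edges h ne
      by (auto simp: lower_triangle_def)
    then show ?thesis using h by (auto simp: lower_triangle_def)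
  next
    assume h: "f \<i> = 1 \<and> f (-1) = -\<i>"
    have "{-\<i>, 1, f 1} = lower_triangle \<or> {-\<i>, 1, f 1} = geodesic_reflection (-\<i>) 1 `
        lower_triangle"
      using farey_common_neighbour[OF lower_triangle_farey, of "-\<i>" 1 "f 1"] edges h ne
      by (auto simp: lower_triangle_def insert_commute)
    then show ?thesis using h by (auto simp: lower_triangle_def)
  qed
qed (auto simp: complex_eq_iff)

text \<open>The orbit statement writes \<open>f\<close> as an element of the torus group times an
  element that takes T_1 to T_1 or T_2. There are finitely many of the latter, and this remainder
  \<open>\<phi> f\<close> separates the right cosets.\<close>

lemma finite_rcosets_torus_group: "finite (rcosets\<^bsub>PSL2Z\<^esub> (carrier torus_group))"
proof -
  let ?H = "{h \<in> carrier PSL2Z. h ` lower_triangle = lower_triangle \<or> h ` lower_triangle =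
      upper_triangle}"
  have finH: "finite ?H"
  proof (rule finite_disk_isometries[where p = 1 and q = "-\<i>" and r = "-1"])
    show "?H \<subseteq> disk_isometries" using PSL2Z_isometry by blast
    show "finite (lower_triangle \<union> upper_triangle)" by (simp add: lower_triangle_def
        upper_triangle_def)
    show "f 1 \<in> lower_triangle \<union> upper_triangle \<and> f (-\<i>) \<in> lower_triangle \<union> upper_triangle \<and> f
        (-1) \<in> lower_triangle \<union> upper_triangle"
      if "f \<in> ?H" for f
    proof -
      have "f ` lower_triangle \<subseteq> lower_triangle \<union> upper_triangle" using that by auto
      then show ?thesis by (simp add: lower_triangle_def)
    qed
  qed (auto simp: complex_eq_iff)
  have ex: "\<exists>g. g \<in> carrier torus_group \<and> inv\<^bsub>PSL2Z\<^esub> g \<otimes>\<^bsub>PSL2Z\<^esub> f \<in> ?H" if f: "f \<in> carrier PSL2Z"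
      for f
  proof -
    obtain g where g: "g \<in> carrier torus_group" "f ` lower_triangle = g ` lower_triangle \<or> f `
        lower_triangle = g ` upper_triangle"
      using torus_group_orbit[OF PSL2Z_farey_triangle[OF f lower_triangle_farey]] by blast
    have gP: "g \<in> carrier PSL2Z" using g torus_group_subset by auto
    have "(inv\<^bsub>PSL2Z\<^esub> g \<otimes>\<^bsub>PSL2Z\<^esub> f) ` lower_triangle = (inv\<^bsub>PSL2Z\<^esub> g) ` f ` lower_triangle"
      using PSL2Z_mult_image[OF PSL2Z.inv_closed[OF gP] f farey_triangle_subset_cball[OF
          lower_triangle_farey]] .
    then have "(inv\<^bsub>PSL2Z\<^esub> g \<otimes>\<^bsub>PSL2Z\<^esub> f) ` lower_triangle \<in> {lower_triangle, upper_triangle}"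
      using g(2) PSL2Z_inv_image(1)[OF gP farey_triangle_subset_cball[OF lower_triangle_farey]]
        PSL2Z_inv_image(1)[OF gP farey_triangle_subset_cball[OF upper_triangle_farey]]
      by (elim disjE) (simp_all only: insert_iff simp_thms)
    then show ?thesis using g(1) gP f by (intro exI[of _ g]) simp
  qed
  define \<gamma> where "\<gamma> f = (SOME g. g \<in> carrier torus_group \<and> inv\<^bsub>PSL2Z\<^esub> g \<otimes>\<^bsub>PSL2Z\<^esub> f \<in> ?H)" for f
  have \<gamma>: "\<gamma> f \<in> carrier torus_group" "inv\<^bsub>PSL2Z\<^esub> (\<gamma> f) \<otimes>\<^bsub>PSL2Z\<^esub> f \<in> ?H" if "f \<in> carrier PSL2Z"
      for f
    using someI_ex[OF ex[OF that]] unfolding \<gamma>_def by auto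
  define \<phi> where "\<phi> f = inv\<^bsub>PSL2Z\<^esub> (\<gamma> f) \<otimes>\<^bsub>PSL2Z\<^esub> f" for f
  have "\<phi> ` carrier PSL2Z \<subseteq> ?H" unfolding \<phi>_def by (rule image_subsetI) (rule \<gamma>(2))
  then have fin: "finite (\<phi> ` carrier PSL2Z)" using finH finite_subset by blast
  have inj: "f \<otimes>\<^bsub>PSL2Z\<^esub> inv\<^bsub>PSL2Z\<^esub> g \<in> carrier torus_group"
    if f: "f \<in> carrier PSL2Z" and g: "g \<in> carrier PSL2Z" and e: "\<phi> f = \<phi> g" for f g
  proof -
    have P: "\<gamma> f \<in> carrier PSL2Z" "\<gamma> g \<in> carrier PSL2Z" using \<gamma>(1) f g torus_group_subset by blast+
    have \<phi>f: "\<phi> f \<in> carrier PSL2Z" using f P by (simp add: \<phi>_def)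
    have "f = \<gamma> f \<otimes>\<^bsub>PSL2Z\<^esub> \<phi> f" using f P by (simp add: \<phi>_def PSL2Z.m_assoc[symmetric])
    moreover have "g = \<gamma> g \<otimes>\<^bsub>PSL2Z\<^esub> \<phi> f" unfolding e using g P by (simp add: \<phi>_def
        PSL2Z.m_assoc[symmetric])
    ultimately have "f \<otimes>\<^bsub>PSL2Z\<^esub> inv\<^bsub>PSL2Z\<^esub> g = (\<gamma> f \<otimes>\<^bsub>PSL2Z\<^esub> \<phi> f) \<otimes>\<^bsub>PSL2Z\<^esub> inv\<^bsub>PSL2Z\<^esub> (\<gamma> g
        \<otimes>\<^bsub>PSL2Z\<^esub> \<phi> f)" by metis
    also have "\<dots> = \<gamma> f \<otimes>\<^bsub>PSL2Z\<^esub> inv\<^bsub>PSL2Z\<^esub> (\<gamma> g)"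
      by (rule PSL2Z.mult_inv_cancel_right[OF P \<phi>f])
    finally show ?thesis
      using \<gamma>(1)[OF f] \<gamma>(1)[OF g] subgroup.m_closed[OF subgroup_torus_group]
          subgroup.m_inv_closed[OF subgroup_torus_group] by metis
  qed
  show ?thesis using PSL2Z.rcosets_card_le[OF subgroup_torus_group fin inj] by blast
qed

section \<open>The subgroups G_n inside the torus group\<close>

lemma index_intersection_eq:
  "index_intersection n = carrier PSL2Z \<inter> \<Inter> (bounded_index_subgroups PSL2Z n)"
  by (auto simp: index_intersection_def bounded_index_subgroups_def)

lemma normal_index_intersection: "index_intersection n \<lhd> PSL2Z"
proof -
  have "subgroup (index_intersection n) PSL2Z"
  proof (rule PSL2Z.subgroupI)
    have "\<one>\<^bsub>PSL2Z\<^esub> \<in> index_intersection n"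
      by (auto simp: index_intersection_def subgroup.one_closed)
    then show "index_intersection n \<noteq> {}" by blast
    show "inv\<^bsub>PSL2Z\<^esub> f \<in> index_intersection n" if "f \<in> index_intersection n" for f
      using that by (auto simp: index_intersection_def subgroup.m_inv_closed)
    show "f \<otimes>\<^bsub>PSL2Z\<^esub> g \<in> index_intersection n" if "f \<in> index_intersection n" "g \<in>
        index_intersection n" for f g
      using that by (auto simp: index_intersection_def subgroup.m_closed)
  qed (auto simp: index_intersection_def)
  moreover have "x \<otimes>\<^bsub>PSL2Z\<^esub> h \<otimes>\<^bsub>PSL2Z\<^esub> inv\<^bsub>PSL2Z\<^esub> x \<in> index_intersection n"
    if x: "x \<in> carrier PSL2Z" and h: "h \<in> index_intersection n" for x h
    using PSL2Z.bounded_index_conjugate[OF _ x] h x unfolding index_intersection_eq by fastforce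
  ultimately show ?thesis unfolding PSL2Z.normal_inv_iff by blast
qed

lemma index_intersection_subset:
  assumes "subgroup H PSL2Z" "finite (rcosets\<^bsub>PSL2Z\<^esub> H)"
  shows "\<exists>n. \<forall>k\<ge>n. index_intersection k \<subseteq> H"
  using assms by (auto simp: index_intersection_def intro!: exI[of _ "card (rcosets\<^bsub>PSL2Z\<^esub> H)"])

text \<open>The torus group is finitely generated, so its finitely many subgroups of index at most
  \<open>n\<close> have an intersection of finite index. This intersection lies in G_n, because
  restricting a subgroup of the modular group to the torus group does not raise the index.\<close>

lemma index_intersection_finite_index_normal:
  assumes sub: "index_intersection n \<subseteq> carrier torus_group"
  shows "index_intersection n \<in> finite_index_normals torus_group"
proof -
  interpret G: group torus_group by (rule group_torus_group)
  have norm: "index_intersection n \<lhd> torus_group"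
    using PSL2Z.normal_restrict_supergroup[OF subgroup_torus_group normal_index_intersection sub]
        by (simp only: torus_group_eq_carrier[symmetric])
  have gen: "carrier torus_group = generate torus_group torus_generators"
  proof -
    have "torus_generators \<subseteq> generate PSL2Z torus_generators" by (auto intro: generate.incl)
    then have "generate (PSL2Z\<lparr>carrier := generate PSL2Z torus_generators\<rparr>) torus_generators =
        generate PSL2Z torus_generators"
      by (rule PSL2Z.generate_consistent[OF _ subgroup_torus_group[unfolded carrier_torus_group]])
    then show ?thesis by (simp add: torus_group_eq)
  qed
  have gsub: "torus_generators \<subseteq> carrier torus_group" unfolding carrier_torus_group by (auto
      intro: generate.incl)
  have fin: "finite (bounded_index_subgroups torus_group n)"
    by (rule G.finite_bounded_index_subgroups[OF finite_torus_generators gsub gen])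
  have "finite (rcosets\<^bsub>torus_group\<^esub> (index_intersection n))"
  proof (rule G.rcosets_Int_finite[OF fin])
    show "subgroup (index_intersection n) torus_group" by (rule normal_imp_subgroup[OF norm])
    show "subgroup H torus_group \<and> finite (rcosets\<^bsub>torus_group\<^esub> H)" if "H \<in>
        bounded_index_subgroups torus_group n" for H
      using that by (auto simp: bounded_index_subgroups_def)
    show "carrier torus_group \<inter> \<Inter> (bounded_index_subgroups torus_group n) \<subseteq> index_intersection n"
    proof
      fix g assume g: "g \<in> carrier torus_group \<inter> \<Inter> (bounded_index_subgroups torus_group n)"
      have "g \<in> H" if H: "subgroup H PSL2Z" "finite (rcosets\<^bsub>PSL2Z\<^esub> H)" "card (rcosets\<^bsub>PSL2Z\<^esub> H) \<le>
          n" for H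
      proof -
        have "H \<inter> carrier torus_group \<in> bounded_index_subgroups torus_group n"
          using PSL2Z.finite_rcosets_restrict[OF subgroup_torus_group H(1,2)] H(3)
          unfolding torus_group_eq_carrier[symmetric] bounded_index_subgroups_def by auto
        then show ?thesis using g by blast
      qed
      then show "g \<in> index_intersection n" using g torus_group_subset by (auto simp:
          index_intersection_def)
    qed
  qed
  then show ?thesis using norm by (simp add: finite_index_normals_def)
qed

text \<open>By transitivity \<open>M\<close> has finite index in the modular group as well, and G_k
  lies in it once \<open>k\<close> reaches that index.\<close>

lemma index_intersection_cofinal:
  assumes M: "M \<in> finite_index_normals torus_group"
  shows "\<exists>n. \<forall>k\<ge>n. index_intersection k \<subseteq> M"
proof -
  have "subgroup M torus_group" "finite (rcosets\<^bsub>torus_group\<^esub> M)"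
    using M by (auto simp: finite_index_normals_def normal_imp_subgroup)
  then have "subgroup M PSL2Z" "finite (rcosets\<^bsub>PSL2Z\<^esub> M)"
    using PSL2Z.finite_rcosets_trans[OF subgroup_torus_group finite_rcosets_torus_group, of M]
    unfolding torus_group_eq_carrier[symmetric] by blast+
  then show ?thesis by (rule index_intersection_subset)
qed

section \<open>Triangles in fundamental polygons\<close>

lemma ideal_hull_klein: "ideal_hull V = {z \<in> ball 0 1. klein z \<in> convex hull V}"
  by (simp add: ideal_hull_def klein_def)

text \<open>The interior is taken in the Klein disk, where an ideal triangle is a Euclidean one and
  its interior consists of the strictly positive barycentric combinations.\<close>

definition open_ideal_hull :: "complex set \<Rightarrow> complex set" where
  "open_ideal_hull V = {z \<in> ball 0 1. klein z \<in> interior (convex hull V)}"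

lemma open_ideal_hull_subset: "open_ideal_hull V \<subseteq> ideal_hull V" "open_ideal_hull V \<subseteq> ball 0 1"
  using interior_subset by (auto simp: open_ideal_hull_def ideal_hull_klein)

lemma continuous_klein: "continuous_on A klein"
proof -
  have "1 + (norm z)\<^sup>2 \<noteq> 0" for z :: complex by (metis add_pos_nonneg less_irrefl zero_le_power2
      zero_less_one)
  then show ?thesis unfolding klein_def by (intro continuous_intros) auto
qed

lemma open_open_ideal_hull: "open (open_ideal_hull V)"
proof -
  have "open (ball 0 1 \<inter> klein -` interior (convex hull V))"
    by (intro open_Int open_ball open_vimage open_interior continuous_klein)
  moreover have "ball 0 1 \<inter> klein -` interior (convex hull V) = open_ideal_hull V"
    by (auto simp: open_ideal_hull_def)
  ultimately show ?thesis by simp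
qed

text \<open>\<open>klein\<close> sends the radius r to 2r / (1 + r^2); the factor comes from the
  smaller root of this quadratic equation for r.\<close>

definition klein_inverse :: "complex \<Rightarrow> complex" where
  "klein_inverse w = (1 / (1 + sqrt (1 - (norm w)\<^sup>2))) *\<^sub>R w"

lemma continuous_klein_inverse: "continuous_on (ball 0 1) klein_inverse"
proof -
  have "1 + sqrt (1 - (norm w)\<^sup>2) \<noteq> 0" if "w \<in> ball 0 1" for w :: complex
  proof -
    have "0 \<le> sqrt (1 - (norm w)\<^sup>2)" using that by (simp add: abs_square_le_1)
    then show ?thesis by linarith
  qed
  then show ?thesis unfolding klein_inverse_def by (intro continuous_intros) auto
qed

lemma klein_klein_inverse:
  assumes "norm w < 1" shows "norm (klein_inverse w) < 1" "klein (klein_inverse w) = w"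
proof -
  define s where "s = sqrt (1 - (norm w)\<^sup>2)"
  have w: "(norm w)\<^sup>2 < 1" using assms by (simp add: abs_square_less_1)
  then have s: "s > 0" by (simp add: s_def)
  have s2: "(norm w)\<^sup>2 = (1 - s) * (1 + s)" using w by (simp add: s_def algebra_simps
      power2_eq_square)
  have n: "(norm (klein_inverse w))\<^sup>2 = (1 - s) / (1 + s)"
  proof -
    have "(norm (klein_inverse w))\<^sup>2 = (norm w)\<^sup>2 / (1 + s)\<^sup>2"
      by (simp add: klein_inverse_def s_def[symmetric] power_divide)
    then show ?thesis using s unfolding s2 by (simp add: power2_eq_square)
  qed
  have "(1 - s) / (1 + s) < 1" using s by simp
  then show "norm (klein_inverse w) < 1" unfolding n[symmetric] by (simp add: abs_square_less_1)
  have "2 / (1 + (norm (klein_inverse w))\<^sup>2) = 1 + s" unfolding n using s by (simp add: field_simps)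
  then show "klein (klein_inverse w) = w" unfolding klein_def using s by (simp add:
      klein_inverse_def s_def[symmetric])
qed

lemma klein_inverse_klein:
  assumes "norm z < 1" shows "klein_inverse (klein z) = z"
proof -
  define r where "r = (norm z)\<^sup>2"
  have r: "0 \<le> r" "r < 1" using assms by (simp_all add: r_def abs_square_less_1)
  have "(norm (klein z))\<^sup>2 = 4 * r / (1 + r)\<^sup>2"
    using r by (simp add: klein_def r_def[symmetric] power_mult_distrib power_divide)
  moreover have "1 - 4 * r / (1 + r)\<^sup>2 = ((1 - r) / (1 + r))\<^sup>2"
  proof -
    have "1 - 4 * r / (1 + r)\<^sup>2 = ((1 + r)\<^sup>2 - 4 * r) / (1 + r)\<^sup>2" using r by (simp add:
        diff_divide_distrib)
    also have "(1 + r)\<^sup>2 - 4 * r = (1 - r)\<^sup>2" by algebra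
    finally show ?thesis by (simp add: power_divide)
  qed
  ultimately have s: "sqrt (1 - (norm (klein z))\<^sup>2) = (1 - r) / (1 + r)" using r by simp
  have "1 / (1 + (1 - r) / (1 + r)) * (2 / (1 + r)) = 1" using r by (simp add: field_simps)
  then show ?thesis unfolding klein_inverse_def s by (simp add: klein_def r_def[symmetric])
qed

lemma interior_convex_hull_sphere:
  assumes "V \<subseteq> sphere 0 1" shows "interior (convex hull V) \<subseteq> (ball 0 1 :: complex set)"
proof -
  have "convex hull V \<subseteq> cball 0 1" using assms by (intro hull_minimal) auto
  then show ?thesis using interior_mono[of "convex hull V" "cball 0 1"] by simp
qed

text \<open>As a continuous image of a convex set the open hull will be connected.\<close>

lemma open_ideal_hull_eq:
  assumes "V \<subseteq> sphere 0 1" shows "open_ideal_hull V = klein_inverse ` interior (convex hull V)"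
proof
  show "open_ideal_hull V \<subseteq> klein_inverse ` interior (convex hull V)"
  proof
    fix z assume "z \<in> open_ideal_hull V"
    then have "z \<in> ball 0 1" "klein z \<in> interior (convex hull V)" by (auto simp:
        open_ideal_hull_def)
    then show "z \<in> klein_inverse ` interior (convex hull V)"
      using klein_inverse_klein[of z] by (metis image_eqI mem_ball_0)
  qed
  show "klein_inverse ` interior (convex hull V) \<subseteq> open_ideal_hull V"
  proof (rule image_subsetI)
    fix w assume w: "w \<in> interior (convex hull V)"
    then have "norm w < 1" using interior_convex_hull_sphere[OF assms] by auto
    then show "klein_inverse w \<in> open_ideal_hull V"
      using klein_klein_inverse[of w] w by (simp add: open_ideal_hull_def)
  qed
qed

lemma connected_open_ideal_hull:
  assumes "V \<subseteq> sphere 0 1" shows "connected (open_ideal_hull V)"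
  unfolding open_ideal_hull_eq[OF assms]
  by (intro connected_continuous_image convex_connected convex_interior convex_convex_hull
      continuous_on_subset[OF continuous_klein_inverse] interior_convex_hull_sphere assms)

lemma farey_triangle_subset_sphere: "T \<in> farey_triangles \<Longrightarrow> T \<subseteq> sphere 0 1"
  using farey_triangle_sphere by auto

lemma interior_convex_hull_sphere_triangle:
  fixes p q r :: complex
  assumes "norm p = 1" "norm q = 1" "norm r = 1" "p \<noteq> q" "q \<noteq> r" "p \<noteq> r"
  shows "w \<in> interior (convex hull {p, q, r}) \<longleftrightarrow>
    (\<exists>x y t. 0 < x \<and> 0 < y \<and> 0 < t \<and> x + y + t = 1 \<and> w = x *\<^sub>R p + y *\<^sub>R q + t *\<^sub>R r)"
  using interior_convex_hull_3_minimal[OF sphere_not_collinear[OF assms]] by auto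

lemma interior_convex_hull_farey_triangle:
  assumes "T \<in> farey_triangles" shows "interior (convex hull T) \<noteq> {}"
proof -
  obtain p q r where T: "T = {p, q, r}" "p \<noteq> q" "q \<noteq> r" "p \<noteq> r" "norm p = 1" "norm q = 1" "norm r
      = 1"
    by (rule farey_triangle_vertices[OF assms])
  have "(1/3) *\<^sub>R p + (1/3) *\<^sub>R q + (1/3) *\<^sub>R r \<in> interior (convex hull T)"
    unfolding T(1) interior_convex_hull_sphere_triangle[OF T(5-7) T(2-4)]
    by (intro exI[of _ "1/3"]) simp
  then show ?thesis by blast
qed

text \<open>A convex set with nonempty interior lies in the closure of that interior. The passage
  back to the Poincare disk uses continuity of \<open>klein_inverse\<close> on the open disk, which
  is why \<open>klein z\<close> is first shown to have norm below 1.\<close>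

lemma ideal_hull_subset_closure:
  assumes T: "T \<in> farey_triangles" shows "ideal_hull T \<subseteq> closure (open_ideal_hull T)"
proof
  note S = farey_triangle_subset_sphere[OF T]
  fix z assume "z \<in> ideal_hull T"
  then have z: "norm z < 1" "klein z \<in> convex hull T" by (auto simp: ideal_hull_klein)
  have "norm (klein z) < 1"
  proof -
    have "0 < (1 - norm z)\<^sup>2" using z by simp
    then have "2 * norm z < 1 + (norm z)\<^sup>2" by (simp add: power2_diff)
    moreover have "0 < 1 + (norm z)\<^sup>2" by (simp add: add_pos_nonneg)
    ultimately show ?thesis by (simp add: klein_def)
  qed
  moreover have "klein z \<in> closure (interior (convex hull T))"
    using convex_closure_interior[OF convex_convex_hull interior_convex_hull_farey_triangle[OF T]]
        z(2) closure_subset by auto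
  moreover have "klein_inverse ` (ball 0 1 \<inter> closure (interior (convex hull T))) \<subseteq> closure
      (klein_inverse ` interior (convex hull T))"
  proof (rule image_subsetI)
    fix w assume w: "w \<in> ball 0 1 \<inter> closure (interior (convex hull T))"
    then have "\<exists>x. (\<forall>n. x n \<in> interior (convex hull T)) \<and> x \<longlonglongrightarrow> w"
      using closure_sequential by blast
    then obtain x where x: "\<And>n. x n \<in> interior (convex hull T)" "x \<longlonglongrightarrow> w" by blast
    have "x n \<in> ball 0 1" for n using x(1) interior_convex_hull_sphere[OF S] by blast
    then have "(\<lambda>n. klein_inverse (x n)) \<longlonglongrightarrow> klein_inverse w"
      using w by (intro continuous_on_tendsto_compose[OF continuous_klein_inverse x(2)]) auto
    then show "klein_inverse w \<in> closure (klein_inverse ` interior (convex hull T))"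
      unfolding closure_sequential using x(1) by (intro exI[of _ "\<lambda>n. klein_inverse (x n)"]) auto
  qed
  ultimately have "klein_inverse (klein z) \<in> closure (klein_inverse ` interior (convex hull T))"
      by auto
  then show "z \<in> closure (open_ideal_hull T)"
    unfolding open_ideal_hull_eq[OF S] klein_inverse_klein[OF z(1)] .
qed

lemma open_ideal_hull_nonempty:
  assumes "T \<in> farey_triangles" shows "open_ideal_hull T \<noteq> {}"
  unfolding open_ideal_hull_eq[OF farey_triangle_subset_sphere[OF assms]]
  using interior_convex_hull_farey_triangle[OF assms] by simp

lemma open_ideal_hull_disjoint_edge:
  assumes T: "T \<in> farey_triangles" and e: "e \<in> farey_edges"
  shows "open_ideal_hull T \<inter> ideal_hull e = {}"
proof (rule ccontr)
  assume "open_ideal_hull T \<inter> ideal_hull e \<noteq> {}"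
  then obtain z where z: "klein z \<in> interior (convex hull T)" "klein z \<in> convex hull e"
    by (auto simp: open_ideal_hull_def ideal_hull_klein)
  obtain a b c d where det: "\<bar>a * d - b * c\<bar> = 1"
    and T': "T = {farey_point a b, farey_point c d, farey_point (a + c) (b + d)}"
    by (rule farey_triangle_cases[OF T])
  obtain g h k l where gl: "\<bar>g * l - h * k\<bar> = 1" "e = {farey_point g h, farey_point k l}"
    by (rule farey_edge_cases[OF e])
  note nz = unimodular_nz[OF det]
  have ne: "farey_point a b \<noteq> farey_point c d" "farey_point c d \<noteq> farey_point (a + c) (b + d)"
      "farey_point a b \<noteq> farey_point (a + c) (b + d)"
    using farey_point_eq_iff[OF nz(1,2)] farey_point_eq_iff[OF nz(2,3)] farey_point_eq_iff[OF
        nz(1,3)] det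
    by (auto simp: algebra_simps)
  obtain x y t where "0 < x" "0 < y" "0 < t" "x + y + t = 1"
    "klein z = x *\<^sub>R farey_point a b + y *\<^sub>R farey_point c d + t *\<^sub>R farey_point (a + c) (b + d)"
    using z(1) unfolding T' interior_convex_hull_sphere_triangle[OF farey_point_norm[OF nz(1)]
        farey_point_norm[OF nz(2)] farey_point_norm[OF nz(3)] ne]
    by blast
  then show False using farey_noncrossing[OF det gl(1)] z(2) gl(2) by blast
qed

lemma isometry_open_ideal_hull:
  assumes f: "f \<in> disk_isometries" and T: "T \<in> farey_triangles" and z: "z \<in> open_ideal_hull T"
  shows "f z \<in> open_ideal_hull (f ` T)"
proof -
  obtain p q r where pqr: "T = {p, q, r}" "p \<noteq> q" "q \<noteq> r" "p \<noteq> r" "norm p = 1" "norm q = 1" "norm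
      r = 1"
    by (rule farey_triangle_vertices[OF T])
  have z1: "norm z < 1" using z by (simp add: open_ideal_hull_def)
  obtain x y t where "0 < x" "0 < y" "0 < t" "x + y + t = 1" "klein z = x *\<^sub>R p + y *\<^sub>R q + t *\<^sub>R r"
    using z unfolding open_ideal_hull_def pqr(1) mem_Collect_eq
        interior_convex_hull_sphere_triangle[OF pqr(5-7) pqr(2-4)] by blast
  from disk_isometry_positive_combination[OF f pqr(5-7) less_imp_le[OF z1] this]
  have c: "\<exists>x y t. 0 < x \<and> 0 < y \<and> 0 < t \<and> x + y + t = 1 \<and> klein (f z) = x *\<^sub>R f p + y *\<^sub>R f q + t
      *\<^sub>R f r" .
  have n: "norm (f p) = 1" "norm (f q) = 1" "norm (f r) = 1" using disk_isometry_norm(1)[OF f] pqr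
      by blast+
  have "f p \<noteq> f q" "f q \<noteq> f r" "f p \<noteq> f r"
    using disk_isometry_inj[OF f, of p q] disk_isometry_inj[OF f, of q r] disk_isometry_inj[OF f,
        of p r] pqr by auto
  then have "klein (f z) \<in> interior (convex hull (f ` T))"
    unfolding pqr(1) image_insert image_empty by (subst interior_convex_hull_sphere_triangle) (use
        n c in auto)
  then show ?thesis using disk_isometry_norm(2)[OF f z1] by (simp add: open_ideal_hull_def)
qed

text \<open>The open hull is connected and misses the frontier edges, so one common point puts it
  inside \<open>P\<close>. The closed hull follows since \<open>P\<close> is the relative closure of
  its interior.\<close>

lemma farey_polygon_triangle:
  assumes P: "farey_polygon P" and T: "T \<in> farey_triangles" and meet: "open_ideal_hull T \<inter> P \<noteq> {}"
  shows "ideal_hull T \<subseteq> P"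
proof -
  have PB: "P = ball 0 1 \<inter> closure (interior P)" using P by (simp add: farey_polygon_def)
  obtain E where E: "E \<subseteq> farey_edges" "ball 0 1 \<inter> frontier P = (\<Union>e\<in>E. ideal_hull e)"
    using P by (auto simp: farey_polygon_def)
  have "open_ideal_hull T \<inter> frontier P = {}"
  proof -
    have "open_ideal_hull T \<inter> frontier P \<subseteq> open_ideal_hull T \<inter> (\<Union>e\<in>E. ideal_hull e)"
      using open_ideal_hull_subset(2)[of T] E(2) by blast
    then show ?thesis using open_ideal_hull_disjoint_edge[OF T] E(1) by blast
  qed
  then have "open_ideal_hull T \<subseteq> P"
    using connected_Int_frontier[OF connected_open_ideal_hull[OF farey_triangle_subset_sphere[OF
        T]] meet] by blast
  then have "open_ideal_hull T \<subseteq> interior P" by (rule interior_maximal[OF _ open_open_ideal_hull])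
  then have "closure (open_ideal_hull T) \<subseteq> closure (interior P)" by (rule closure_mono)
  then have "ideal_hull T \<subseteq> closure (interior P)" using ideal_hull_subset_closure[OF T] by blast
  moreover have "ideal_hull T \<subseteq> ball 0 1" by (auto simp: ideal_hull_def)
  ultimately show ?thesis using PB by blast
qed

text \<open>Some translate of \<open>P\<close> by \<open>g\<close> covers a point of the open hull
  of \<open>T\<close>. The inverse of \<open>g\<close> takes this point into \<open>P\<close>, and
  with it the whole image triangle.\<close>

lemma fundamental_polygon_translate:
  assumes P: "fundamental_polygon \<Gamma> P" and \<Gamma>: "\<Gamma> \<subseteq> carrier PSL2Z"
    "\<And>g. g \<in> \<Gamma> \<Longrightarrow> inv\<^bsub>PSL2Z\<^esub> g \<in> \<Gamma>" and T: "T \<in> farey_triangles"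
  shows "\<exists>g\<in>\<Gamma>. g ` T \<in> triangles_in P"
proof -
  have FP: "farey_polygon P" and cover: "(\<Union>g\<in>\<Gamma>. g ` P) = ball 0 1"
    using P by (auto simp: fundamental_polygon_def)
  obtain z where z: "z \<in> open_ideal_hull T" using open_ideal_hull_nonempty[OF T] by blast
  then have "z \<in> (\<Union>g\<in>\<Gamma>. g ` P)" unfolding cover using open_ideal_hull_subset(2) by blast
  then obtain g y where g: "g \<in> \<Gamma>" "y \<in> P" "z = g y" by blast
  have gP: "g \<in> carrier PSL2Z" using g \<Gamma>(1) by blast
  let ?h = "inv\<^bsub>PSL2Z\<^esub> g"
  have hP: "?h \<in> carrier PSL2Z" using gP by simp
  have "norm y < 1" using g(2) FP by (auto simp: farey_polygon_def)
  then have "?h z = y" using PSL2Z_inv_apply(1)[OF gP, of y] g(3) by simp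
  then have "y \<in> open_ideal_hull (?h ` T)" using isometry_open_ideal_hull[OF PSL2Z_isometry[OF hP]
      T z] by simp
  then have "ideal_hull (?h ` T) \<subseteq> P"
    using farey_polygon_triangle[OF FP PSL2Z_farey_triangle[OF hP T]] g(2) by blast
  then have "?h ` T \<in> triangles_in P" using PSL2Z_farey_triangle[OF hP T] by (simp add:
      triangles_in_def)
  then show ?thesis using \<Gamma>(2)[OF g(1)] by blast
qed

text \<open>Open hulls of triangles in \<open>P\<close> lie in the interior of \<open>P\<close>, so
  \<open>g\<close> would carry an interior point of \<open>P\<close> to an interior point, against
  disjointness.\<close>

lemma fundamental_polygon_free:
  assumes P: "fundamental_polygon \<Gamma> P" and g: "g \<in> \<Gamma>" "\<Gamma> \<subseteq> carrier PSL2Z"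
    and T: "T \<in> triangles_in P" "g ` T \<in> triangles_in P"
  shows "g = \<one>\<^bsub>PSL2Z\<^esub>"
proof (rule ccontr)
  assume "g \<noteq> \<one>\<^bsub>PSL2Z\<^esub>"
  then have disj: "g ` interior P \<inter> interior P = {}" using P g(1) by (auto simp:
      fundamental_polygon_def)
  have iso: "g \<in> disk_isometries" using g PSL2Z_isometry by blast
  have int: "open_ideal_hull S \<subseteq> interior P" if "S \<in> triangles_in P" for S
    using that open_ideal_hull_subset(1)[of S] by (intro interior_maximal open_open_ideal_hull)
        (auto simp: triangles_in_def)
  have TF: "T \<in> farey_triangles" using T by (simp add: triangles_in_def)
  obtain z where z: "z \<in> open_ideal_hull T" using open_ideal_hull_nonempty[OF TF] by blast
  have "g z \<in> open_ideal_hull (g ` T)" by (rule isometry_open_ideal_hull[OF iso TF z])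
  then show False using int[OF T(1)] int[OF T(2)] z disj by blast
qed

section \<open>The Weil-Petersson form as a limit\<close>

lemma topspace_sup_topology: "topspace (sup_topology S) = extensional S"
proof -
  have "openin (sup_topology S) (extensional S)" unfolding openin_sup_topology by (auto intro:
      exI[of _ 1])
  moreover have "U \<subseteq> extensional S" if "openin (sup_topology S) U" for U
    using that by (simp add: openin_sup_topology)
  ultimately show ?thesis by (auto simp: topspace_def)
qed

lemma continuous_map_sup_topology_eval:
  assumes "e \<in> S" shows "continuous_map (sup_topology S) euclideanreal (\<lambda>f. f e)"
  unfolding continuous_map_def
proof (intro conjI allI impI)
  fix U :: "real set" assume "openin euclideanreal U"
  then have U: "open U" by simp
  show "openin (sup_topology S) {f \<in> topspace (sup_topology S). f e \<in> U}"
    unfolding openin_sup_topology topspace_sup_topology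
  proof (intro conjI ballI)
    fix f assume "f \<in> {f \<in> extensional S. f e \<in> U}"
    then obtain d where d: "d > 0" "\<And>y. dist y (f e) < d \<Longrightarrow> y \<in> U"
      using U by (auto simp: open_dist)
    show "\<exists>\<epsilon>>0. \<forall>g\<in>extensional S. (\<forall>e\<in>S. \<bar>g e - f e\<bar> < \<epsilon>) \<longrightarrow> g \<in> {f \<in> extensional S. f e \<in> U}"
      using d assms by (intro exI[of _ d]) (auto simp: dist_real_def)
  qed auto
qed simp

lemma ContG_continuous_eval:
  assumes "v \<in> ContG" "e \<in> farey_edges"
  shows "continuous_map Ghat_topology euclideanreal (\<lambda>t. v t e)"
proof -
  have "continuous_map Ghat_topology (sup_topology farey_edges) v" using assms(1) unfolding
      ContG_def by blast
  from continuous_map_compose[OF this continuous_map_sup_topology_eval[OF assms(2)]]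
  show ?thesis unfolding o_def .
qed

text \<open>This is equivariance at \<open>?t\<close>, the image of \<open>g\<close>, where the
  translated argument becomes the identity.\<close>

lemma ContG_embedding:
  assumes v: "v \<in> ContG" and g: "g \<in> carrier torus_group" and e: "e \<in> farey_edges"
  shows "v \<one>\<^bsub>Ghat\<^esub> (g ` e) = v (profinite_embedding torus_group g) e"
proof -
  let ?t = "profinite_embedding torus_group g"
  have "?t \<in> carrier Ghat" by (rule profinite_embedding_closed[OF group_torus_group g])
  then have "v (?t \<otimes>\<^bsub>Ghat\<^esub> inv\<^bsub>Ghat\<^esub> ?t) (g ` e) = v ?t e"
    using v g e unfolding ContG_def by blast
  then show ?thesis unfolding profinite_embedding_r_inv[OF group_torus_group g] .
qed

lemma farey_edgeI:
  assumes "T \<in> farey_triangles" "x \<in> T" "y \<in> T" "x \<noteq> y" shows "{x, y} \<in> farey_edges"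
  using assms unfolding farey_edges_def by blast

lemma farey_triangle_edges:
  assumes "{p, q, r} \<in> farey_triangles" "p \<noteq> q" "q \<noteq> r" "p \<noteq> r"
  shows "{p, q} \<in> farey_edges" "{q, r} \<in> farey_edges" "{r, p} \<in> farey_edges"
  using assms by (auto intro!: farey_edgeI[OF assms(1)])

lemma counterclockwise_distinct: "counterclockwise p q r \<Longrightarrow> p \<noteq> q \<and> q \<noteq> r \<and> p \<noteq> r"
  by (auto simp: counterclockwise_def algebra_simps)

lemma base_triangle_counterclockwise:
  assumes "T = lower_triangle \<or> T = upper_triangle"
  obtains p q r where "T = {p, q, r}" "counterclockwise p q r" "norm p = 1" "norm q = 1" "norm r =
      1"
proof -
  have "counterclockwise (-1) (-\<i>) 1" "counterclockwise 1 \<i> (-1)" by (simp_all add: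
      counterclockwise_def)
  then show thesis using assms that[of "-1" "-\<i>" 1] that[of 1 \<i> "-1"] by (auto simp:
      lower_triangle_def upper_triangle_def)
qed

context
  fixes lam u v :: "ghat \<Rightarrow> edge \<Rightarrow> real"
  assumes lam: "lam \<in> ContG_pos" and u: "u \<in> ContG" and v: "v \<in> ContG"
begin

text \<open>On the two base triangles these are the functions \<open>\<eta>\<close> on the
  completion; at the identity they give the summands of the polygon average.\<close>

definition form_at :: "triangle \<Rightarrow> ghat \<Rightarrow> real" where
  "form_at T t = triangle_form (lam t) (u t) (v t) T"

lemma continuous_form_at:
  assumes T: "T = lower_triangle \<or> T = upper_triangle"
  shows "continuous_map Ghat_topology euclideanreal (form_at T)"
proof -
  obtain p q r where pqr: "T = {p, q, r}" "counterclockwise p q r" "norm p = 1" "norm q = 1" "norm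
      r = 1"
    by (rule base_triangle_counterclockwise[OF T])
  have "T \<in> farey_triangles" using T lower_triangle_farey upper_triangle_farey by auto
  then have edges: "{p, q} \<in> farey_edges" "{q, r} \<in> farey_edges" "{r, p} \<in> farey_edges"
    using farey_triangle_edges[of p q r] counterclockwise_distinct[OF pqr(2)] pqr(1) by auto
  have lam': "lam \<in> ContG" using lam by (simp add: ContG_pos_def)
  have d: "continuous_map Ghat_topology euclideanreal (\<lambda>t. dlog (lam t) e (w t))"
    if w: "w \<in> ContG" and e: "e \<in> farey_edges" for w e
    unfolding dlog_def
  proof (rule continuous_map_real_divide[OF ContG_continuous_eval[OF w e] ContG_continuous_eval[OF
      lam' e]])
    show "lam t e \<noteq> 0" if "t \<in> topspace Ghat_topology" for t
      using lam that e unfolding topspace_profinite[OF group_torus_group] ContG_pos_def by force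
  qed
  have "continuous_map Ghat_topology euclideanreal (\<lambda>t. local_form (lam t) (u t) (v t) {p, q} {q,
      r} {r, p})"
    unfolding local_form_def dlog_wedge_def
    by (intro continuous_map_real_mult continuous_map_add continuous_map_diff
        continuous_map_const[THEN iffD2] d u v edges) simp
  then show ?thesis unfolding form_at_def pqr(1) triangle_form_eq[OF pqr(2)] .
qed

text \<open>The element \<open>g\<close> preserves orientation and hence carries the
  counterclockwise reading of \<open>T\<close> to that of its image; equivariance then applies edge
  by edge.\<close>

lemma form_at_embedding:
  assumes T: "T = lower_triangle \<or> T = upper_triangle" and g: "g \<in> carrier torus_group"
  shows "form_at (g ` T) \<one>\<^bsub>Ghat\<^esub> = form_at T (profinite_embedding torus_group g)"
proof -
  obtain p q r where pqr: "T = {p, q, r}" "counterclockwise p q r" "norm p = 1" "norm q = 1" "norm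
      r = 1"
    by (rule base_triangle_counterclockwise[OF T])
  have "T \<in> farey_triangles" using T lower_triangle_farey upper_triangle_farey by auto
  then have edges: "{p, q} \<in> farey_edges" "{q, r} \<in> farey_edges" "{r, p} \<in> farey_edges"
    using farey_triangle_edges[of p q r] counterclockwise_distinct[OF pqr(2)] pqr(1) by auto
  have lam': "lam \<in> ContG" using lam by (simp add: ContG_pos_def)
  have iso: "g \<in> disk_isometries" using g torus_group_subset PSL2Z_isometry by blast
  have ccw: "counterclockwise (g p) (g q) (g r)"
    using disk_isometry_counterclockwise[OF iso pqr(3-5)] pqr(2) by simp
  have e: "w \<one>\<^bsub>Ghat\<^esub> {g x, g y} = w (profinite_embedding torus_group g) {x, y}"
    if "w \<in> ContG" "{x, y} \<in> farey_edges" for w x y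
    using ContG_embedding[OF that(1) g that(2)] by simp
  have "form_at (g ` T) \<one>\<^bsub>Ghat\<^esub> = local_form (lam \<one>\<^bsub>Ghat\<^esub>) (u \<one>\<^bsub>Ghat\<^esub>) (v \<one>\<^bsub>Ghat\<^esub>) {g p, g q} {g
      q, g r} {g r, g p}"
    unfolding form_at_def pqr(1) image_insert image_empty by (rule triangle_form_eq[OF ccw])
  also have "\<dots> = form_at T (profinite_embedding torus_group g)"
    unfolding form_at_def pqr(1) triangle_form_eq[OF pqr(2)]
    by (simp only: local_form_def dlog_wedge_def dlog_def e[OF lam' edges(1)] e[OF lam' edges(2)]
        e[OF lam' edges(3)]
        e[OF u edges(1)] e[OF u edges(2)] e[OF u edges(3)] e[OF v edges(1)] e[OF v edges(2)] e[OF
            v edges(3)])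
  finally show ?thesis .
qed

end

section \<open>Counting the representations of a Farey triangle\<close>

definition orbit_maps :: "triangle \<Rightarrow> triangle \<Rightarrow> (complex \<Rightarrow> complex) set" where
  "orbit_maps S T = {g \<in> carrier torus_group. g ` S = T}"

lemma card_orbit_maps_translate:
  assumes h: "h \<in> carrier torus_group" and S: "S \<in> farey_triangles" and T: "T \<in> farey_triangles"
  shows "card (orbit_maps S (h ` T)) = card (orbit_maps S T)"
proof -
  note sub = torus_group_subset
  have hP: "h \<in> carrier PSL2Z" using h sub by blast
  have "bij_betw (\<lambda>g. h \<otimes>\<^bsub>PSL2Z\<^esub> g) (orbit_maps S T) (orbit_maps S (h ` T))"
  proof (rule bij_betw_byWitness[where f' = "\<lambda>g. inv\<^bsub>PSL2Z\<^esub> h \<otimes>\<^bsub>PSL2Z\<^esub> g"])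
    show "\<forall>g\<in>orbit_maps S T. inv\<^bsub>PSL2Z\<^esub> h \<otimes>\<^bsub>PSL2Z\<^esub> (h \<otimes>\<^bsub>PSL2Z\<^esub> g) = g"
      using hP sub by (auto simp: orbit_maps_def PSL2Z.m_assoc[symmetric] subset_iff)
    show "\<forall>g\<in>orbit_maps S (h ` T). h \<otimes>\<^bsub>PSL2Z\<^esub> (inv\<^bsub>PSL2Z\<^esub> h \<otimes>\<^bsub>PSL2Z\<^esub> g) = g"
      using hP sub by (auto simp: orbit_maps_def PSL2Z.m_assoc[symmetric] subset_iff)
    show "(\<lambda>g. h \<otimes>\<^bsub>PSL2Z\<^esub> g) ` orbit_maps S T \<subseteq> orbit_maps S (h ` T)"
    proof (rule image_subsetI)
      fix g assume "g \<in> orbit_maps S T"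
      then have g: "g \<in> carrier torus_group" "g ` S = T" by (auto simp: orbit_maps_def)
      have gP: "g \<in> carrier PSL2Z" using g sub by blast
      show "h \<otimes>\<^bsub>PSL2Z\<^esub> g \<in> orbit_maps S (h ` T)"
        using subgroup.m_closed[OF subgroup_torus_group h g(1)] PSL2Z_mult_image[OF hP gP
            farey_triangle_subset_cball[OF S]] g(2)
        by (simp add: orbit_maps_def)
    qed
    show "(\<lambda>g. inv\<^bsub>PSL2Z\<^esub> h \<otimes>\<^bsub>PSL2Z\<^esub> g) ` orbit_maps S (h ` T) \<subseteq> orbit_maps S T"
    proof (rule image_subsetI)
      fix g assume "g \<in> orbit_maps S (h ` T)"
      then have g: "g \<in> carrier torus_group" "g ` S = h ` T" by (auto simp: orbit_maps_def)
      have gP: "g \<in> carrier PSL2Z" using g sub by blast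
      have "(inv\<^bsub>PSL2Z\<^esub> h \<otimes>\<^bsub>PSL2Z\<^esub> g) ` S = T"
        unfolding PSL2Z_mult_image[OF PSL2Z.inv_closed[OF hP] gP farey_triangle_subset_cball[OF
            S]] g(2)
        by (rule PSL2Z_inv_image(1)[OF hP farey_triangle_subset_cball[OF T]])
      then show "inv\<^bsub>PSL2Z\<^esub> h \<otimes>\<^bsub>PSL2Z\<^esub> g \<in> orbit_maps S T"
        using subgroup.m_closed[OF subgroup_torus_group subgroup.m_inv_closed[OF
            subgroup_torus_group h] g(1)]
        by (simp add: orbit_maps_def)
    qed
  qed
  then show ?thesis by (metis bij_betw_same_card)
qed

text \<open>Conjugation by the half turn is an involution of the torus group that moves source and
  target triangle simultaneously.\<close>

lemma card_orbit_maps_half_turn: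
  assumes S: "S \<in> farey_triangles" and T: "T \<in> farey_triangles"
  shows "card (orbit_maps (half_turn ` S) (half_turn ` T)) = card (orbit_maps S T)"
proof -
  define c where "c g = half_turn \<otimes>\<^bsub>PSL2Z\<^esub> g \<otimes>\<^bsub>PSL2Z\<^esub> half_turn" for g
  note sub = torus_group_subset
  note s = half_turn_PSL2Z
  have cc: "c (c g) = g" if g: "g \<in> carrier torus_group" for g
  proof -
    have gP: "g \<in> carrier PSL2Z" using g sub by blast
    have "c (c g) = (half_turn \<otimes>\<^bsub>PSL2Z\<^esub> half_turn) \<otimes>\<^bsub>PSL2Z\<^esub> g \<otimes>\<^bsub>PSL2Z\<^esub> (half_turn \<otimes>\<^bsub>PSL2Z\<^esub>
        half_turn)"
      using gP s by (simp add: c_def PSL2Z.m_assoc)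
    then show ?thesis using gP by (simp add: half_turn_square)
  qed
  have c: "c g \<in> orbit_maps (half_turn ` A) (half_turn ` B)"
    if g: "g \<in> orbit_maps A B" and A: "A \<in> farey_triangles" for g A B
  proof -
    have g': "g \<in> carrier torus_group" "g ` A = B" using g by (auto simp: orbit_maps_def)
    have gP: "g \<in> carrier PSL2Z" using g' sub by blast
    note A' = farey_triangle_subset_cball[OF A]
    note hA = farey_triangle_subset_cball[OF PSL2Z_farey_triangle[OF s A]]
    have hh: "half_turn ` half_turn ` A = A"
      using PSL2Z_mult_image[OF s s A'] PSL2Z_one_image[OF A'] unfolding half_turn_square by (rule
          subst)
    have "c g ` half_turn ` A = half_turn ` g ` half_turn ` half_turn ` A"
      unfolding c_def PSL2Z_mult_image[OF PSL2Z.m_closed[OF s gP] s hA] hh PSL2Z_mult_image[OF s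
          gP A'] by simp
    then show ?thesis
      using half_turn_conj_torus_group[OF g'(1)] unfolding hh g'(2) by (simp add: orbit_maps_def
          c_def)
  qed
  have hh: "half_turn ` half_turn ` A = A" if "A \<in> farey_triangles" for A
    using PSL2Z_mult_image[OF s s farey_triangle_subset_cball[OF that]]
      PSL2Z_one_image[OF farey_triangle_subset_cball[OF that]] unfolding half_turn_square by (rule
          subst)
  have "bij_betw c (orbit_maps S T) (orbit_maps (half_turn ` S) (half_turn ` T))"
  proof (rule bij_betw_byWitness[where f' = c])
    show "\<forall>g\<in>orbit_maps S T. c (c g) = g" "\<forall>g\<in>orbit_maps (half_turn ` S) (half_turn ` T). c (c g)
        = g"
      using cc by (auto simp: orbit_maps_def)
    show "c ` orbit_maps S T \<subseteq> orbit_maps (half_turn ` S) (half_turn ` T)" using c[OF _ S] by blast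
    show "c ` orbit_maps (half_turn ` S) (half_turn ` T) \<subseteq> orbit_maps S T"
      using c[OF _ PSL2Z_farey_triangle[OF s S], of _ "half_turn ` T"] unfolding hh[OF S] hh[OF T]
          by blast
  qed
  then show ?thesis by (metis bij_betw_same_card)
qed

text \<open>Translation reduces \<open>T\<close> to one of the base triangles. The half turn matches
  the two diagonal counts and the two mixed counts, so both base triangles have the same
  total.\<close>

lemma card_orbit_maps_sum:
  assumes "T \<in> farey_triangles"
  shows "card (orbit_maps lower_triangle T) + card (orbit_maps upper_triangle T)
    = card (orbit_maps lower_triangle lower_triangle) + card (orbit_maps upper_triangle
        lower_triangle)"
proof -
  note L = lower_triangle_farey and U = upper_triangle_farey
  obtain h where h: "h \<in> carrier torus_group" "T = h ` lower_triangle \<or> T = h ` upper_triangle"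
    using torus_group_orbit[OF assms] by blast
  have "card (orbit_maps lower_triangle upper_triangle) = card (orbit_maps upper_triangle
      lower_triangle)"
    "card (orbit_maps upper_triangle upper_triangle) = card (orbit_maps lower_triangle
        lower_triangle)"
    using card_orbit_maps_half_turn[OF U L] card_orbit_maps_half_turn[OF L L] by (simp_all only:
        half_turn_triangles)
  then show ?thesis
    using h(2) card_orbit_maps_translate[OF h(1) L L] card_orbit_maps_translate[OF h(1) U L]
      card_orbit_maps_translate[OF h(1) L U] card_orbit_maps_translate[OF h(1) U U] by auto
qed

definition polygon_maps :: "complex set \<Rightarrow> triangle \<Rightarrow> (complex \<Rightarrow> complex) set" where
  "polygon_maps P T = {g \<in> carrier torus_group. g ` T \<in> triangles_in P}"

lemma polygon_maps_transversal:
  assumes P: "fundamental_polygon K P" and K: "K \<in> finite_index_normals torus_group" and T: "T \<in>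
      farey_triangles"
  shows "bij_betw (\<lambda>g. K #>\<^bsub>torus_group\<^esub> g) (polygon_maps P T) (rcosets\<^bsub>torus_group\<^esub> K)"
proof -
  interpret G: group torus_group by (rule group_torus_group)
  have sK: "subgroup K torus_group" using K by (simp add: finite_index_normals_def
      normal_imp_subgroup)
  have KG: "K \<subseteq> carrier torus_group" by (rule subgroup.subset[OF sK])
  have sKP: "subgroup K PSL2Z"
    using PSL2Z.incl_subgroup[OF subgroup_torus_group] sK torus_group_eq_carrier by metis
  have KP: "K \<subseteq> carrier PSL2Z" using KG torus_group_subset by blast
  have Kinv: "inv\<^bsub>PSL2Z\<^esub> k \<in> K" if "k \<in> K" for k using subgroup.m_inv_closed[OF sKP that] .
  show ?thesis
    unfolding bij_betw_def
  proof (intro conjI inj_onI)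
    fix g h assume gh: "g \<in> polygon_maps P T" "h \<in> polygon_maps P T" and e: "K #>\<^bsub>torus_group\<^esub> g =
        K #>\<^bsub>torus_group\<^esub> h"
    have c: "g \<in> carrier PSL2Z" "h \<in> carrier PSL2Z" using gh torus_group_subset by (auto simp:
        polygon_maps_def)
    define k where "k = g \<otimes>\<^bsub>PSL2Z\<^esub> inv\<^bsub>PSL2Z\<^esub> h"
    have k: "k \<in> K" using e PSL2Z.r_coset_eq_iff[OF sKP c] by (simp add: k_def)
    then have kP: "k \<in> carrier PSL2Z" using KP by blast
    have g: "g = k \<otimes>\<^bsub>PSL2Z\<^esub> h" using c by (simp add: k_def PSL2Z.m_assoc)
    have "k ` h ` T \<in> triangles_in P"
      using gh(1) PSL2Z_mult_image[OF kP c(2) farey_triangle_subset_cball[OF T]] unfolding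
          g[symmetric] by (simp add: polygon_maps_def)
    then have "k = \<one>\<^bsub>PSL2Z\<^esub>"
      using fundamental_polygon_free[OF P k KP, of "h ` T"] gh(2) by (simp add: polygon_maps_def)
    then show "g = h" using g c by simp
  next
    show "(\<lambda>g. K #>\<^bsub>torus_group\<^esub> g) ` polygon_maps P T = rcosets\<^bsub>torus_group\<^esub> K"
    proof
      show "(\<lambda>g. K #>\<^bsub>torus_group\<^esub> g) ` polygon_maps P T \<subseteq> rcosets\<^bsub>torus_group\<^esub> K"
        by (auto simp: rcosets_image polygon_maps_def)
      show "rcosets\<^bsub>torus_group\<^esub> K \<subseteq> (\<lambda>g. K #>\<^bsub>torus_group\<^esub> g) ` polygon_maps P T"
      proof
        fix C assume "C \<in> rcosets\<^bsub>torus_group\<^esub> K"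
        then obtain g where g: "g \<in> carrier torus_group" "C = K #>\<^bsub>torus_group\<^esub> g" unfolding
            rcosets_image by blast
        have gP: "g \<in> carrier PSL2Z" using g torus_group_subset by blast
        obtain k where k: "k \<in> K" "k ` g ` T \<in> triangles_in P"
          using fundamental_polygon_translate[OF P KP Kinv PSL2Z_farey_triangle[OF gP T]] by blast
        have kP: "k \<in> carrier PSL2Z" using k KP by blast
        have "k \<otimes>\<^bsub>PSL2Z\<^esub> g \<in> polygon_maps P T"
          using k(2) PSL2Z_mult_image[OF kP gP farey_triangle_subset_cball[OF T]]
              subgroup.m_closed[OF subgroup_torus_group _ g(1), of k] k(1) KG
          by (auto simp: polygon_maps_def)
        moreover have "K #>\<^bsub>torus_group\<^esub> (k \<otimes>\<^bsub>PSL2Z\<^esub> g) = C"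
        proof -
          have "k \<otimes>\<^bsub>PSL2Z\<^esub> g \<otimes>\<^bsub>PSL2Z\<^esub> inv\<^bsub>PSL2Z\<^esub> g = k" using kP gP by (simp add: PSL2Z.m_assoc)
          then show ?thesis using PSL2Z.r_coset_eq_iff[OF sKP PSL2Z.m_closed[OF kP gP] gP] k(1) by
              (simp add: g(2))
        qed
        ultimately show "C \<in> (\<lambda>g. K #>\<^bsub>torus_group\<^esub> g) ` polygon_maps P T" by blast
      qed
    qed
  qed
qed

text \<open>Group elements are collected according to the triangle they produce, and the total
  multiplicity is the same for every triangle. With a constant \<open>f\<close> this also counts the
  triangles.\<close>

lemma sum_over_polygon_maps:
  fixes f :: "triangle \<Rightarrow> real"
  assumes "finite (polygon_maps P lower_triangle)" "finite (polygon_maps P upper_triangle)"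
  shows "finite (triangles_in P)"
    and "(\<Sum>g\<in>polygon_maps P lower_triangle. f (g ` lower_triangle)) + (\<Sum>g\<in>polygon_maps P
        upper_triangle. f (g ` upper_triangle))
      = (card (orbit_maps lower_triangle lower_triangle) + card (orbit_maps upper_triangle
          lower_triangle)) * (\<Sum>T\<in>triangles_in P. f T)"
proof -
  have "triangles_in P \<subseteq> (\<lambda>g. g ` lower_triangle) ` polygon_maps P lower_triangle \<union> (\<lambda>g. g `
      upper_triangle) ` polygon_maps P upper_triangle"
  proof
    fix T assume T: "T \<in> triangles_in P"
    then obtain g where "g \<in> carrier torus_group" "T = g ` lower_triangle \<or> T = g ` upper_triangle"
      using torus_group_orbit[of T] by (auto simp: triangles_in_def)
    then show "T \<in> (\<lambda>g. g ` lower_triangle) ` polygon_maps P lower_triangle \<union> (\<lambda>g. g `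
        upper_triangle) ` polygon_maps P upper_triangle"
      using T by (auto simp: polygon_maps_def)
  qed
  then show fin: "finite (triangles_in P)" by (rule finite_subset) (use assms in blast)
  have one: "(\<Sum>g\<in>polygon_maps P S. f (g ` S)) = (\<Sum>T\<in>triangles_in P. card (orbit_maps S T) * f T)"
    if "finite (polygon_maps P S)" for S
  proof -
    have "(\<Sum>g\<in>polygon_maps P S. f (g ` S)) = (\<Sum>T\<in>triangles_in P. card {g \<in> polygon_maps P S. g ` S
        = T} * f T)"
      using sum_fun_comp[OF that fin, of "\<lambda>g. g ` S" f] by (auto simp: polygon_maps_def)
    also have "\<dots> = (\<Sum>T\<in>triangles_in P. card (orbit_maps S T) * f T)"
      by (intro sum.cong refl arg_cong2[where f = "(*)"] arg_cong[where f = "\<lambda>A. real (card A)"])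
        (auto simp: polygon_maps_def orbit_maps_def)
    finally show ?thesis .
  qed
  show "(\<Sum>g\<in>polygon_maps P lower_triangle. f (g ` lower_triangle)) + (\<Sum>g\<in>polygon_maps P
      upper_triangle. f (g ` upper_triangle))
      = (card (orbit_maps lower_triangle lower_triangle) + card (orbit_maps upper_triangle
          lower_triangle)) * (\<Sum>T\<in>triangles_in P. f T)"
    unfolding one[OF assms(1)] one[OF assms(2)] sum.distrib[symmetric] sum_distrib_left
  proof (rule sum.cong[OF refl])
    fix T assume "T \<in> triangles_in P"
    then have "T \<in> farey_triangles" by (simp add: triangles_in_def)
    from card_orbit_maps_sum[OF this]
    show "card (orbit_maps lower_triangle T) * f T + card (orbit_maps upper_triangle T) * f T =
      (card (orbit_maps lower_triangle lower_triangle) + card (orbit_maps upper_triangle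
          lower_triangle)) * f T"
      by (metis distrib_right of_nat_add)
  qed
qed

theorem proposition9p1:
  fixes lam u v :: "ghat \<Rightarrow> edge \<Rightarrow> real"
    and m :: "ghat measure"
    and P :: "nat \<Rightarrow> complex set"
    and N :: nat
  assumes "haar_probability Ghat Ghat_topology m"
    and "\<And>n. n \<ge> N \<Longrightarrow> fundamental_polygon (index_intersection n) (P n)"
    and "\<And>n. n \<ge> N \<Longrightarrow> P n \<subseteq> P (Suc n)"
    and "lam \<in> ContG_pos"
    and "u \<in> ContG"
    and "v \<in> ContG"
  shows "(\<lambda>n. 2 / real (card (triangles_in (P n))) *
            (\<Sum>T\<in>triangles_in (P n).
               triangle_form (lam \<one>\<^bsub>Ghat\<^esub>) (u \<one>\<^bsub>Ghat\<^esub>) (v \<one>\<^bsub>Ghat\<^esub>) T))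
         \<longlonglongrightarrow> weil_petersson_form m lam u v"
proof -
  let ?L = lower_triangle and ?U = upper_triangle
  note LU = lower_triangle_farey upper_triangle_farey
  define \<eta> where "\<eta> = form_at lam u v"
  define \<iota> where "\<iota> = profinite_embedding torus_group"
  obtain n1 where n1: "\<And>k. k \<ge> n1 \<Longrightarrow> index_intersection k \<subseteq> carrier torus_group"
    using index_intersection_subset[OF subgroup_torus_group finite_rcosets_torus_group] by blast
  \<comment> \<open>Below \<open>N\<close> no polygon is given; below \<open>n1\<close> the group
    G_n need not lie in the torus group.\<close>
  define n0 where "n0 = max N n1"
  have K: "index_intersection n \<in> finite_index_normals torus_group" if "n \<ge> n0" for n
    using index_intersection_finite_index_normal n1 that by (simp add: n0_def)
  have poly: "fundamental_polygon (index_intersection n) (P n)" if "n \<ge> n0" for n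
    using assms(2) that by (simp add: n0_def)
  have bij: "bij_betw (\<lambda>g. index_intersection n #>\<^bsub>torus_group\<^esub> g) (polygon_maps (P n) T)
      (rcosets\<^bsub>torus_group\<^esub> (index_intersection n))"
    if "n \<ge> n0" "T \<in> farey_triangles" for n T
    by (rule polygon_maps_transversal[OF poly[OF that(1)] K[OF that(1)] that(2)])
  define avg where "avg T n = (\<Sum>g\<in>polygon_maps (P n) T. \<eta> T (\<iota> g)) / card (polygon_maps (P n) T)"
      for T n
  have sub: "polygon_maps (P n) T \<subseteq> carrier torus_group" for n T by (auto simp: polygon_maps_def)
  have "integrable m (\<eta> T) \<and> avg T \<longlonglongrightarrow> (LINT t|m. \<eta> T t)" if T: "T = ?L \<or> T = ?U" for T
  proof -
    have cont: "continuous_map Ghat_topology euclideanreal (\<eta> T)"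
      unfolding \<eta>_def by (rule continuous_form_at[OF assms(4-6) T])
    have far: "T \<in> farey_triangles" using T LU by auto
    note equi = profinite_equidistribution[where ?n0.0 = n0 and K = index_intersection and R =
        "\<lambda>n. polygon_maps (P n) T",
        OF group_torus_group assms(1) cont K index_intersection_cofinal sub bij[OF _ far]]
    have "avg T \<longlonglongrightarrow> (LINT t|m. \<eta> T t)" unfolding avg_def \<iota>_def by (rule equi(2))
    then show ?thesis using equi(1) by blast
  qed
  then have int: "integrable m (\<eta> ?L)" "integrable m (\<eta> ?U)"
    and lim: "avg ?L \<longlonglongrightarrow> (LINT t|m. \<eta> ?L t)" "avg ?U \<longlonglongrightarrow> (LINT t|m. \<eta> ?U t)"
    by blast+
  have wp: "weil_petersson_form m lam u v = (LINT t|m. \<eta> ?L t) + (LINT t|m. \<eta> ?U t)"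
    unfolding weil_petersson_form_def Bochner_Integration.integral_add[OF int, symmetric]
    by (simp add: \<eta>_def form_at_def[OF assms(4-6)] lower_triangle_def upper_triangle_def)
  have "2 / real (card (triangles_in (P n))) * (\<Sum>T\<in>triangles_in (P n). \<eta> T \<one>\<^bsub>Ghat\<^esub>) = avg ?L n +
      avg ?U n"
    if n: "n \<ge> n0" for n
  proof -
    define c where "c = card (rcosets\<^bsub>torus_group\<^esub> (index_intersection n))"
    define s where "s = real (card (orbit_maps ?L ?L) + card (orbit_maps ?U ?L))"
    define A where "A = triangles_in (P n)"
    have finK: "finite (rcosets\<^bsub>torus_group\<^esub> (index_intersection n))" using K[OF n] by (simp add:
        finite_index_normals_def)
    have fin: "finite (polygon_maps (P n) ?L)" "finite (polygon_maps (P n) ?U)"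
      using bij_betw_finite[OF bij[OF n LU(1)]] bij_betw_finite[OF bij[OF n LU(2)]] finK by auto
    have card: "card (polygon_maps (P n) ?L) = c" "card (polygon_maps (P n) ?U) = c"
      unfolding c_def using bij_betw_same_card[OF bij[OF n LU(1)]] bij_betw_same_card[OF bij[OF n
          LU(2)]] by auto
    have "rcosets\<^bsub>torus_group\<^esub> (index_intersection n) \<noteq> {}"
      unfolding rcosets_image using subgroup.one_closed[OF subgroup_torus_group] by blast
    then have c: "c > 0" unfolding c_def using finK by (simp add: card_gt_0_iff)
    \<comment> \<open>The constant function 1 counts all representations of triangles in the
      polygon: \<open>c\<close> from each base triangle. This is the origin of the factor 2.\<close>
    have "real c + real c = s * real (card A)"
      using sum_over_polygon_maps(2)[OF fin, of "\<lambda>_. 1"] card by (simp add: s_def A_def)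
    then have sA: "2 * real c = s * real (card A)" by simp
    have S: "(\<Sum>g\<in>polygon_maps (P n) T. \<eta> T (\<iota> g)) = (\<Sum>g\<in>polygon_maps (P n) T. \<eta> (g ` T) \<one>\<^bsub>Ghat\<^esub>)"
      if "T = ?L \<or> T = ?U" for T
      unfolding \<eta>_def \<iota>_def
      by (intro sum.cong refl form_at_embedding[OF assms(4-6) that, symmetric]) (simp add:
          polygon_maps_def)
    have "avg ?L n + avg ?U n = ((\<Sum>g\<in>polygon_maps (P n) ?L. \<eta> (g ` ?L) \<one>\<^bsub>Ghat\<^esub>) + (\<Sum>g\<in>polygon_maps
        (P n) ?U. \<eta> (g ` ?U) \<one>\<^bsub>Ghat\<^esub>)) / c"
      unfolding avg_def card using S by (simp add: add_divide_distrib)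
    also have "\<dots> = s * (\<Sum>T\<in>A. \<eta> T \<one>\<^bsub>Ghat\<^esub>) / c"
      using sum_over_polygon_maps(2)[OF fin, of "\<lambda>T. \<eta> T \<one>\<^bsub>Ghat\<^esub>"] by (simp add: s_def A_def)
    also have "\<dots> = 2 / real (card A) * (\<Sum>T\<in>A. \<eta> T \<one>\<^bsub>Ghat\<^esub>)"
    proof -
      \<comment> \<open>As \<open>c\<close> is positive, neither factor vanishes, and
        \<open>s\<close> cancels whatever its value.\<close>
      have "s * real (card A) \<noteq> 0" using sA c by linarith
      then have nz: "s \<noteq> 0" "real (card A) \<noteq> 0" by auto
      have half: "real c = s * real (card A) / 2" using sA by simp
      show ?thesis unfolding half using nz by simp
    qed
    finally show ?thesis by (simp add: A_def)
  qed
  then have "eventually (\<lambda>n. avg ?L n + avg ?U n = 2 / real (card (triangles_in (P n))) *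
      (\<Sum>T\<in>triangles_in (P n). \<eta> T \<one>\<^bsub>Ghat\<^esub>)) sequentially"
    by (intro eventually_sequentiallyI[of n0]) simp
  note limit = Lim_transform_eventually[OF tendsto_add[OF lim] this]
  have "triangle_form (lam \<one>\<^bsub>Ghat\<^esub>) (u \<one>\<^bsub>Ghat\<^esub>) (v \<one>\<^bsub>Ghat\<^esub>) T = \<eta> T \<one>\<^bsub>Ghat\<^esub>" for T
    by (simp add: \<eta>_def form_at_def[OF assms(4-6)])
  then show ?thesis using limit unfolding wp by (simp only:)
qed

end
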